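(* Let $X$ and $Y$ be Banach spaces and let $\Omega$ be a compact Hausdorff space. Let $1\leq p\leq\infty$. Assume that $S\in\mathcal{L}(\mathcal{C}(\Omega),\mathcal{L}(X,Y))$. The following statements are equivalent. (a) There exists an operator $U\in\mathcal{L}(\mathcal{C}_{p}(\Omega,X),Y)$ such that $U^{\#}=S$. (b) There exists a constant $c>0$ such that, for all finite systems $(x_{i})_{i=1}^{n}\subset X$ and $(\varphi_{i})_{i=1}^{n}\subset\mathcal{C}(\Omega)$, \[\|((S\varphi_{i})x_{i})\|_{p'}^{w}\leq c\,\|(x_{i})\|_{\infty}\|(\varphi_{i})\|_{p'}^{w}.\] (b$'$) There exists a constant $c>0$ such that, for all $(x_{i})\in\ell_{\infty}(X)$ and $(\varphi_{i})\in\ell_{p'}^{w}(\mathcal{C}(\Omega))$, and for all $n\in\mathbb{N}$, \[\|((S\varphi_{i})x_{i})_{i=n}^{\infty}\|_{p'}^{w}\leq c\,\|(x_{i})_{i=n}^{\infty}\|_{\infty}\|(\varphi_{i})_{i=n}^{\infty}\|_{p'}^{w}.\] (c) If $(x_{i})\in\ell_{\infty}(X)$ and $(\varphi_{i})\in\ell_{p'}^{w}(\mathcal{C}(\Omega))$, then $((S\varphi_{i})x_{i})\in\ell_{p'}^{w}(Y)$. (d) If $(x_{i})\in c_{0}(X)$ and $(\varphi_{i})\in\ell_{p'}^{w}(\mathcal{C}(\Omega))$, then $((S\varphi_{i})x_{i})\in\ell_{p'}^{u}(Y)$. (d, alternative version) If $(x_{i})\in\ell_{\infty}(X)$ and $(\varphi_{i})\in\ell_{p'}^{u}(\mathcal{C}(\Omega))$,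 then $((S\varphi_{i})x_{i})\in\ell_{p'}^{u}(Y)$.
   Context: All Banach spaces are over the same field $\mathbb{K}$ ($\mathbb{R}$ or $\mathbb{C}$); $\mathcal{L}(X,Y)$ is the Banach space of bounded linear operators; $p'$ is the conjugate index, $1/p+1/p'=1$ with $1/\infty=0$. For $1\le q\le\infty$, $\ell_q^w(X)$ is the Banach space of weakly $q$-summable sequences in $X$ with norm $\|(x_i)\|_q^w=\sup_{x^*\in B_{X^*}}(\sum_i|x^*(x_i)|^q)^{1/q}$ (supremum if $q=\infty$; the same formula for finite systems), and $\ell_q^u(X)$ is its closed subspace of unconditionally $q$-summable sequences, i.e. those $(x_n)\in\ell_q^w(X)$ with $(x_n)=\lim_{N\to\infty}(x_1,\dots,x_N,0,0,\dots)$ in $\ell_q^w(X)$. $\|(x_i)\|_\infty=\sup_i\|x_i\|$. $\mathcal{C}(\Omega)$ and $\mathcal{C}(\Omega,X)$ are the spaces of continuous $\mathbb{K}$-valued and $X$-valued functions on $\Omega$ with the supremum norm. $\mathcal{C}_p(\Omega,X)$, the Banach space of $p$-continuous $X$-valued functions, consists of all $f\in\mathcal{C}(\Omega,X)$ for which there is a sequence $(x_n)\in\ell_p(X)$ (or $(x_n)\in c_0(X)$ when $p=\infty$) with $f(\Omega)\subset\{\sum_n\alpha_nx_n:(\alpha_n)\in B_{\ell_{p'}}\}$, where $B_{\ell_{p'}}$ is the closed unit ball of $\ell_{p'}$; its norm is $\inf\|(x_n)\|_p$ over all such sequences. It is known that $\mathcal{C}_p(\Omega,X)=\mathcal{C}(\Omega)\hat{\otimes}_{d_p}X$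 as Banach spaces via $\varphi x\leftrightarrow\varphi\otimes x$, where $\varphi x$ is the function $\omega\mapsto\varphi(\omega)x$ and $d_p$ is the right Chevet--Saphar tensor norm: for $u\in Z\otimes X$, $d_p(u)=\inf\{\|(z_i)\|_{p'}^w\,\|(x_i)\|_p: u=\sum_{i=1}^n z_i\otimes x_i\}$. For $U\in\mathcal{L}(\mathcal{C}_p(\Omega,X),Y)$, the associated operator $U^{\#}\in\mathcal{L}(\mathcal{C}(\Omega),\mathcal{L}(X,Y))$ is $(U^{\#}\varphi)x=U(\varphi x)$. *)

theory Defs
  imports "HOL-Analysis.Analysis"
begin

section \<open>Scalars and Banach spaces\<close>

text \<open>
  The field \<open>\<K>\<close> is a type variable of the class below, whose members are exactly the real and
  the complex numbers, up to isometric isomorphism: either every element is a real scalar, or there is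
  an imaginary unit \<open>j\<close> such that every element is \<open>a + b j\<close> with real \<open>a, b\<close>, with the usual modulus.
\<close>

class real_or_complex = real_normed_field + banach +
  assumes real_or_complex:
    "(\<forall>z. \<exists>a. z = a *\<^sub>R 1) \<or>
     (\<exists>j. j * j = - 1 \<and>
          (\<forall>z. \<exists>a b. z = a *\<^sub>R 1 + b *\<^sub>R j) \<and>
          (\<forall>a b. norm (a *\<^sub>R 1 + b *\<^sub>R j) = sqrt (a\<^sup>2 + b\<^sup>2)))"

instance real :: real_or_complex
  by standard auto

instance complex :: real_or_complex
proof
  have "(\<forall>z. \<exists>a b. z = a *\<^sub>R 1 + b *\<^sub>R \<i>) \<and>
        (\<forall>a b. norm (a *\<^sub>R 1 + b *\<^sub>R \<i>) = sqrt (a\<^sup>2 + b\<^sup>2))"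
  proof (intro conjI allI)
    fix z :: complex
    have "z = Re z *\<^sub>R 1 + Im z *\<^sub>R \<i>"
      by (simp add: complex_eq_iff)
    then show "\<exists>a b. z = a *\<^sub>R 1 + b *\<^sub>R \<i>"
      by blast
  qed (simp add: cmod_def)
  moreover have "\<i> * \<i> = - 1"
    by simp
  ultimately show "(\<forall>z::complex. \<exists>a. z = a *\<^sub>R 1) \<or>
     (\<exists>j::complex. j * j = - 1 \<and>
          (\<forall>z. \<exists>a b. z = a *\<^sub>R 1 + b *\<^sub>R j) \<and>
          (\<forall>a b. norm (a *\<^sub>R 1 + b *\<^sub>R j) = sqrt (a\<^sup>2 + b\<^sup>2)))"
    by blast
qed

text \<open>
  The class \<^class>\<open>banach\<close> is about real scalars only. A Banach space over \<open>\<K>\<close> is a type of that class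
  with a multiplication by scalars from \<open>\<K>\<close> that is compatible with the norm and extends \<open>scaleR\<close>.
\<close>

locale banach_over = vector_space scale
  for scale :: "'k::real_or_complex \<Rightarrow> 'x::banach \<Rightarrow> 'x" +
  assumes norm_scale: "norm (scale a x) = norm a * norm x"
    and scale_of_real: "scale (of_real r) x = r *\<^sub>R x"

lemma banach_over_scalars: "banach_over ((*) :: 'k::real_or_complex \<Rightarrow> 'k \<Rightarrow> 'k)"
  by unfold_locales (simp_all add: algebra_simps norm_mult scaleR_conv_of_real)

lemma banach_over_scaleR: "banach_over ((*\<^sub>R) :: real \<Rightarrow> 'x::banach \<Rightarrow> 'x)"
  by unfold_locales (simp_all add: algebra_simps)

definition bounded_ops ::
  "('k::real_or_complex \<Rightarrow> 'x::real_normed_vector \<Rightarrow> 'x) \<Rightarrow>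
   ('k \<Rightarrow> 'y::real_normed_vector \<Rightarrow> 'y) \<Rightarrow> ('x \<Rightarrow>\<^sub>L 'y) set"
where
  "bounded_ops sX sY = {T. \<forall>a x. blinfun_apply T (sX a x) = sY a (blinfun_apply T x)}"

definition dual_ball ::
  "('k::real_or_complex \<Rightarrow> 'x::real_normed_vector \<Rightarrow> 'x) \<Rightarrow> ('x \<Rightarrow>\<^sub>L 'k) set"
where
  "dual_ball sX = {f \<in> bounded_ops sX (*). norm f \<le> 1}"


section \<open>Strongly and weakly summable sequences\<close>

text \<open>Conventions of \<^typ>\<open>ennreal\<close>: \<open>inverse \<infinity> = 0\<close> and \<open>inverse 0 = \<infinity>\<close>.\<close>

definition conj_index :: "ennreal \<Rightarrow> ennreal" where
  "conj_index p = inverse (1 - inverse p)"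

lemma conj_index:
  assumes "1 \<le> p"
  shows "inverse p + inverse (conj_index p) = 1"
proof -
  have inv_inv: "inverse (inverse r) = r" for r :: ennreal
    by (cases r; cases "r = 0") (auto simp: inverse_ennreal less_le)
  have "inverse p \<le> 1"
    using assms
    by (cases p) (auto simp: inverse_ennreal inverse_le_1_iff ennreal_le_1 ennreal_1[symmetric]
        simp del: ennreal_1)
  then show ?thesis
    by (simp add: conj_index_def inv_inv)
qed

text \<open>
  The norms take values in \<^typ>\<open>ennreal\<close>, with \<open>\<infinity>\<close> outside the corresponding sequence space. The
  index set \<open>I\<close> accounts for finite systems (\<open>I = {..<n}\<close>), sequences (\<open>I = UNIV\<close>) and tails
  (\<open>I = {n..}\<close>).
\<close>

definition lnorm :: "ennreal \<Rightarrow> nat set \<Rightarrow> (nat \<Rightarrow> 'x::real_normed_vector) \<Rightarrow> ennreal" where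
  "lnorm q I x =
    (if q = \<infinity> then (SUP i\<in>I. ennreal (norm (x i)))
     else let s = (\<Sum>\<^sub>\<infinity>i\<in>I. ennreal (norm (x i) powr enn2real q))
          in if s = \<infinity> then \<infinity> else ennreal (enn2real s powr (1 / enn2real q)))"

definition ell :: "ennreal \<Rightarrow> (nat \<Rightarrow> 'x::real_normed_vector) set" where
  "ell q = {x. lnorm q UNIV x < \<infinity>}"

definition c_zero :: "(nat \<Rightarrow> 'x::real_normed_vector) set" where
  "c_zero = {x. x \<longlonglongrightarrow> 0}"

definition wnorm ::
  "('k::real_or_complex \<Rightarrow> 'x::real_normed_vector \<Rightarrow> 'x) \<Rightarrow> ennreal \<Rightarrow> nat set \<Rightarrow> (nat \<Rightarrow> 'x) \<Rightarrow> ennreal"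
where
  "wnorm sX q I x = (SUP f\<in>dual_ball sX. lnorm q I (\<lambda>i. blinfun_apply f (x i)))"

definition ell_w ::
  "('k::real_or_complex \<Rightarrow> 'x::real_normed_vector \<Rightarrow> 'x) \<Rightarrow> ennreal \<Rightarrow> (nat \<Rightarrow> 'x) set"
where
  "ell_w sX q = {x. \<forall>f\<in>bounded_ops sX (*). (\<lambda>i. blinfun_apply f (x i)) \<in> ell q}"

definition ell_u ::
  "('k::real_or_complex \<Rightarrow> 'x::real_normed_vector \<Rightarrow> 'x) \<Rightarrow> ennreal \<Rightarrow> (nat \<Rightarrow> 'x) set"
where
  "ell_u sX q =
    {x \<in> ell_w sX q. (\<lambda>N. wnorm sX q UNIV (\<lambda>i. x i - (if i < N then x i else 0))) \<longlonglongrightarrow> 0}"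


section \<open>Continuous and \<open>p\<close>-continuous functions\<close>

text \<open>
  On a compact space, bounded continuous functions are the same as continuous functions, so
  \<open>\<C>(\<Omega>)\<close> and \<open>\<C>(\<Omega>,X)\<close> are \<^typ>\<open>'w \<Rightarrow>\<^sub>C 'k\<close> and \<^typ>\<open>'w \<Rightarrow>\<^sub>C 'x\<close>, with the supremum norm.
\<close>

definition scaleC ::
  "('k::real_or_complex \<Rightarrow> 'x::real_normed_vector \<Rightarrow> 'x) \<Rightarrow>
   'k \<Rightarrow> ('w::topological_space \<Rightarrow>\<^sub>C 'x) \<Rightarrow> ('w \<Rightarrow>\<^sub>C 'x)"
where
  "scaleC sX a f = Bcontfun (\<lambda>\<omega>. sX a (apply_bcontfun f \<omega>))"

definition fun_times ::
  "('k::real_or_complex \<Rightarrow> 'x::real_normed_vector \<Rightarrow> 'x) \<Rightarrow>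
   ('w::topological_space \<Rightarrow>\<^sub>C 'k) \<Rightarrow> 'x \<Rightarrow> ('w \<Rightarrow>\<^sub>C 'x)"
where
  "fun_times sX \<phi> x = Bcontfun (\<lambda>\<omega>. sX (apply_bcontfun \<phi> \<omega>) x)"

context banach_over
begin

lemma bounded_bilinear_scale: "bounded_bilinear scale"
proof
  show "scale (r *\<^sub>R a) x = r *\<^sub>R scale a x" for r a x
    by (metis scaleR_conv_of_real scale_of_real scale_scale)
  show "scale a (r *\<^sub>R x) = r *\<^sub>R scale a x" for r a x
    by (metis scale_of_real scale_left_commute)
  show "\<exists>K. \<forall>a x. norm (scale a x) \<le> norm a * norm x * K"
    by (rule exI[of _ 1]) (simp add: norm_scale)
qed (simp_all add: scale_left_distrib scale_right_distrib)

lemma apply_scaleC: "apply_bcontfun (scaleC scale a f) \<omega> = scale a (apply_bcontfun f \<omega>)"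
proof -
  have "(\<lambda>\<omega>. scale a (apply_bcontfun f \<omega>)) \<in> bcontfun"
    unfolding bcontfun_def mem_Collect_eq
  proof
    show "continuous_on UNIV (\<lambda>\<omega>. scale a (apply_bcontfun f \<omega>))"
      by (intro bounded_bilinear.continuous_on[OF bounded_bilinear_scale] continuous_intros) simp
    show "bounded (range (\<lambda>\<omega>. scale a (apply_bcontfun f \<omega>)))"
      by (rule boundedI[where B = "norm a * norm f"])
        (auto simp: norm_scale intro!: mult_left_mono norm_bounded)
  qed
  then show ?thesis
    by (simp add: scaleC_def Bcontfun_inverse)
qed

lemma apply_fun_times: "apply_bcontfun (fun_times scale \<phi> x) \<omega> = scale (apply_bcontfun \<phi> \<omega>) x"
proof -
  have "(\<lambda>\<omega>. scale (apply_bcontfun \<phi> \<omega>) x) \<in> bcontfun"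
    unfolding bcontfun_def mem_Collect_eq
  proof
    show "continuous_on UNIV (\<lambda>\<omega>. scale (apply_bcontfun \<phi> \<omega>) x)"
      by (intro bounded_bilinear.continuous_on[OF bounded_bilinear_scale] continuous_intros) simp
    show "bounded (range (\<lambda>\<omega>. scale (apply_bcontfun \<phi> \<omega>) x))"
      by (rule boundedI[where B = "norm \<phi> * norm x"])
        (auto simp: norm_scale intro!: mult_right_mono norm_bounded)
  qed
  then show ?thesis
    by (simp add: fun_times_def Bcontfun_inverse)
qed

end

definition Cp_dominates ::
  "('k::real_or_complex \<Rightarrow> 'x::real_normed_vector \<Rightarrow> 'x) \<Rightarrow> ennreal \<Rightarrow>
   ('w::topological_space \<Rightarrow>\<^sub>C 'x) \<Rightarrow> (nat \<Rightarrow> 'x) \<Rightarrow> bool"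
where
  "Cp_dominates sX p f x \<longleftrightarrow>
    x \<in> (if p = \<infinity> then c_zero else ell p) \<and>
    range (apply_bcontfun f) \<subseteq>
      {y. \<exists>\<alpha>::nat \<Rightarrow> 'k. lnorm (conj_index p) UNIV \<alpha> \<le> 1 \<and> (\<lambda>n. sX (\<alpha> n) (x n)) sums y}"

definition Cp ::
  "('k::real_or_complex \<Rightarrow> 'x::real_normed_vector \<Rightarrow> 'x) \<Rightarrow> ennreal \<Rightarrow>
   ('w::topological_space \<Rightarrow>\<^sub>C 'x) set"
where
  "Cp sX p = {f. \<exists>x. Cp_dominates sX p f x}"

definition Cp_norm ::
  "('k::real_or_complex \<Rightarrow> 'x::real_normed_vector \<Rightarrow> 'x) \<Rightarrow> ennreal \<Rightarrow>
   ('w::topological_space \<Rightarrow>\<^sub>C 'x) \<Rightarrow> ennreal"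
where
  "Cp_norm sX p f = (INF x\<in>{x. Cp_dominates sX p f x}. lnorm p UNIV x)"

text \<open>
  \<open>\<L>(\<C>\<^sub>p(\<Omega>,X),Y)\<close>. Since \<open>\<C>\<^sub>p(\<Omega>,X)\<close> is a set of functions with a norm of its own, its operators are
  functions on the ambient type, of which only the restriction to \<open>\<C>\<^sub>p(\<Omega>,X)\<close> matters.
\<close>

definition Cp_ops ::
  "('k::real_or_complex \<Rightarrow> 'x::real_normed_vector \<Rightarrow> 'x) \<Rightarrow>
   ('k \<Rightarrow> 'y::real_normed_vector \<Rightarrow> 'y) \<Rightarrow> ennreal \<Rightarrow>
   (('w::topological_space \<Rightarrow>\<^sub>C 'x) \<Rightarrow> 'y) set"
where
  "Cp_ops sX sY p =
    {U. (\<forall>f\<in>Cp sX p. \<forall>g\<in>Cp sX p. U (f + g) = U f + U g) \<and>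
        (\<forall>a. \<forall>f\<in>Cp sX p. U (scaleC sX a f) = sY a (U f)) \<and>
        (\<exists>K::real. \<forall>f\<in>Cp sX p. ennreal (norm (U f)) \<le> ennreal K * Cp_norm sX p f)}"

text \<open>\<open>\<L>(\<C>(\<Omega>),\<L>(X,Y))\<close>; the second condition is \<open>\<K>\<close>-homogeneity, \<open>S (a \<phi>) = a (S \<phi>)\<close>.\<close>

definition C_op_ops ::
  "('k::real_or_complex \<Rightarrow> 'x::real_normed_vector \<Rightarrow> 'x) \<Rightarrow>
   ('k \<Rightarrow> 'y::real_normed_vector \<Rightarrow> 'y) \<Rightarrow>
   (('w::topological_space \<Rightarrow>\<^sub>C 'k) \<Rightarrow>\<^sub>L ('x \<Rightarrow>\<^sub>L 'y)) set"
where
  "C_op_ops sX sY =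
    {S. (\<forall>\<phi>. blinfun_apply S \<phi> \<in> bounded_ops sX sY) \<and>
        (\<forall>a \<phi> x. blinfun_apply (blinfun_apply S (scaleC (*) a \<phi>)) x =
                  sY a (blinfun_apply (blinfun_apply S \<phi>) x))}"

definition sharp ::
  "('k::real_or_complex \<Rightarrow> 'x::real_normed_vector \<Rightarrow> 'x) \<Rightarrow>
   (('w::topological_space \<Rightarrow>\<^sub>C 'x) \<Rightarrow> 'y) \<Rightarrow> ('w \<Rightarrow>\<^sub>C 'k) \<Rightarrow> 'x \<Rightarrow> 'y"
where
  "sharp sX U \<phi> x = U (fun_times sX \<phi> x)"

end

theory Submission
  imports Defs
begin

text \<open>
  A bounded operator on \<open>\<C>\<^sub>p(\<Omega>,X)\<close> satisfies (b) because \<open>\<Sum>\<^sub>i \<phi>\<^sub>i x\<^sub>i\<close> takes its values in a multiple of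
  \<open>{\<Sum>\<^sub>i \<alpha>\<^sub>i x\<^sub>i | \<alpha> \<in> B(\<ell>\<^sub>q)}\<close>, so that its norm is at most the weak \<open>q\<close>-norm of \<open>\<phi>\<close> times the \<open>p\<close>-norm
  of \<open>x\<close>; duality between \<open>\<ell>\<^sub>p\<close> and \<open>\<ell>\<^sub>q\<close> does the rest. Conversely, given (b), the operator is
  obtained without tensor products as \<open>U f = lim \<Sum>\<^sub>j S(h\<^sub>j) f(w\<^sub>j)\<close>, a limit over partitions of unity \<open>(h\<^sub>j)\<close>
  with sample points \<open>(w\<^sub>j)\<close>. If \<open>f(w\<^sub>j) = \<Sum>\<^sub>n \<alpha>\<^sub>j\<^sub>n x\<^sub>n\<close> with \<open>\<alpha>\<^sub>j\<close> in the ball of \<open>\<ell>\<^sub>q\<close>, then the sum equals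
  \<open>\<Sum>\<^sub>n S(\<Sum>\<^sub>j \<alpha>\<^sub>j\<^sub>n h\<^sub>j) x\<^sub>n\<close>, and by convexity (b) bounds it by \<open>c\<close> times the \<open>p\<close>-norm of \<open>x\<close>. The same
  estimate, applied to \<open>f(w\<^sub>j) - f(w'\<^sub>k)\<close>, gives convergence once these differences have coefficients
  whose first coordinates are small, and that is a compactness argument.

  Each of (c), (d) and its alternative implies (b): if (b) fails, then finite systems that violate it
  with larger and larger constants, scaled by \<open>2\<^sup>-\<^sup>k\<close>, are put together to \<open>x\<close> in \<open>c\<^sub>0\<close> and an
  unconditionally \<open>q\<close>-summable \<open>\<phi>\<close> for which \<open>(S(\<phi>\<^sub>i) x\<^sub>i)\<close> is not weakly \<open>q\<close>-summable.
\<close>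


section \<open>Duality of the sequence norms\<close>

text \<open>The limit defining \<open>U f\<close> is taken in \<open>Y\<close> only; no
  approximation of \<open>f\<close> in the norm of C_p enters. The obstacle is that (b) controls
  sums of values of \<open>S\<close> through the p-norm of a family of vectors, so sample values
  that are merely close in \<open>X\<close> do not make two sums close. Their differences are
  therefore expanded along \<open>x\<close> and split at an index \<open>N\<close>: beyond
  \<open>N\<close> the vectors have small p-norm, before \<open>N\<close> the coefficients must be
  small. Expansions are not unique, so small coefficients cannot be read off given ones; they arise
  by subtracting an expansion of 0. Only finitely many sample points occur at a time, so
  coefficients may depend on the point in any way. Norm bounds have the form
  \<open>lnorm p I x \<le> ennreal C\<close>, which amounts to a family of finite inequalities with
  nonnegative real weights. This treats 1, infinity and the indices in between alike, and makes
  convexity and closedness of balls immediate. In the construction for the converse, both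
  \<open>x\<close> and \<open>\<phi>\<close> carry the factor 2^-k. That costs 4^k, so the violated
  constants are 8^k and an excess of 2^k remains.\<close>

lemma conj_index_cases [consumes 1, case_names one infinity real]:
  assumes "1 \<le> p"
  obtains "p = 1" "conj_index p = \<infinity>"
    | "p = \<infinity>" "conj_index p = 1"
    | r s where "p = ennreal r" "conj_index p = ennreal s" "1 < r" "1 < s" "1 / r + 1 / s = 1"
proof (cases "p = \<infinity>")
  case True
  then show ?thesis
    using that(2) by (simp add: conj_index_def)
next
  case False
  then obtain r where r: "p = ennreal r" "0 \<le> r"
    by (cases p) auto
  have r1: "1 \<le> r"
    using assms r by (simp flip: ennreal_1)
  show ?thesis
  proof (cases "r = 1")
    case True
    then show ?thesis
      using that(1) r by (simp add: conj_index_def)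
  next
    case False
    then have "1 < r"
      using r1 by simp
    define s where "s = r / (r - 1)"
    have "1 - inverse p = ennreal (1 - inverse r)"
      using \<open>1 < r\<close> r by (simp add: inverse_ennreal ennreal_minus flip: ennreal_1)
    moreover have "1 - inverse r > 0"
      using \<open>1 < r\<close> by (simp add: field_simps)
    moreover have "inverse (1 - inverse r) = s"
      using \<open>1 < r\<close> by (simp add: s_def field_simps)
    ultimately have "conj_index p = ennreal s"
      by (simp add: conj_index_def inverse_ennreal)
    moreover have "1 < s" "1 / r + 1 / s = 1"
      using \<open>1 < r\<close> by (auto simp: s_def field_simps)
    ultimately show ?thesis
      using that(3) r \<open>1 < r\<close> by blast
  qed
qed

lemma one_le_conj_index:
  assumes "1 \<le> p"
  shows "1 \<le> conj_index p"
  using assms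
  by (cases rule: conj_index_cases) (auto simp flip: ennreal_1 intro: ennreal_leI)

lemma conj_index_conj_index:
  assumes "1 \<le> p"
  shows "conj_index (conj_index p) = p"
  using assms
proof (cases rule: conj_index_cases)
  case (real r s)
  have "1 - inverse (ennreal s) = ennreal (1 - inverse s)"
    using \<open>1 < s\<close> by (simp add: inverse_ennreal ennreal_minus flip: ennreal_1)
  moreover have "1 - inverse s = inverse r"
    using real(5) by (simp add: field_simps)
  ultimately show ?thesis
    using real by (simp add: conj_index_def[of "ennreal s"] inverse_ennreal)
qed (simp_all add: conj_index_def)

section \<open>Sequence norms as families of finite real inequalities\<close>

lemma lnorm_infinity_le_iff:
  assumes "0 \<le> C"
  shows "lnorm \<infinity> I x \<le> ennreal C \<longleftrightarrow> (\<forall>i\<in>I. norm (x i) \<le> C)"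
  using assms by (auto simp: lnorm_def SUP_le_iff)

text \<open>An infinite sum of nonnegative terms is the supremum of its finite partial sums, and
  \<open>powr r\<close> is monotone. This removes the case distinction at infinity from
  \<open>lnorm\<close>.\<close>

lemma lnorm_real_le_iff:
  assumes r: "1 \<le> r" and C: "0 \<le> C"
  shows "lnorm (ennreal r) I x \<le> ennreal C \<longleftrightarrow>
    (\<forall>F. finite F \<and> F \<subseteq> I \<longrightarrow> (\<Sum>i\<in>F. norm (x i) powr r) \<le> C powr r)"
proof -
  define s where "s = (\<Sum>\<^sub>\<infinity>i\<in>I. ennreal (norm (x i) powr r))"
  have "s = (SUP F\<in>{F. finite F \<and> F \<subseteq> I}. (\<Sum>i\<in>F. ennreal (norm (x i) powr r)))"
    unfolding s_def by (intro nonneg_infsum_complete) simp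
  then have *: "s \<le> ennreal (C powr r) \<longleftrightarrow>
      (\<forall>F. finite F \<and> F \<subseteq> I \<longrightarrow> (\<Sum>i\<in>F. norm (x i) powr r) \<le> C powr r)"
    by (auto simp: SUP_le_iff sum_ennreal)
  have lnorm: "lnorm (ennreal r) I x = (if s = \<infinity> then \<infinity> else ennreal (enn2real s powr (1 / r)))"
    using r by (simp add: lnorm_def s_def)
  have "lnorm (ennreal r) I x \<le> ennreal C \<longleftrightarrow> s \<le> ennreal (C powr r)"
  proof (cases s)
    case top
    then show ?thesis
      by (simp add: lnorm top_unique)
  next
    case (real t)
    have "t powr (1 / r) \<le> C \<longleftrightarrow> t \<le> C powr r"
    proof
      assume "t powr (1 / r) \<le> C"
      then have "(t powr (1 / r)) powr r \<le> C powr r"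
        using r by (intro powr_mono2) auto
      then show "t \<le> C powr r"
        using r real by (simp add: powr_powr)
    next
      assume "t \<le> C powr r"
      then have "t powr (1 / r) \<le> (C powr r) powr (1 / r)"
        using r real by (intro powr_mono2) auto
      then show "t powr (1 / r) \<le> C"
        using r C by (simp add: powr_powr)
    qed
    then show ?thesis
      using real C by (simp add: lnorm)
  qed
  then show ?thesis
    using * by simp
qed

lemma lnorm_one_le_iff:
  assumes C: "0 \<le> C"
  shows "lnorm 1 I x \<le> ennreal C \<longleftrightarrow>
    (\<forall>F. finite F \<and> F \<subseteq> I \<longrightarrow> (\<Sum>i\<in>F. norm (x i)) \<le> C)"
  using lnorm_real_le_iff[of 1 C I x] C by simp

text \<open>Hoelder's inequality on a finite set together with its sharpness. One direction is
  Young's inequality applied termwise to \<open>a i / C\<close>; the other tests with the extremal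
  weight.\<close>

lemma powr_sum_le_dual:
  fixes a :: "'a \<Rightarrow> real"
  assumes r: "1 < r" and s: "1 < s" and rs: "1 / r + 1 / s = 1"
    and F: "finite F" and a: "\<And>i. i \<in> F \<Longrightarrow> 0 \<le> a i" and C: "0 \<le> C"
  shows "(\<Sum>i\<in>F. a i powr s) \<le> C powr s \<longleftrightarrow>
    (\<forall>\<mu>. (\<forall>i. 0 \<le> \<mu> i) \<and> (\<Sum>i\<in>F. \<mu> i powr r) \<le> 1 \<longrightarrow> (\<Sum>i\<in>F. \<mu> i * a i) \<le> C)"
proof (intro iffI allI impI)
  fix \<mu> :: "'a \<Rightarrow> real"
  assume le: "(\<Sum>i\<in>F. a i powr s) \<le> C powr s"
    and \<mu>: "(\<forall>i. 0 \<le> \<mu> i) \<and> (\<Sum>i\<in>F. \<mu> i powr r) \<le> 1"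
  show "(\<Sum>i\<in>F. \<mu> i * a i) \<le> C"
  proof (cases "C = 0")
    case True
    then have "(\<Sum>i\<in>F. a i powr s) \<le> 0"
      using le s by simp
    then have "(\<Sum>i\<in>F. a i powr s) = 0"
      by (meson antisym powr_ge_zero sum_nonneg)
    then have "a i = 0" if "i \<in> F" for i
      using that F by (simp add: sum_nonneg_eq_0_iff)
    then show ?thesis
      using True by simp
  next
    case False
    then have C0: "0 < C"
      using C by simp
    have "(\<Sum>i\<in>F. \<mu> i * (a i / C)) \<le> (\<Sum>i\<in>F. \<mu> i powr r / r + (a i / C) powr s / s)"
      using r s rs a \<mu> C0 by (intro sum_mono Youngs_inequality) auto
    also have "\<dots> = (\<Sum>i\<in>F. \<mu> i powr r) / r + (\<Sum>i\<in>F. a i powr s) / C powr s / s"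
      using a C0 by (simp add: sum.distrib powr_divide flip: sum_divide_distrib)
    also have "\<dots> \<le> 1 / r + 1 / s"
      using \<mu> le C0 r s by (intro add_mono divide_right_mono) auto
    finally show ?thesis
      using rs C0 by (simp add: field_simps flip: sum_divide_distrib)
  qed
next
  assume dual: "\<forall>\<mu>. (\<forall>i. 0 \<le> \<mu> i) \<and> (\<Sum>i\<in>F. \<mu> i powr r) \<le> 1 \<longrightarrow> (\<Sum>i\<in>F. \<mu> i * a i) \<le> C"
  define A where "A = (\<Sum>i\<in>F. a i powr s)"
  have "0 \<le> A"
    by (simp add: A_def sum_nonneg)
  show "(\<Sum>i\<in>F. a i powr s) \<le> C powr s"
  proof (cases "A = 0")
    case True
    then show ?thesis
      by (simp flip: A_def)
  next
    case False
    then have A: "0 < A"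
      using \<open>0 \<le> A\<close> by simp
    have e: "(s - 1) * r = s"
      using rs r s by (simp add: field_simps)
    have e': "1 - 1 / r = 1 / s"
      using rs by simp
    \<comment> \<open>The equality case of Hoelder: since \<open>(s - 1) * r = s\<close>, this
      weight has r-norm 1, and its pairing with \<open>a\<close> is
      \<open>A powr (1 - 1 / r)\<close>, the s-norm of \<open>a\<close>.\<close>
    define \<mu> where "\<mu> i = a i powr (s - 1) / A powr (1 / r)" for i
    have "(\<Sum>i\<in>F. \<mu> i powr r) = (\<Sum>i\<in>F. a i powr s / A)"
      using a A e r by (intro sum.cong) (auto simp: \<mu>_def powr_divide powr_powr)
    also have "\<dots> = 1"
      using A by (simp add: A_def flip: sum_divide_distrib)
    finally have "(\<Sum>i\<in>F. \<mu> i powr r) \<le> 1"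
      by simp
    moreover have "\<forall>i. 0 \<le> \<mu> i"
      by (simp add: \<mu>_def)
    ultimately have le: "(\<Sum>i\<in>F. \<mu> i * a i) \<le> C"
      using dual by blast
    have "\<mu> i * a i = a i powr s / A powr (1 / r)" if "i \<in> F" for i
      using a[OF that] powr_mult_base[OF a[OF that], of "s - 1"] by (simp add: \<mu>_def mult.commute)
    then have "(\<Sum>i\<in>F. \<mu> i * a i) = A / A powr (1 / r)"
      by (simp add: A_def flip: sum_divide_distrib)
    moreover have "A / A powr (1 / r) = A powr (1 / s)"
      using A powr_diff[of A 1 "1 / r"] e' by simp
    ultimately have "(A powr (1 / s)) powr s \<le> C powr s"
      using s le by (intro powr_mono2) auto
    then show ?thesis
      using s A by (simp add: powr_powr flip: A_def)
  qed
qed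

lemma sum_finite_subsets_le_iff:
  fixes f :: "'a \<Rightarrow> real"
  assumes "finite F" "\<And>i. i \<in> F \<Longrightarrow> 0 \<le> f i"
  shows "(\<forall>G. finite G \<and> G \<subseteq> F \<longrightarrow> sum f G \<le> C) \<longleftrightarrow> sum f F \<le> C"
  using assms sum_mono2[of F _ f] by (meson DiffD1 order_refl order_trans)

text \<open>The norm is a supremum of sums that are linear and increasing in the numbers
  \<open>norm (x i)\<close>. Nonnegative real weights suffice because only norms are paired, so the
  values may lie in any normed space. At the endpoints the extremal tests are a point mass and the
  constant 1.\<close>

lemma lnorm_conj_index_le_iff_dual:
  fixes x :: "nat \<Rightarrow> 'x::real_normed_vector"
  assumes p: "1 \<le> p" and C: "0 \<le> C"
  shows "lnorm (conj_index p) I x \<le> ennreal C \<longleftrightarrow>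
    (\<forall>F (\<mu>::nat \<Rightarrow> real). finite F \<and> F \<subseteq> I \<and> (\<forall>i. 0 \<le> \<mu> i) \<and> lnorm p F \<mu> \<le> 1 \<longrightarrow>
      (\<Sum>i\<in>F. \<mu> i * norm (x i)) \<le> C)"
  using p
proof (cases rule: conj_index_cases)
  case one
  have *: "lnorm p F \<mu> \<le> 1 \<longleftrightarrow> (\<Sum>i\<in>F. \<mu> i) \<le> 1" if "\<forall>i. 0 \<le> \<mu> i" "finite F"
    for \<mu> :: "nat \<Rightarrow> real" and F
    using lnorm_one_le_iff[of 1 F \<mu>] that one sum_finite_subsets_le_iff[of F \<mu> 1] by simp
  show ?thesis
    unfolding one(2) lnorm_infinity_le_iff[OF C]
  proof (intro iffI allI impI ballI; (elim conjE)?)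
    fix F and \<mu> :: "nat \<Rightarrow> real"
    assume le: "\<forall>i\<in>I. norm (x i) \<le> C" and F: "finite F" "F \<subseteq> I" and \<mu>: "\<forall>i. 0 \<le> \<mu> i" "lnorm p F \<mu> \<le> 1"
    have "(\<Sum>i\<in>F. \<mu> i * norm (x i)) \<le> (\<Sum>i\<in>F. \<mu> i * C)"
      using le F \<mu> by (intro sum_mono mult_left_mono) auto
    also have "\<dots> = (\<Sum>i\<in>F. \<mu> i) * C"
      by (simp add: sum_distrib_right)
    also have "\<dots> \<le> 1 * C"
      using * F \<mu> C by (intro mult_right_mono) auto
    finally show "(\<Sum>i\<in>F. \<mu> i * norm (x i)) \<le> C"
      by simp
  next
    fix i
    assume dual: "\<forall>F (\<mu>::nat \<Rightarrow> real). finite F \<and> F \<subseteq> I \<and> (\<forall>i. 0 \<le> \<mu> i) \<and> lnorm p F \<mu> \<le> 1 \<longrightarrow>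
      (\<Sum>i\<in>F. \<mu> i * norm (x i)) \<le> C" and "i \<in> I"
    then show "norm (x i) \<le> C"
      using dual[rule_format, of "{i}" "\<lambda>_. 1"] * by simp
  qed
next
  case infinity
  have *: "lnorm p F \<mu> \<le> 1 \<longleftrightarrow> (\<forall>i\<in>F. \<bar>\<mu> i\<bar> \<le> 1)" for \<mu> :: "nat \<Rightarrow> real" and F
    using lnorm_infinity_le_iff[of 1 F \<mu>] infinity by simp
  show ?thesis
    unfolding infinity(2) lnorm_one_le_iff[OF C]
  proof (intro iffI allI impI; elim conjE)
    fix F and \<mu> :: "nat \<Rightarrow> real"
    assume le: "\<forall>F. finite F \<and> F \<subseteq> I \<longrightarrow> (\<Sum>i\<in>F. norm (x i)) \<le> C"
      and F: "finite F" "F \<subseteq> I" and \<mu>: "\<forall>i. 0 \<le> \<mu> i" "lnorm p F \<mu> \<le> 1"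
    have "(\<Sum>i\<in>F. \<mu> i * norm (x i)) \<le> (\<Sum>i\<in>F. 1 * norm (x i))"
      using \<mu> * by (intro sum_mono mult_right_mono) auto
    then show "(\<Sum>i\<in>F. \<mu> i * norm (x i)) \<le> C"
      using le F by fastforce
  next
    fix F
    assume dual: "\<forall>F (\<mu>::nat \<Rightarrow> real). finite F \<and> F \<subseteq> I \<and> (\<forall>i. 0 \<le> \<mu> i) \<and> lnorm p F \<mu> \<le> 1 \<longrightarrow>
      (\<Sum>i\<in>F. \<mu> i * norm (x i)) \<le> C" and "finite F" "F \<subseteq> I"
    then show "(\<Sum>i\<in>F. norm (x i)) \<le> C"
      using dual[rule_format, of F "\<lambda>_. 1"] * by simp
  qed
next
  case (real r s)
  have *: "lnorm p F \<mu> \<le> 1 \<longleftrightarrow> (\<Sum>i\<in>F. \<mu> i powr r) \<le> 1" if "\<forall>i. 0 \<le> \<mu> i" "finite F"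
    for \<mu> :: "nat \<Rightarrow> real" and F
    using lnorm_real_le_iff[of r 1 F \<mu>] that real
      sum_finite_subsets_le_iff[of F "\<lambda>i. \<mu> i powr r" 1] by simp
  show ?thesis
    unfolding real(2) lnorm_real_le_iff[OF less_imp_le[OF \<open>1 < s\<close>] C]
    using powr_sum_le_dual[OF real(3-5) _ _ C, of _ "\<lambda>i. norm (x i)"] *
    by (smt (verit, best) norm_ge_zero)
qed

lemma lnorm_le_iff_dual:
  fixes x :: "nat \<Rightarrow> 'x::real_normed_vector"
  assumes "1 \<le> p" "0 \<le> C"
  shows "lnorm p I x \<le> ennreal C \<longleftrightarrow>
    (\<forall>F (\<mu>::nat \<Rightarrow> real). finite F \<and> F \<subseteq> I \<and> (\<forall>i. 0 \<le> \<mu> i) \<and> lnorm (conj_index p) F \<mu> \<le> 1 \<longrightarrow>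
      (\<Sum>i\<in>F. \<mu> i * norm (x i)) \<le> C)"
  using lnorm_conj_index_le_iff_dual[OF one_le_conj_index, of p C I x] assms by (simp add: conj_index_conj_index)

lemma ennreal_le_by_real_bounds:
  fixes a b :: ennreal
  assumes "\<And>C. 0 \<le> C \<Longrightarrow> b \<le> ennreal C \<Longrightarrow> a \<le> ennreal C"
  shows "a \<le> b"
  using assms by (cases b) auto

lemma lnorm_scale_le:
  assumes p: "1 \<le> p" and C: "0 \<le> C" "lnorm p I x \<le> ennreal C"
    and a: "0 \<le> a" "\<And>i. i \<in> I \<Longrightarrow> norm (y i) \<le> a * norm (x i)"
  shows "lnorm p I y \<le> ennreal (a * C)"
proof -
  have "0 \<le> a * C"
    using a C by simp
  then show ?thesis
    unfolding lnorm_le_iff_dual[OF p \<open>0 \<le> a * C\<close>]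
  proof (intro allI impI, elim conjE)
    fix F and \<mu> :: "nat \<Rightarrow> real"
    assume F: "finite F" "F \<subseteq> I" and \<mu>: "\<forall>i. 0 \<le> \<mu> i" "lnorm (conj_index p) F \<mu> \<le> 1"
    have "(\<Sum>i\<in>F. \<mu> i * norm (y i)) \<le> (\<Sum>i\<in>F. \<mu> i * (a * norm (x i)))"
      using F \<mu> a by (intro sum_mono mult_left_mono) auto
    also have "\<dots> = a * (\<Sum>i\<in>F. \<mu> i * norm (x i))"
      by (simp add: sum_distrib_left mult.left_commute)
    also have "\<dots> \<le> a * C"
      using lnorm_le_iff_dual[OF p C(1), of I x] C F \<mu> a by (intro mult_left_mono) auto
    finally show "(\<Sum>i\<in>F. \<mu> i * norm (y i)) \<le> a * C" .
  qed
qed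

lemma lnorm_mono:
  assumes p: "1 \<le> p" and IJ: "I \<subseteq> J" and le: "\<And>i. i \<in> I \<Longrightarrow> norm (y i) \<le> norm (x i)"
  shows "lnorm p I y \<le> lnorm p J x"
proof (rule ennreal_le_by_real_bounds)
  fix C :: real
  assume C: "0 \<le> C" "lnorm p J x \<le> ennreal C"
  have "lnorm p I x \<le> ennreal C"
    using lnorm_le_iff_dual[OF p C(1), of J x, THEN iffD1, OF C(2)] IJ
    unfolding lnorm_le_iff_dual[OF p C(1)] by (meson subset_trans)
  from lnorm_scale_le[OF p C(1) this, of 1 y] le show "lnorm p I y \<le> ennreal C"
    by simp
qed

lemma lnorm_Hoelder:
  fixes x :: "nat \<Rightarrow> 'x::real_normed_vector" and y :: "nat \<Rightarrow> 'y::real_normed_vector"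
  assumes p: "1 \<le> p" and F: "finite F" and L: "0 \<le> L" "lnorm p F y \<le> ennreal L"
    and C: "0 \<le> C" "lnorm (conj_index p) F x \<le> ennreal C"
  shows "(\<Sum>i\<in>F. norm (y i) * norm (x i)) \<le> L * C"
proof -
  \<comment> \<open>The dual criterion wants a weight of norm at most 1, and \<open>L\<close> may be
    0. Dividing by any \<open>K > L\<close> avoids this; then \<open>K\<close> decreases to
    \<open>L\<close>.\<close>
  have *: "(\<Sum>i\<in>F. norm (y i) * norm (x i)) \<le> K * C" if "L < K" for K
  proof -
    have K: "0 < K"
      using that L by simp
    have "lnorm p F (\<lambda>i. norm (y i) / K) \<le> ennreal (1 / K * L)"
      using K by (intro lnorm_scale_le[OF p L]) auto
    also have "\<dots> \<le> 1"
      using that K by (simp flip: ennreal_1 add: ennreal_leI)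
    finally have "(\<Sum>i\<in>F. norm (y i) / K * norm (x i)) \<le> C"
      using lnorm_conj_index_le_iff_dual[OF p C(1), of F x, THEN iffD1, OF C(2), rule_format, of F "\<lambda>i. norm (y i) / K"]
        F K by simp
    then show ?thesis
      using K by (simp add: field_simps flip: sum_divide_distrib)
  qed
  have "((\<lambda>K. K * C) \<longlongrightarrow> L * C) (at_right L)"
    by (intro tendsto_intros)
  then show ?thesis
    by (rule tendsto_lowerbound) (auto simp: eventually_at_right_less intro!: eventually_mono[OF eventually_at_right_less] *)
qed

text \<open>Each test is linear in the norms, so balls are convex. Later \<open>t j\<close> is the
  modulus of a partition function at a fixed point, hence a total weight of at most 1.\<close>

lemma lnorm_convex_le:
  assumes p: "1 \<le> p" and C: "0 \<le> C" and J: "finite J"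
    and \<gamma>: "\<And>j. j \<in> J \<Longrightarrow> lnorm p I (\<gamma> j) \<le> ennreal C"
    and t: "\<And>j. j \<in> J \<Longrightarrow> 0 \<le> t j" "(\<Sum>j\<in>J. t j) \<le> 1"
    and z: "\<And>i. i \<in> I \<Longrightarrow> norm (z i) \<le> (\<Sum>j\<in>J. t j * norm (\<gamma> j i))"
  shows "lnorm p I z \<le> ennreal C"
  unfolding lnorm_le_iff_dual[OF p C]
proof (intro allI impI, elim conjE)
  fix F and \<mu> :: "nat \<Rightarrow> real"
  assume F: "finite F" "F \<subseteq> I" and \<mu>: "\<forall>i. 0 \<le> \<mu> i" "lnorm (conj_index p) F \<mu> \<le> 1"
  have "(\<Sum>i\<in>F. \<mu> i * norm (z i)) \<le> (\<Sum>i\<in>F. \<mu> i * (\<Sum>j\<in>J. t j * norm (\<gamma> j i)))"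
    using F \<mu> z by (intro sum_mono mult_left_mono) auto
  also have "\<dots> = (\<Sum>j\<in>J. t j * (\<Sum>i\<in>F. \<mu> i * norm (\<gamma> j i)))"
    unfolding sum_distrib_left by (subst sum.swap) (simp add: mult.left_commute)
  also have "\<dots> \<le> (\<Sum>j\<in>J. t j * C)"
    using \<gamma> F \<mu> t unfolding lnorm_le_iff_dual[OF p C] by (intro sum_mono mult_left_mono) auto
  also have "\<dots> \<le> 1 * C"
    using t C unfolding sum_distrib_right[symmetric] by (intro mult_right_mono)
  finally show "(\<Sum>i\<in>F. \<mu> i * norm (z i)) \<le> C"
    by simp
qed

lemma lnorm_triangle_le:
  assumes p: "1 \<le> p" and C: "0 \<le> C" "lnorm p I x \<le> ennreal C"
    and D: "0 \<le> D" "lnorm p I y \<le> ennreal D"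
    and z: "\<And>i. i \<in> I \<Longrightarrow> norm (z i) \<le> norm (x i) + norm (y i)"
  shows "lnorm p I z \<le> ennreal (C + D)"
proof -
  have CD: "0 \<le> C + D"
    using C D by simp
  show ?thesis
    unfolding lnorm_le_iff_dual[OF p CD]
  proof (intro allI impI, elim conjE)
    fix F and \<mu> :: "nat \<Rightarrow> real"
    assume F: "finite F" "F \<subseteq> I" and \<mu>: "\<forall>i. 0 \<le> \<mu> i" "lnorm (conj_index p) F \<mu> \<le> 1"
    have "(\<Sum>i\<in>F. \<mu> i * norm (z i)) \<le> (\<Sum>i\<in>F. \<mu> i * (norm (x i) + norm (y i)))"
      using F \<mu> z by (intro sum_mono mult_left_mono) auto
    also have "\<dots> = (\<Sum>i\<in>F. \<mu> i * norm (x i)) + (\<Sum>i\<in>F. \<mu> i * norm (y i))"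
      by (simp add: distrib_left sum.distrib)
    also have "\<dots> \<le> C + D"
      using C D F \<mu> unfolding lnorm_le_iff_dual[OF p C(1)] lnorm_le_iff_dual[OF p D(1)]
      by (intro add_mono) auto
    finally show "(\<Sum>i\<in>F. \<mu> i * norm (z i)) \<le> C + D" .
  qed
qed

lemma lnorm_reindex:
  assumes "inj_on g I"
  shows "lnorm p (g ` I) x = lnorm p I (\<lambda>i. x (g i))"
  by (simp add: lnorm_def infsum_reindex[OF assms] o_def image_image)

lemma lnorm_if:
  assumes p: "1 \<le> p"
  shows "lnorm p I (\<lambda>i. if i \<in> J then x i else 0) = lnorm p (I \<inter> J) x"
proof (rule antisym)
  show "lnorm p (I \<inter> J) x \<le> lnorm p I (\<lambda>i. if i \<in> J then x i else 0)"
    by (intro lnorm_mono[OF p]) auto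
  show "lnorm p I (\<lambda>i. if i \<in> J then x i else 0) \<le> lnorm p (I \<inter> J) x"
  proof (rule ennreal_le_by_real_bounds)
    fix C :: real
    assume C: "0 \<le> C" "lnorm p (I \<inter> J) x \<le> ennreal C"
    show "lnorm p I (\<lambda>i. if i \<in> J then x i else 0) \<le> ennreal C"
      unfolding lnorm_le_iff_dual[OF p C(1)]
    proof (intro allI impI, elim conjE)
      fix F and \<mu> :: "nat \<Rightarrow> real"
      assume F: "finite F" "F \<subseteq> I" and \<mu>: "\<forall>i. 0 \<le> \<mu> i" "lnorm (conj_index p) F \<mu> \<le> 1"
      have "lnorm (conj_index p) (F \<inter> J) \<mu> \<le> lnorm (conj_index p) F \<mu>"
        by (intro lnorm_mono one_le_conj_index p) auto
      then have "(\<Sum>i\<in>F \<inter> J. \<mu> i * norm (x i)) \<le> C"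
        using lnorm_le_iff_dual[OF p C(1), of "I \<inter> J" x, THEN iffD1, OF C(2), rule_format, of "F \<inter> J" \<mu>] F \<mu>
        by (meson finite_Int inf_le2 inf_mono order_refl order_trans)
      moreover have "(\<Sum>i\<in>F. \<mu> i * norm (if i \<in> J then x i else 0)) = (\<Sum>i\<in>F \<inter> J. \<mu> i * norm (x i))"
        using F by (simp add: sum.inter_restrict if_distrib cong: if_cong)
      ultimately show "(\<Sum>i\<in>F. \<mu> i * norm (if i \<in> J then x i else 0)) \<le> C"
        by simp
    qed
  qed
qed

lemma norm_le_of_lnorm_le:
  assumes p: "1 \<le> p" and C: "0 \<le> C" and x: "lnorm p I x \<le> ennreal C" and i: "i \<in> I"
  shows "norm (x i) \<le> C"
  using p
proof (cases rule: conj_index_cases)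
  case one
  then show ?thesis
    using x i lnorm_one_le_iff[OF C, of I x, THEN iffD1, rule_format, of "{i}"] by simp
next
  case infinity
  then show ?thesis
    using x i lnorm_infinity_le_iff[OF C, of I x] by auto
next
  case (real r s)
  then have "norm (x i) powr r \<le> C powr r"
    using x i lnorm_real_le_iff[of r, OF _ C, of I x, THEN iffD1, rule_format, of "{i}"] by simp
  then show ?thesis
    using real C powr_less_mono2[of r C "norm (x i)"] by force
qed

text \<open>Weights in the dual ball have entries at most 1. Crude but uniform in \<open>p\<close>:
  it gives finiteness on finite index sets, and bounds \<open>N\<close> coefficients of size
  \<open>\<epsilon>\<close> by \<open>real N * \<epsilon>\<close>.\<close>

lemma lnorm_le_sum:
  assumes p: "1 \<le> p" and I: "finite I"
  shows "lnorm p I x \<le> ennreal (\<Sum>i\<in>I. norm (x i))"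
proof -
  have "0 \<le> (\<Sum>i\<in>I. norm (x i))"
    by (simp add: sum_nonneg)
  from lnorm_le_iff_dual[OF p this, of I x] show ?thesis
  proof (rule iffD2, intro allI impI, elim conjE)
    fix F and \<mu> :: "nat \<Rightarrow> real"
    assume F: "finite F" "F \<subseteq> I" and \<mu>: "\<forall>i. 0 \<le> \<mu> i" "lnorm (conj_index p) F \<mu> \<le> 1"
    have "\<mu> i \<le> 1" if "i \<in> F" for i
      using norm_le_of_lnorm_le[OF one_le_conj_index[OF p], of 1 F \<mu> i] \<mu> that by simp
    then have "(\<Sum>i\<in>F. \<mu> i * norm (x i)) \<le> (\<Sum>i\<in>F. norm (x i))"
      using \<mu> by (intro sum_mono mult_left_le_one_le) auto
    also have "\<dots> \<le> (\<Sum>i\<in>I. norm (x i))"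
      using F I by (intro sum_mono2) auto
    finally show "(\<Sum>i\<in>F. \<mu> i * norm (x i)) \<le> (\<Sum>i\<in>I. norm (x i))" .
  qed
qed

text \<open>A finite test set lies below some \<open>N\<close>. This carries estimates for finite
  systems over to sequences and tails.\<close>

lemma lnorm_lessThan_Int_le:
  assumes p: "1 \<le> p" and C: "0 \<le> C" and le: "\<And>N. lnorm p (I \<inter> {..<N}) x \<le> ennreal C"
  shows "lnorm p I x \<le> ennreal C"
  unfolding lnorm_le_iff_dual[OF p C]
proof (intro allI impI, elim conjE)
  fix F and \<mu> :: "nat \<Rightarrow> real"
  assume F: "finite F" "F \<subseteq> I" and \<mu>: "\<forall>i. 0 \<le> \<mu> i" "lnorm (conj_index p) F \<mu> \<le> 1"
  obtain N where "F \<subseteq> {..<N}"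
    using F finite_nat_bounded by blast
  then show "(\<Sum>i\<in>F. \<mu> i * norm (x i)) \<le> C"
    using le[of N] F \<mu> unfolding lnorm_le_iff_dual[OF p C] by auto
qed

text \<open>A single test sees finitely many coordinates, so balls are closed under coordinatewise
  limits.\<close>

lemma lnorm_le_LIMSEQ:
  assumes p: "1 \<le> p" and C: "0 \<le> C" and le: "\<And>m. lnorm p I (a m) \<le> ennreal C"
    and lim: "\<And>i. i \<in> I \<Longrightarrow> (\<lambda>m. a m i) \<longlonglongrightarrow> l i"
  shows "lnorm p I l \<le> ennreal C"
  unfolding lnorm_le_iff_dual[OF p C]
proof (intro allI impI, elim conjE)
  fix F and \<mu> :: "nat \<Rightarrow> real"
  assume F: "finite F" "F \<subseteq> I" and \<mu>: "\<forall>i. 0 \<le> \<mu> i" "lnorm (conj_index p) F \<mu> \<le> 1"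
  have "(\<lambda>m. \<Sum>i\<in>F. \<mu> i * norm (a m i)) \<longlonglongrightarrow> (\<Sum>i\<in>F. \<mu> i * norm (l i))"
    using lim F by (intro tendsto_intros) auto
  then show "(\<Sum>i\<in>F. \<mu> i * norm (l i)) \<le> C"
    by (rule LIMSEQ_le_const2) (use le F \<mu> in \<open>auto simp: lnorm_le_iff_dual[OF p C]\<close>)
qed

text \<open>For finite \<open>p\<close> this is the Cauchy criterion. For infinite \<open>p\<close>
  a bounded sequence would not do, which is where \<open>c_zero\<close> matters.\<close>

lemma lnorm_atLeast_small:
  assumes p: "1 \<le> p" and x: "x \<in> (if p = \<infinity> then c_zero else ell p)" and e: "0 < e"
  obtains N where "lnorm p {N..} x \<le> ennreal e"
proof (cases "p = \<infinity>")
  case True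
  then have "x \<longlonglongrightarrow> 0"
    using x by (simp add: c_zero_def)
  then obtain N where "\<forall>n\<ge>N. norm (x n) < e"
    using e by (auto simp: LIMSEQ_iff)
  then show thesis
    using e lnorm_infinity_le_iff[of e "{N..}" x] unfolding True
    by (intro that[of N]) (simp add: less_imp_le True)
next
  case False
  then obtain r where r: "p = ennreal r" "0 \<le> r"
    by (cases p) auto
  have r1: "1 \<le> r"
    using p r by (simp flip: ennreal_1)
  obtain C where C: "0 \<le> C" "lnorm p UNIV x \<le> ennreal C"
    using x False by (cases "lnorm p UNIV x") (auto simp: ell_def)
  have bound: "(\<Sum>i\<in>F. norm (x i) powr r) \<le> C powr r" if "finite F" for F
    using C that unfolding r lnorm_real_le_iff[OF r1 C(1)] by auto
  have "summable (\<lambda>i. norm (x i) powr r)"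
    by (rule summableI_nonneg_bounded[of _ "C powr r"]) (auto intro: bound)
  moreover have e': "0 < e powr r"
    using e by simp
  ultimately obtain N where N: "\<forall>m\<ge>N. \<forall>n. norm (\<Sum>i=m..<n. norm (x i) powr r) < e powr r"
    unfolding summable_Cauchy by blast
  have "lnorm p {N..} x \<le> ennreal e"
    unfolding r lnorm_real_le_iff[OF r1 less_imp_le[OF e]]
  proof (intro allI impI, elim conjE)
    fix F
    assume F: "finite F" "F \<subseteq> {N..}"
    obtain n where "F \<subseteq> {..<n}"
      using F finite_nat_bounded by blast
    with F have "(\<Sum>i\<in>F. norm (x i) powr r) \<le> (\<Sum>i=N..<n. norm (x i) powr r)"
      by (intro sum_mono2) auto
    also have "\<dots> \<le> e powr r"
      using N[rule_format, of N n] by simp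
    finally show "(\<Sum>i\<in>F. norm (x i) powr r) \<le> e powr r" .
  qed
  then show thesis
    by (rule that)
qed

lemma lnorm_realE:
  assumes "lnorm p' I x < \<infinity>"
  obtains A where "0 \<le> A" "lnorm p' I x = ennreal A"
  using assms by (cases "lnorm p' I x") auto


section \<open>Norming functionals and uniform boundedness\<close>

text \<open>Only one inequality of positive homogeneity is demanded; applied to
  \<open>inverse c\<close> it yields the other, so constructions have less to verify.\<close>

definition sublinear :: "('a::real_vector \<Rightarrow> real) \<Rightarrow> bool" where
  "sublinear p \<longleftrightarrow> (\<forall>x y. p (x + y) \<le> p x + p y) \<and> (\<forall>c x. 0 < c \<longrightarrow> c * p x \<le> p (c *\<^sub>R x))"

lemma sublinear_add: "sublinear p \<Longrightarrow> p (x + y) \<le> p x + p y"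
  by (simp add: sublinear_def)

lemma sublinear_scaleR:
  assumes "sublinear p" "0 < c"
  shows "p (c *\<^sub>R x) = c * p x"
proof (rule antisym)
  have "inverse c * p (c *\<^sub>R x) \<le> p (inverse c *\<^sub>R c *\<^sub>R x)"
    using assms unfolding sublinear_def by (meson positive_imp_inverse_positive)
  then show "p (c *\<^sub>R x) \<le> c * p x"
    using assms by (simp add: field_simps)
  show "c * p x \<le> p (c *\<^sub>R x)"
    using assms by (simp add: sublinear_def)
qed

lemma sublinear_zero: "sublinear p \<Longrightarrow> p 0 = 0"
  using sublinear_scaleR[of p 2 0] by simp

lemma sublinear_norm: "sublinear (norm :: 'a::real_normed_vector \<Rightarrow> real)"
  by (simp add: sublinear_def norm_triangle_ineq)

lemma sublinear_neg_le: "sublinear p \<Longrightarrow> - p (- x) \<le> p x"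
  using sublinear_add[of p x "- x"] sublinear_zero[of p] by simp

text \<open>The infimum of \<open>p (v + t x0) - t p x0\<close> over \<open>t \<ge> 0\<close> lies
  below \<open>p\<close> by \<open>t = 0\<close>. Taking \<open>t = 1\<close> at
  \<open>v = - x0\<close> lowers the value there to \<open>- p x0\<close>, as an odd functional with
  value \<open>p x0\<close> at \<open>x0\<close> would require.\<close>

lemma sublinear_minorant:
  fixes p :: "'a::real_vector \<Rightarrow> real"
  assumes p: "sublinear p"
  obtains p' where "sublinear p'" "p' \<le> p" "p' (- x0) \<le> - p x0"
proof
  define g where "g v t = p (v + t *\<^sub>R x0) - t * p x0" for v t
  define p' where "p' v = (INF t\<in>{0..}. g v t)" for v
  \<comment> \<open>A lower bound independent of \<open>t\<close>, from subadditivity at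
    \<open>t x0 = - v + (v + t x0)\<close>; it makes the infimum meaningful.\<close>
  have g_ge: "- p (- v) \<le> g v t" if "0 \<le> t" for v t
  proof (cases "t = 0")
    case True
    then show ?thesis
      using sublinear_neg_le[OF p, of v] by (simp add: g_def)
  next
    case False
    then have "t * p x0 = p (- v + (v + t *\<^sub>R x0))"
      using that sublinear_scaleR[OF p] by simp
    also have "\<dots> \<le> p (- v) + p (v + t *\<^sub>R x0)"
      by (rule sublinear_add[OF p])
    finally show ?thesis
      by (simp add: g_def)
  qed
  have p'_le: "p' v \<le> g v t" if "0 \<le> t" for v t
    unfolding p'_def using that g_ge by (intro cINF_lower bdd_belowI2[where m = "- p (- v)"]) auto
  have p'_ge: "a \<le> p' v" if "\<And>t. 0 \<le> t \<Longrightarrow> a \<le> g v t" for a v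
    unfolding p'_def using that by (intro cINF_greatest) auto
  show "sublinear p'"
    unfolding sublinear_def
  proof (intro conjI allI impI)
    fix v w
    have "p' (v + w) \<le> g v s + g w t" if "0 \<le> s" "0 \<le> t" for s t
    proof -
      have "p' (v + w) \<le> g (v + w) (s + t)"
        using that by (intro p'_le) simp
      also have "\<dots> \<le> g v s + g w t"
        using sublinear_add[OF p, of "v + s *\<^sub>R x0" "w + t *\<^sub>R x0"]
        by (simp add: g_def algebra_simps)
      finally show ?thesis .
    qed
    then have "p' (v + w) - g w t \<le> p' v" if "0 \<le> t" for t
      using that by (intro p'_ge) (simp add: algebra_simps)
    then have "p' (v + w) - p' v \<le> p' w"
      by (intro p'_ge) (simp add: algebra_simps)
    then show "p' (v + w) \<le> p' v + p' w"
      by simp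
  next
    fix c :: real and v
    assume c: "0 < c"
    show "c * p' v \<le> p' (c *\<^sub>R v)"
    proof (rule p'_ge)
      fix t :: real
      assume t: "0 \<le> t"
      have "c * p' v \<le> c * g v (t / c)"
        using c t by (intro mult_left_mono p'_le) auto
      also have "\<dots> = c * p (v + (t / c) *\<^sub>R x0) - t * p x0"
        using c by (simp add: g_def algebra_simps)
      also have "c * p (v + (t / c) *\<^sub>R x0) = p (c *\<^sub>R v + t *\<^sub>R x0)"
        using c sublinear_scaleR[OF p c, of "v + (t / c) *\<^sub>R x0"] by (simp add: scaleR_add_right)
      finally show "c * p' v \<le> g (c *\<^sub>R v) t"
        by (simp add: g_def)
    qed
  qed
  show "p' \<le> p"
    unfolding le_fun_def using p'_le[of 0] by (simp add: g_def)
  show "p' (- x0) \<le> - p x0"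
    using p'_le[of 1 "- x0"] sublinear_zero[OF p] by (simp add: g_def)
qed

text \<open>
  A minimal sublinear functional \<open>m\<close> satisfies \<open>m (- v) \<le> - m v\<close>, since otherwise the previous lemma yields
  a smaller one; so it is odd, hence linear.
\<close>

lemma sublinear_minorant_linear:
  fixes q :: "'a::real_vector \<Rightarrow> real"
  assumes q: "sublinear q"
  obtains f where "linear f" "\<And>v. f v \<le> q v"
proof -
  define A where "A = {p. sublinear p \<and> p \<le> q}"
  have "\<exists>m\<in>A. \<forall>a\<in>A. a \<le> m \<longrightarrow> a = m"
  proof (rule predicate_Zorn)
    show "partial_order_on A (relation_of (\<lambda>a b. b \<le> a) A)"
      by (rule partial_order_on_relation_ofI) auto
    fix C
    assume "C \<in> Chains (relation_of (\<lambda>a b. b \<le> a) A)"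
    then have CA: "\<And>a. a \<in> C \<Longrightarrow> a \<in> A" and chain: "\<And>a b. a \<in> C \<Longrightarrow> b \<in> C \<Longrightarrow> a \<le> b \<or> b \<le> a"
      unfolding Chains_def relation_of_def by blast+
    show "\<exists>u\<in>A. \<forall>a\<in>C. u \<le> a"
    proof (cases "C = {}")
      case True
      then show ?thesis
        using q A_def by auto
    next
      case False
      define u where "u v = (INF a\<in>C. a v)" for v
      \<comment> \<open>A lower bound common to the whole chain, from
        \<open>- a (- v) \<le> a v\<close> and \<open>a \<le> q\<close>, so that the pointwise
        infimum exists.\<close>
      have "- q (- v) \<le> a v" if "a \<in> C" for a v
        using CA[OF that] sublinear_neg_le[of a v] unfolding A_def le_fun_def
        by (smt (verit) mem_Collect_eq)
      then have u_le: "u v \<le> a v" if "a \<in> C" for a v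
        unfolding u_def using that by (intro cINF_lower bdd_belowI2) auto
      have u_ge: "b \<le> u v" if "\<And>a. a \<in> C \<Longrightarrow> b \<le> a v" for b v
        unfolding u_def using that False by (intro cINF_greatest) auto
      have "sublinear u"
        unfolding sublinear_def
      proof (intro conjI allI impI)
        fix v w
        have "u (v + w) \<le> a v + b w" if ab: "a \<in> C" "b \<in> C" for a b
        proof -
          \<comment> \<open>The smaller of two chain members serves both summands.\<close>
          obtain e where "e \<in> C" "e \<le> a" "e \<le> b"
            using chain ab by blast
          then have "u (v + w) \<le> e v + e w"
            using u_le CA sublinear_add unfolding A_def by (metis (mono_tags) mem_Collect_eq order_trans)
          then show ?thesis
            using \<open>e \<le> a\<close> \<open>e \<le> b\<close> unfolding le_fun_def by (meson add_mono order_trans)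
        qed
        then have "u (v + w) - b w \<le> u v" if "b \<in> C" for b
          using that by (intro u_ge) (simp add: algebra_simps)
        then have "u (v + w) - u v \<le> u w"
          by (intro u_ge) (simp add: algebra_simps)
        then show "u (v + w) \<le> u v + u w"
          by simp
      next
        fix c :: real and v
        assume c: "0 < c"
        show "c * u v \<le> u (c *\<^sub>R v)"
        proof (rule u_ge)
          fix a
          assume a: "a \<in> C"
          have "c * u v \<le> c * a v"
            using u_le[OF a] c by simp
          also have "\<dots> = a (c *\<^sub>R v)"
            using CA[OF a] sublinear_scaleR[OF _ c, of a] unfolding A_def by simp
          finally show "c * u v \<le> a (c *\<^sub>R v)" .
        qed
      qed
      moreover have "u \<le> q"
      proof -
        obtain a where "a \<in> C"
          using False by blast
        then show ?thesis
          using CA u_le unfolding A_def le_fun_def by (metis (mono_tags) mem_Collect_eq order_trans)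
      qed
      ultimately show ?thesis
        using u_le unfolding A_def le_fun_def by auto
    qed
  qed
  then obtain m where m: "sublinear m" "m \<le> q" and min: "\<And>a. sublinear a \<Longrightarrow> a \<le> m \<Longrightarrow> a = m"
    unfolding A_def by (auto intro: order_trans)
  have odd: "m (- v) = - m v" for v
  proof -
    obtain p' where "sublinear p'" "p' \<le> m" "p' (- v) \<le> - m v"
      using sublinear_minorant[OF m(1)] by blast
    then have "m (- v) \<le> - m v"
      using min by auto
    then show ?thesis
      using sublinear_neg_le[OF m(1), of "- v"] by simp
  qed
  have "linear m"
  proof (rule linearI)
    show "m (v + w) = m v + m w" for v w
      using sublinear_add[OF m(1), of v w] sublinear_add[OF m(1), of "- v" "- w"] odd[of "v + w"]
      by (simp add: odd)
    show "m (c *\<^sub>R v) = c *\<^sub>R m v" for c v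
    proof (cases c "0 :: real" rule: linorder_cases)
      case less
      then show ?thesis
        using sublinear_scaleR[OF m(1), of "- c" v] odd[of "c *\<^sub>R v"] by simp
    next
      case equal
      then show ?thesis
        using sublinear_zero[OF m(1)] by simp
    next
      case greater
      then show ?thesis
        using sublinear_scaleR[OF m(1)] by simp
    qed
  qed
  then show thesis
    using that m(2) by (auto simp: le_fun_def)
qed

text \<open>The value at \<open>y\<close> is settled before linearity:
  \<open>p (- y) \<le> - norm y\<close> forces every linear functional below \<open>p\<close> to be
  at least \<open>norm y\<close> at \<open>y\<close>. This replaces extension from a line.\<close>

lemma real_norming_functional:
  fixes y :: "'a::real_normed_vector"
  obtains f :: "'a \<Rightarrow> real" where "linear f" "\<And>v. f v \<le> norm v" "f y = norm y"
proof -
  obtain p where p: "sublinear p" "p \<le> norm" "p (- y) \<le> - norm y"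
    using sublinear_minorant[OF sublinear_norm] by blast
  obtain f where f: "linear f" "\<And>v. f v \<le> p v"
    using sublinear_minorant_linear[OF p(1)] by blast
  have le: "f v \<le> norm v" for v
    using f(2)[of v] p(2) by (meson le_funD order_trans)
  have "- f y \<le> - norm y"
    using f(2)[of "- y"] p(3) linear_neg[OF f(1), of y] by simp
  then show thesis
    using that[OF f(1) le] le[of y] by simp
qed

text \<open>A common setting for functionals on the given Banach spaces and on C(Omega) with
  \<open>scaleC\<close>.\<close>

locale normed_over = vector_space scale
  for scale :: "'k::real_or_complex \<Rightarrow> 'x::real_normed_vector \<Rightarrow> 'x" +
  assumes norm_scale: "norm (scale a x) = norm a * norm x"
    and scale_of_real: "scale (of_real r) x = r *\<^sub>R x"

sublocale banach_over \<subseteq> normed_over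
  by unfold_locales (simp_all add: norm_scale scale_of_real)

context normed_over
begin

lemma scale_scaleR: "r *\<^sub>R x = scale (of_real r) x"
  by (simp add: scale_of_real)

lemma ex_dual_ball_functional:
  assumes "\<And>v w. g (v + w) = g v + g w" "\<And>a v. g (scale a v) = a * g v" "\<And>v. norm (g v) \<le> norm v"
  obtains f where "f \<in> dual_ball scale" "\<And>v. blinfun_apply f v = g v"
proof -
  have "bounded_linear g"
    using assms by (intro bounded_linear_intro[where K = 1]) (auto simp: scale_scaleR scaleR_conv_of_real)
  then have "blinfun_apply (Blinfun g) v = g v" for v
    by (simp add: bounded_linear_Blinfun_apply)
  moreover from this have "norm (Blinfun g) \<le> 1"
    using assms by (intro norm_blinfun_bound) auto
  ultimately show thesis
    using assms by (intro that[of "Blinfun g"]) (auto simp: dual_ball_def bounded_ops_def)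
qed

lemma norming_functional:
  obtains f where "f \<in> dual_ball scale" "norm y \<le> norm (blinfun_apply f y)"
proof -
  obtain f :: "'x \<Rightarrow> real" where f: "linear f" "\<And>v. f v \<le> norm v" "f y = norm y"
    using real_norming_functional by blast
  note f_simps = linear_add[OF f(1)] linear_scale[OF f(1)] linear_diff[OF f(1)]
  have abs_f: "\<bar>f v\<bar> \<le> norm v" for v
    using f(2)[of v] f(2)[of "- v"] linear_neg[OF f(1), of v] by (simp add: abs_le_iff)
  from real_or_complex[where 'a = 'k] show thesis
  proof
    assume real: "\<forall>z::'k. \<exists>a. z = a *\<^sub>R 1"
    obtain g where "g \<in> dual_ball scale" "\<And>v. blinfun_apply g v = of_real (f v)"
    proof (rule ex_dual_ball_functional[of "\<lambda>v. of_real (f v) :: 'k"])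
      fix a :: 'k and v
      obtain r where "a = of_real r"
        using real by (auto simp: of_real_def)
      then show "of_real (f (scale a v)) = a * of_real (f v)"
        by (simp add: f_simps flip: scale_scaleR)
    qed (use abs_f f_simps in auto)
    then show thesis
      using that f(3) by simp
  next
    assume "\<exists>j::'k. j * j = - 1 \<and> (\<forall>z. \<exists>a b. z = a *\<^sub>R 1 + b *\<^sub>R j) \<and>
          (\<forall>a b. norm (a *\<^sub>R 1 + b *\<^sub>R j) = sqrt (a\<^sup>2 + b\<^sup>2))"
    then obtain j :: 'k where jj: "j * j = - 1" and rep: "\<And>z. \<exists>a b. z = a *\<^sub>R 1 + b *\<^sub>R j"
      and nrm: "\<And>a b. norm (a *\<^sub>R 1 + b *\<^sub>R j) = sqrt (a\<^sup>2 + b\<^sup>2)"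
      by blast
    \<comment> \<open>The scalar-linear functional with real part \<open>f\<close>, that is
      \<open>f v - f (j v) j\<close>.\<close>
    define h where "h v = f v *\<^sub>R 1 + (- f (scale j v)) *\<^sub>R j" for v
    have h_add: "h (v + w) = h v + h w" for v w
      by (simp add: h_def scale_right_distrib f_simps algebra_simps)
    have h_scale: "h (scale z v) = z * h v" for z v
    proof -
      obtain a b where z: "z = a *\<^sub>R 1 + b *\<^sub>R j"
        using rep by blast
      have sz: "scale z v = a *\<^sub>R v + b *\<^sub>R scale j v"
        unfolding z by (simp add: scale_left_distrib scaleR_conv_of_real scale_scaleR)
      have "scale j (scale j v) = - v"
        by (simp add: jj)
      moreover have "scale j (r *\<^sub>R w) = r *\<^sub>R scale j w" for r w
        unfolding scale_scaleR by (rule scale_left_commute)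
      ultimately have jz: "scale j (scale z v) = a *\<^sub>R scale j v - b *\<^sub>R v"
        unfolding sz by (simp add: scale_right_distrib)
      have "h (scale z v) = (a * f v + b * f (scale j v)) *\<^sub>R 1 - (a * f (scale j v) - b * f v) *\<^sub>R j"
        unfolding h_def jz unfolding sz by (simp add: f_simps algebra_simps)
      also have "\<dots> = z * h v"
        unfolding z h_def using jj by (simp add: algebra_simps)
      finally show ?thesis .
    qed
    have h_norm: "norm (h v) \<le> norm v" for v
    proof (cases "h v = 0")
      case False
      \<comment> \<open>\<open>v\<close> is rotated so that \<open>h w\<close> becomes the positive
        real \<open>norm (h v)\<close>; it then equals its real part \<open>f w\<close>, which is at
        most \<open>norm w = norm v\<close>.\<close>
      define w where "w = scale (of_real (norm (h v)) / h v) v"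
      have "h w = norm (h v) *\<^sub>R 1"
        unfolding w_def h_scale scaleR_conv_of_real using False by simp
      then have "(f w - norm (h v)) *\<^sub>R 1 + (- f (scale j w)) *\<^sub>R j = 0"
        by (simp add: h_def algebra_simps)
      then have "(f w - norm (h v))\<^sup>2 + (- f (scale j w))\<^sup>2 = 0"
        by (metis nrm norm_zero real_sqrt_eq_zero_cancel_iff)
      then have "norm (h v) = f w"
        by (simp add: sum_power2_eq_zero_iff)
      also have "\<dots> \<le> norm w"
        by (rule f)
      also have "\<dots> = norm v"
        unfolding w_def norm_scale using False by (simp add: norm_divide)
      finally show ?thesis .
    qed simp
    obtain g where g: "g \<in> dual_ball scale" "\<And>v. blinfun_apply g v = h v"
      using ex_dual_ball_functional[OF h_add h_scale h_norm] by blast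
    have "norm y \<le> norm (h y)"
      unfolding h_def nrm f(3) by (rule real_le_rsqrt) simp
    then show thesis
      using that g by simp
  qed
qed

end

text \<open>Without a bound there are nested balls with \<open>n < \<phi> k\<close> on the \<open>n\<close>-th one for some \<open>k\<close>.\<close>

lemma uniform_boundedness_seminorms:
  fixes V :: "'a::banach set" and \<phi> :: "'i \<Rightarrow> 'a \<Rightarrow> real"
  assumes V: "closed V" "subspace V"
    and add: "\<And>k a b. k \<in> K \<Longrightarrow> \<phi> k (a + b) \<le> \<phi> k a + \<phi> k b"
    and scale: "\<And>k c a. k \<in> K \<Longrightarrow> \<phi> k (c *\<^sub>R a) = \<bar>c\<bar> * \<phi> k a"
    and bound: "\<And>k. k \<in> K \<Longrightarrow> \<exists>B. \<forall>a. \<phi> k a \<le> B * norm a"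
    and ptw: "\<And>a. a \<in> V \<Longrightarrow> \<exists>M. \<forall>k\<in>K. \<phi> k a \<le> M"
  obtains M where "\<And>k a. k \<in> K \<Longrightarrow> a \<in> V \<Longrightarrow> norm a \<le> 1 \<Longrightarrow> \<phi> k a \<le> M"
proof (rule ccontr)
  assume "\<not> thesis"
  then have unb: "\<exists>k\<in>K. \<exists>a\<in>V. norm a \<le> 1 \<and> M < \<phi> k a" for M
    using that by (meson not_le)
  have step: "\<exists>b s. b \<in> V \<and> 0 < s \<and> s \<le> e \<and> cball b s \<subseteq> cball a r \<and> (\<exists>k\<in>K. \<forall>c\<in>cball b s. M < \<phi> k c)"
    if a: "a \<in> V" and r: "0 < r" and e: "0 < e" for a r e M
  proof -
    obtain M' where M': "\<forall>k\<in>K. \<phi> k a \<le> M'"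
      using ptw[OF a] by blast
    obtain k h where k: "k \<in> K" and h: "h \<in> V" "norm h \<le> 1" "2 * (\<bar>M\<bar> + 1 + \<bar>M'\<bar>) / r < \<phi> k h"
      using unb by blast
    \<comment> \<open>All seminorms are at most \<open>M'\<close> at \<open>a\<close>, and
      \<open>h\<close> is chosen so that this step pushes \<open>\<phi> k\<close> above
      \<open>M + 1\<close>. Half the radius leaves room for a ball around \<open>b\<close>.\<close>
    define b where "b = a + (r / 2) *\<^sub>R h"
    have bV: "b \<in> V"
      unfolding b_def using V a h by (intro subspace_add subspace_scale) auto
    have "r / 2 * \<phi> k h = \<phi> k (b + (-1) *\<^sub>R a)"
      using scale[OF k, of "r / 2" h] r by (simp add: b_def)
    also have "\<dots> \<le> \<phi> k b + \<phi> k a"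
      using add[OF k, of b "(-1) *\<^sub>R a"] scale[OF k, of "-1" a] by simp
    finally have "r / 2 * \<phi> k h \<le> \<phi> k b + M'"
      using M' k by fastforce
    moreover have "\<bar>M\<bar> + 1 + \<bar>M'\<bar> < r / 2 * \<phi> k h"
      using h(3) r by (simp add: field_simps)
    ultimately have b: "M + 1 < \<phi> k b"
      by linarith
    obtain B where B: "\<forall>a. \<phi> k a \<le> B * norm a"
      using bound[OF k] by blast
    \<comment> \<open>With this radius \<open>\<phi> k\<close> drops by at most 1 on the ball, which
      uses up exactly the margin in \<open>M + 1\<close>.\<close>
    define s where "s = min (min e (r / 2)) (1 / (\<bar>B\<bar> + 1))"
    have s: "0 < s" "s \<le> e" "s \<le> r / 2" "s * \<bar>B\<bar> \<le> 1"
    proof -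
      have "s * \<bar>B\<bar> \<le> 1 / (\<bar>B\<bar> + 1) * \<bar>B\<bar>"
        by (intro mult_right_mono) (auto simp: s_def)
      also have "\<dots> \<le> 1"
        by (simp add: field_simps)
      finally show "s * \<bar>B\<bar> \<le> 1" .
    qed (use e r in \<open>auto simp: s_def\<close>)
    have "cball b s \<subseteq> cball a r"
    proof -
      have "dist a b \<le> r / 2"
        using h(2) r by (simp add: b_def dist_norm)
      moreover have "dist a c \<le> dist a b + dist b c" for c
        by (rule dist_triangle)
      ultimately show ?thesis
        using s(3) unfolding subset_iff mem_cball by (smt (verit) field_sum_of_halves)
    qed
    moreover have "M < \<phi> k c" if "c \<in> cball b s" for c
    proof -
      have "\<phi> k b \<le> \<phi> k c + \<phi> k (b - c)"
        using add[OF k, of c "b - c"] by simp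
      moreover have "\<phi> k (b - c) \<le> \<bar>B\<bar> * s"
      proof -
        have "\<phi> k (b - c) \<le> B * norm (b - c)"
          using B by blast
        also have "\<dots> \<le> \<bar>B\<bar> * s"
          using that by (intro mult_mono) (auto simp: dist_norm)
        finally show ?thesis .
      qed
      ultimately show ?thesis
        using b s(4) by (simp add: mult.commute)
    qed
    ultimately show ?thesis
      using bV s k by blast
  qed
  define R where "R n p q \<longleftrightarrow> snd q \<le> 1 / real (Suc n) \<and> cball (fst q) (snd q) \<subseteq> cball (fst p) (snd p) \<and>
      (\<exists>k\<in>K. \<forall>c\<in>cball (fst q) (snd q). real n < \<phi> k c)" for n and p q :: "'a \<times> real"
  have "\<exists>p. \<forall>n. (fst (p n) \<in> V \<and> 0 < snd (p n)) \<and> R n (p n) (p (Suc n))"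
  proof (rule dependent_nat_choice)
    show "\<exists>p::'a \<times> real. fst p \<in> V \<and> 0 < snd p"
      using subspace_0[OF V(2)] by (intro exI[of _ "(0::'a, 1::real)"]) simp
    show "\<exists>q. (fst q \<in> V \<and> 0 < snd q) \<and> R n p q" if "fst p \<in> V \<and> 0 < snd p" for p :: "'a \<times> real" and n
      using step[of "fst p" "snd p" "1 / real (Suc n)" "real n"] that unfolding R_def by auto
  qed
  then obtain p where p: "\<And>n. fst (p n) \<in> V" "\<And>n. 0 < snd (p n)" "\<And>n. R n (p n) (p (Suc n))"
    by blast
  \<comment> \<open>Shifted by one, since \<open>R\<close> bounds radius and seminorm for the
    successor ball only.\<close>
  define S where "S n = V \<inter> cball (fst (p (Suc n))) (snd (p (Suc n)))" for n
  obtain a where a: "\<And>n. a \<in> S n"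
  proof (rule decreasing_closed_nest[of S])
    show "closed (S n)" for n
      using V by (simp add: S_def closed_Int)
    show "S n \<noteq> {}" for n
      using p(1,2)[of "Suc n"] by (auto simp: S_def intro!: less_imp_le)
    have "S (Suc n) \<subseteq> S n" for n
      using p(3)[of "Suc n"] by (auto simp: S_def R_def)
    then show "S n \<subseteq> S m" if "m \<le> n" for m n
      using that by (rule lift_Suc_antimono_le)
    show "\<exists>n. \<forall>x\<in>S n. \<forall>y\<in>S n. dist x y < e" if "0 < e" for e
    proof -
      obtain n where n: "1 / real (Suc n) < e / 2"
        using \<open>0 < e\<close> by (metis half_gt_zero nat_approx_posE)
      have "dist x y < e" if "x \<in> S n" "y \<in> S n" for x y
        using that n p(3)[of n] dist_triangle3[of x y "fst (p (Suc n))"] by (auto simp: S_def R_def)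
      then show ?thesis
        by blast
    qed
  qed blast
  then have "a \<in> V"
    by (auto simp: S_def)
  then obtain M where M: "\<forall>k\<in>K. \<phi> k a \<le> M"
    using ptw by blast
  obtain n where "M < real n"
    using reals_Archimedean2 by blast
  then show False
    using M a[of n] p(3)[of n] unfolding S_def R_def by force
qed

section \<open>Finiteness of the weak norm\<close>

text \<open>The type of bounded operators consists of real-linear maps. Over the complex field the
  scalar-linear functionals are only a closed real subspace of it, hence the subspace
  \<open>V\<close> in the uniform boundedness principle.\<close>

lemma closed_bounded_ops_scalars: "closed (bounded_ops sX ((*) :: 'k::real_or_complex \<Rightarrow> 'k \<Rightarrow> 'k))"
  unfolding bounded_ops_def
  by (intro closed_Collect_all closed_Collect_eq continuous_intros)

lemma (in normed_over) subspace_bounded_ops_scalars: "real_vector.subspace (bounded_ops scale ((*) :: 'k \<Rightarrow> 'k \<Rightarrow> 'k))"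
  unfolding bounded_ops_def
  by (intro real_vector.subspaceI) (auto simp: blinfun.add_left blinfun.scaleR_left algebra_simps)

text \<open>Membership in \<open>ell_w\<close> is a condition on each functional separately; a
  finite supremum over the dual ball is uniform boundedness. The seminorms are the finite tests
  \<open>(F, \<mu>)\<close> of the norm.\<close>

lemma (in normed_over) wnorm_less_top:
  assumes q: "1 \<le> q" and x: "x \<in> ell_w scale q"
  shows "wnorm scale q UNIV x < \<infinity>"
proof -
  define K where "K = {(F, \<mu>::nat \<Rightarrow> real). finite F \<and> (\<forall>i. 0 \<le> \<mu> i) \<and> lnorm (conj_index q) F \<mu> \<le> 1}"
  define \<phi> where "\<phi> k f = (\<Sum>i\<in>fst k. snd k i * norm (blinfun_apply f (x i)))"
    for k :: "nat set \<times> (nat \<Rightarrow> real)" and f :: "'x \<Rightarrow>\<^sub>L 'k"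
  obtain M where M: "\<And>k f. k \<in> K \<Longrightarrow> f \<in> bounded_ops scale (*) \<Longrightarrow> norm f \<le> 1 \<Longrightarrow> \<phi> k f \<le> M"
  proof (rule uniform_boundedness_seminorms[of "bounded_ops scale (*)" K \<phi>])
    show "closed (bounded_ops scale ((*) :: 'k \<Rightarrow> 'k \<Rightarrow> 'k))"
      by (rule closed_bounded_ops_scalars)
    show "real_vector.subspace (bounded_ops scale ((*) :: 'k \<Rightarrow> 'k \<Rightarrow> 'k))"
      by (rule subspace_bounded_ops_scalars)
    show "\<phi> k (a + b) \<le> \<phi> k a + \<phi> k b" if "k \<in> K" for k a b
    proof -
      have "\<phi> k (a + b) \<le> (\<Sum>i\<in>fst k. snd k i * (norm (blinfun_apply a (x i)) + norm (blinfun_apply b (x i))))"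
        unfolding \<phi>_def blinfun.add_left
        using that by (intro sum_mono mult_left_mono norm_triangle_ineq) (auto simp: K_def)
      then show ?thesis
        by (simp add: \<phi>_def distrib_left sum.distrib)
    qed
    show "\<phi> k (c *\<^sub>R a) = \<bar>c\<bar> * \<phi> k a" for k c a
      by (simp add: \<phi>_def blinfun.scaleR_left sum_distrib_left mult.left_commute)
    show "\<exists>B. \<forall>a. \<phi> k a \<le> B * norm a" if "k \<in> K" for k
    proof (intro exI allI)
      fix a
      have "\<phi> k a \<le> (\<Sum>i\<in>fst k. snd k i * (norm a * norm (x i)))"
        unfolding \<phi>_def using that by (intro sum_mono mult_left_mono norm_blinfun) (auto simp: K_def)
      then show "\<phi> k a \<le> (\<Sum>i\<in>fst k. snd k i * norm (x i)) * norm a"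
        by (simp add: sum_distrib_left mult_ac)
    qed
    show "\<exists>M. \<forall>k\<in>K. \<phi> k f \<le> M" if "f \<in> bounded_ops scale (*)" for f
    proof -
      have "lnorm q UNIV (\<lambda>i. blinfun_apply f (x i)) < \<infinity>"
        using x that by (auto simp: ell_w_def ell_def)
      then obtain C where C: "0 \<le> C" "lnorm q UNIV (\<lambda>i. blinfun_apply f (x i)) \<le> ennreal C"
        by (cases "lnorm q UNIV (\<lambda>i. blinfun_apply f (x i))") auto
      have "\<forall>k\<in>K. \<phi> k f \<le> C"
        using C(2) unfolding lnorm_le_iff_dual[OF q C(1)] K_def \<phi>_def by auto
      then show ?thesis
        by blast
    qed
  qed blast
  have "wnorm scale q UNIV x \<le> ennreal (max M 0)"
    unfolding wnorm_def
  proof (rule SUP_least)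
    fix f
    assume "f \<in> dual_ball scale"
    then show "lnorm q UNIV (\<lambda>i. blinfun_apply f (x i)) \<le> ennreal (max M 0)"
      using M[of "(_, _)" f] unfolding lnorm_le_iff_dual[OF q max.cobounded2]
      by (auto simp: K_def \<phi>_def dual_ball_def intro: max.coboundedI1)
  qed
  then show ?thesis
    by (simp add: le_less_trans[OF _ ennreal_less_top])
qed


section \<open>Coefficients of \<open>p\<close>-continuous functions\<close>

text \<open>For \<open>z = 0\<close> the quotient is 0, hence a bound on \<open>norm t\<close> and
  not an equality.\<close>

lemma ex_unimodular_mult:
  fixes z :: "'k::real_normed_field"
  obtains t where "norm t \<le> 1" "t * z = of_real (norm z)"
proof
  show "norm (of_real (norm z) / z) \<le> 1"
    by (simp add: norm_divide)
  show "of_real (norm z) / z * z = of_real (norm z)"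
    by simp
qed

text \<open>In one or two real coordinates, a ball lies in the continuous image of an interval or a
  square.\<close>

lemma compact_cball_scalars: "compact (cball 0 R :: 'k::real_or_complex set)"
proof -
  have "\<exists>K::'k set. compact K \<and> cball 0 R \<subseteq> K"
    using real_or_complex[where 'a = 'k]
  proof
    assume real: "\<forall>z::'k. \<exists>a. z = a *\<^sub>R 1"
    have "compact ((\<lambda>a. a *\<^sub>R 1 :: 'k) ` {-R..R})"
      by (intro compact_continuous_image continuous_intros) auto
    moreover have "cball 0 R \<subseteq> (\<lambda>a. a *\<^sub>R 1 :: 'k) ` {-R..R}"
    proof
      fix z :: 'k
      assume z: "z \<in> cball 0 R"
      obtain a where "z = a *\<^sub>R 1"
        using real by blast
      then show "z \<in> (\<lambda>a. a *\<^sub>R 1) ` {-R..R}"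
        using z by (intro image_eqI[of _ _ a]) auto
    qed
    ultimately show ?thesis
      by blast
  next
    assume "\<exists>j::'k. j * j = - 1 \<and> (\<forall>z. \<exists>a b. z = a *\<^sub>R 1 + b *\<^sub>R j) \<and>
          (\<forall>a b. norm (a *\<^sub>R 1 + b *\<^sub>R j) = sqrt (a\<^sup>2 + b\<^sup>2))"
    then obtain j :: 'k where rep: "\<And>z. \<exists>a b. z = a *\<^sub>R 1 + b *\<^sub>R j"
      and nrm: "\<And>a b. norm (a *\<^sub>R 1 + b *\<^sub>R j) = sqrt (a\<^sup>2 + b\<^sup>2)"
      by blast
    have "compact ((\<lambda>c. fst c *\<^sub>R 1 + snd c *\<^sub>R j) ` ({-R..R} \<times> {-R..R}))"
      by (intro compact_continuous_image continuous_intros compact_Times) auto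
    moreover have "cball 0 R \<subseteq> (\<lambda>c. fst c *\<^sub>R 1 + snd c *\<^sub>R j) ` ({-R..R} \<times> {-R..R})"
    proof
      fix z :: 'k
      assume z: "z \<in> cball 0 R"
      obtain a b where ab: "z = a *\<^sub>R 1 + b *\<^sub>R j"
        using rep by blast
      have "\<bar>a\<bar> \<le> norm z" "\<bar>b\<bar> \<le> norm z"
        unfolding ab nrm by simp_all
      then show "z \<in> (\<lambda>c. fst c *\<^sub>R 1 + snd c *\<^sub>R j) ` ({-R..R} \<times> {-R..R})"
        using z ab by (intro image_eqI[of _ _ "(a, b)"]) auto
    qed
    ultimately show ?thesis
      by blast
  qed
  then show ?thesis
    by (metis closed_cball compact_Int_closed inf.absorb_iff2)
qed

text \<open>Tychonoff's theorem in place of a diagonal argument: a countable product of compact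
  balls is compact, hence sequentially compact.\<close>

lemma bounded_scalar_seqs_convergent_subseq:
  fixes k :: "nat \<Rightarrow> nat \<Rightarrow> 'k::real_or_complex"
  assumes "\<And>m n. norm (k m n) \<le> R"
  obtains l r where "strict_mono r" "\<And>n. (\<lambda>m. k (r m) n) \<longlonglongrightarrow> l n"
proof -
  have "compactin (product_topology (\<lambda>_. euclidean) UNIV) (PiE UNIV (\<lambda>_::nat. cball 0 R :: 'k set))"
    unfolding compactin_PiE using compact_cball_scalars[where 'k = 'k] by auto
  then have "compact (PiE UNIV (\<lambda>_::nat. cball 0 R :: 'k set))"
    by (simp add: euclidean_product_topology)
  then have "seq_compact (PiE UNIV (\<lambda>_::nat. cball 0 R :: 'k set))"
    by (rule compact_imp_seq_compact)
  moreover have "\<forall>m. k m \<in> PiE UNIV (\<lambda>_. cball 0 R)"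
    using assms by (auto simp: PiE_iff)
  ultimately obtain l r where r: "strict_mono r" and lim: "(k \<circ> r) \<longlonglongrightarrow> l"
    unfolding seq_compact_def by blast
  have "(\<lambda>m. k (r m) n) \<longlonglongrightarrow> l n" for n
  proof -
    have "isCont (\<lambda>x::nat \<Rightarrow> 'k. x n) l"
      by (metis UNIV_I continuous_on_eq_continuous_at continuous_on_product_coordinates open_UNIV)
    from isCont_tendsto_compose[OF this lim] show ?thesis
      by (simp add: o_def)
  qed
  then show thesis
    using that r by blast
qed

lemma apply_bcontfun_sum: "apply_bcontfun (\<Sum>i\<in>A. f i) \<omega> = (\<Sum>i\<in>A. apply_bcontfun (f i) \<omega>)"
  for f :: "_ \<Rightarrow> 'w::topological_space \<Rightarrow>\<^sub>C 'x::real_normed_vector"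
  by (induction A rule: infinite_finite_induct) auto

context banach_over
begin

lemma normed_over_scaleC: "normed_over (scaleC scale :: 'k \<Rightarrow> ('w::topological_space \<Rightarrow>\<^sub>C 'x) \<Rightarrow> _)"
proof
  show "norm (scaleC scale a f) = norm a * norm f" for a and f :: "'w \<Rightarrow>\<^sub>C 'x"
  proof -
    have le: "norm (scaleC scale a f) \<le> norm a * norm f" for a and f :: "'w \<Rightarrow>\<^sub>C 'x"
      by (rule norm_bound) (simp add: apply_scaleC norm_scale mult_left_mono norm_bounded)
    show ?thesis
    proof (cases "a = 0")
      case True
      then have "scaleC scale a f = 0"
        by (intro bcontfun_eqI) (simp add: apply_scaleC)
      then show ?thesis
        using True by simp
    next
      case False
      then have "f = scaleC scale (inverse a) (scaleC scale a f)"
        by (intro bcontfun_eqI) (simp add: apply_scaleC)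
      then have "norm a * norm f \<le> norm a * (norm (inverse a) * norm (scaleC scale a f))"
        using le[of "inverse a" "scaleC scale a f"] by (intro mult_left_mono) auto
      then have "norm a * norm f \<le> norm (scaleC scale a f)"
        using False by (simp add: norm_inverse) (simp add: field_simps)
      then show ?thesis
        using le by (intro antisym)
    qed
  qed
qed (auto intro!: bcontfun_eqI simp: apply_scaleC scale_right_distrib scale_left_distrib scale_of_real)

text \<open>Hoelder on blocks \<open>{N..<K}\<close>, then \<open>K\<close> tends to infinity. The
  coefficients enter only through \<open>C\<close>, so the series converges uniformly over a ball of
  coefficients.\<close>

lemma norm_partial_sum_diff_le:
  assumes p: "1 \<le> p" and A: "0 \<le> A" "lnorm p {M..} x \<le> ennreal A"
    and C: "0 \<le> C" "lnorm (conj_index p) UNIV \<alpha> \<le> ennreal C"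
    and y: "(\<lambda>n. scale (\<alpha> n) (x n)) sums y" and N: "M \<le> N"
  shows "norm ((\<Sum>n<N. scale (\<alpha> n) (x n)) - y) \<le> A * C"
proof -
  have "norm ((\<Sum>n<N. scale (\<alpha> n) (x n)) - (\<Sum>n<K. scale (\<alpha> n) (x n))) \<le> A * C" if "N \<le> K" for K
  proof -
    have "(\<Sum>n<K. scale (\<alpha> n) (x n)) - (\<Sum>n<N. scale (\<alpha> n) (x n)) = (\<Sum>n\<in>{N..<K}. scale (\<alpha> n) (x n))"
      using that sum_diff_nat_ivl[of 0 N K "\<lambda>n. scale (\<alpha> n) (x n)"] by (simp add: lessThan_atLeast0)
    then have "norm ((\<Sum>n<N. scale (\<alpha> n) (x n)) - (\<Sum>n<K. scale (\<alpha> n) (x n))) =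
        norm (\<Sum>n\<in>{N..<K}. scale (\<alpha> n) (x n))"
      by (metis norm_minus_commute)
    also have "\<dots> \<le> (\<Sum>n\<in>{N..<K}. norm (x n) * norm (\<alpha> n))"
      by (rule sum_norm_le) (simp add: norm_scale)
    also have "\<dots> \<le> A * C"
    proof (rule lnorm_Hoelder[OF p _ A(1) _ C(1)])
      show "lnorm p {N..<K} x \<le> ennreal A"
        by (rule order_trans[OF lnorm_mono A(2)]) (use p N in auto)
      show "lnorm (conj_index p) {N..<K} \<alpha> \<le> ennreal C"
        by (rule order_trans[OF lnorm_mono C(2)]) (use one_le_conj_index[OF p] in auto)
    qed simp
    finally show ?thesis .
  qed
  moreover have "(\<lambda>K. norm ((\<Sum>n<N. scale (\<alpha> n) (x n)) - (\<Sum>n<K. scale (\<alpha> n) (x n))))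
      \<longlonglongrightarrow> norm ((\<Sum>n<N. scale (\<alpha> n) (x n)) - y)"
    using y unfolding sums_def by (intro tendsto_intros)
  ultimately show ?thesis
    by (intro LIMSEQ_le_const2) auto
qed

lemma Cp_dominates_lnorm_finite:
  assumes "Cp_dominates scale p f x"
  shows "lnorm p UNIV x < \<infinity>"
proof (cases "p = \<infinity>")
  case True
  then have "x \<longlonglongrightarrow> 0"
    using assms by (simp add: Cp_dominates_def c_zero_def)
  then have "Bseq x"
    by (intro convergent_imp_Bseq convergentI)
  then obtain B where B: "\<And>n. norm (x n) \<le> B"
    using BseqE by blast
  then have "0 \<le> B"
    using norm_ge_zero order_trans by blast
  then have "lnorm \<infinity> UNIV x \<le> ennreal B"
    using B by (simp only: lnorm_infinity_le_iff) simp
  then show ?thesis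
    using True by (simp add: le_less_trans[OF _ ennreal_less_top])
qed (use assms in \<open>auto simp: Cp_dominates_def ell_def\<close>)

lemma Cp_dominates_coeffs:
  assumes "Cp_dominates scale p f x"
  obtains \<alpha> where "lnorm (conj_index p) UNIV \<alpha> \<le> 1" "(\<lambda>n. scale (\<alpha> n) (x n)) sums apply_bcontfun f \<omega>"
  using assms unfolding Cp_dominates_def by blast

text \<open>
  The ball of \<open>\<ell>\<^sub>q\<close> is compact for coordinatewise convergence and \<open>\<alpha> \<mapsto> \<Sum>\<^sub>n \<alpha>\<^sub>n x\<^sub>n\<close> is continuous on it,
  so coefficients of a small value are coordinatewise close to coefficients of \<open>0\<close>.
\<close>

lemma Cp_dominates_small_coeffs:
  assumes p: "1 \<le> p" and dom: "Cp_dominates scale p f x" and e: "0 < e"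
  obtains d where "0 < d"
    "\<And>\<omega> \<omega>'. norm (apply_bcontfun f \<omega> - apply_bcontfun f \<omega>') < d \<Longrightarrow>
      \<exists>\<gamma>. lnorm (conj_index p) UNIV \<gamma> \<le> ennreal 4 \<and> (\<forall>n<N. norm (\<gamma> n) \<le> e) \<and>
        (\<lambda>n. scale (\<gamma> n) (x n)) sums (apply_bcontfun f \<omega> - apply_bcontfun f \<omega>')"
proof (rule ccontr)
  note q = one_le_conj_index[OF p]
  define D where "D \<omega> \<omega>' = apply_bcontfun f \<omega> - apply_bcontfun f \<omega>'" for \<omega> \<omega>'
  define good where "good \<omega> \<omega>' \<longleftrightarrow> (\<exists>\<gamma>. lnorm (conj_index p) UNIV \<gamma> \<le> ennreal 4 \<and>
      (\<forall>n<N. norm (\<gamma> n) \<le> e) \<and> (\<lambda>n. scale (\<gamma> n) (x n)) sums D \<omega> \<omega>')" for \<omega> \<omega>'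
  assume "\<not> thesis"
  then have "\<exists>\<omega> \<omega>'. norm (D \<omega> \<omega>') < 1 / real (Suc m) \<and> \<not> good \<omega> \<omega>'" for m
    using that[of "1 / real (Suc m)"] unfolding good_def[unfolded D_def] D_def
    by (meson of_nat_0_less_iff zero_less_Suc zero_less_divide_1_iff)
  then obtain \<omega> \<omega>' where small: "\<And>m. norm (D (\<omega> m) (\<omega>' m)) < 1 / real (Suc m)"
    and bad: "\<And>m. \<not> good (\<omega> m) (\<omega>' m)"
    by metis
  \<comment> \<open>Differences of two points of the unit ball, hence the bound 2.\<close>
  have "\<exists>k. lnorm (conj_index p) UNIV k \<le> ennreal 2 \<and> (\<lambda>n. scale (k n) (x n)) sums D (\<omega> m) (\<omega>' m)" for m
  proof -
    obtain \<alpha> where \<alpha>: "lnorm (conj_index p) UNIV \<alpha> \<le> 1"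
      "(\<lambda>n. scale (\<alpha> n) (x n)) sums apply_bcontfun f (\<omega> m)"
      using Cp_dominates_coeffs[OF dom] .
    obtain \<alpha>' where \<alpha>': "lnorm (conj_index p) UNIV \<alpha>' \<le> 1"
      "(\<lambda>n. scale (\<alpha>' n) (x n)) sums apply_bcontfun f (\<omega>' m)"
      using Cp_dominates_coeffs[OF dom] .
    have "lnorm (conj_index p) UNIV (\<lambda>n. \<alpha> n - \<alpha>' n) \<le> ennreal (1 + 1)"
      by (rule lnorm_triangle_le[OF q, of _ _ \<alpha> _ \<alpha>']) (use \<alpha> \<alpha>' norm_triangle_ineq4 in auto)
    moreover have "(\<lambda>n. scale (\<alpha> n - \<alpha>' n) (x n)) sums D (\<omega> m) (\<omega>' m)"
      unfolding D_def scale_left_diff_distrib by (rule sums_diff[OF \<alpha>(2) \<alpha>'(2)])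
    ultimately show ?thesis
      by auto
  qed
  then obtain k where k: "\<And>m. lnorm (conj_index p) UNIV (k m) \<le> ennreal 2"
    "\<And>m. (\<lambda>n. scale (k m n) (x n)) sums D (\<omega> m) (\<omega>' m)"
    by metis
  have "norm (k m n) \<le> 2" for m n
    using norm_le_of_lnorm_le[OF q _ k(1), of n m] by simp
  then obtain l r where r: "strict_mono r" and l: "\<And>n. (\<lambda>m. k (r m) n) \<longlonglongrightarrow> l n"
    using bounded_scalar_seqs_convergent_subseq[of k 2] by blast
  have l2: "lnorm (conj_index p) UNIV l \<le> ennreal 2"
    using lnorm_le_LIMSEQ[OF q _ k(1)] l by auto
  have D0: "(\<lambda>m. D (\<omega> (r m)) (\<omega>' (r m))) \<longlonglongrightarrow> 0"
  proof (rule LIMSEQ_subseq_LIMSEQ[OF _ r, unfolded o_def])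
    show "(\<lambda>m. D (\<omega> m) (\<omega>' m)) \<longlonglongrightarrow> 0"
      by (rule Lim_null_comparison[OF _ LIMSEQ_inverse_real_of_nat])
        (use small in \<open>auto simp: inverse_eq_divide intro!: always_eventually less_imp_le\<close>)
  qed
  have xp: "x \<in> (if p = \<infinity> then c_zero else ell p)"
    using dom by (simp add: Cp_dominates_def)
  \<comment> \<open>The tails are small uniformly in \<open>m\<close>, so for a fixed long partial
    sum the limit over \<open>m\<close> can be taken inside the estimate, while the values tend to
    0.\<close>
  have "(\<lambda>n. scale (l n) (x n)) sums 0"
    unfolding sums_def
  proof (rule LIMSEQ_I)
    fix \<epsilon> :: real
    assume \<epsilon>: "0 < \<epsilon>"
    obtain M where M: "lnorm p {M..} x \<le> ennreal (\<epsilon> / 4)"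
      using lnorm_atLeast_small[OF p xp, of "\<epsilon> / 4"] \<epsilon> by auto
    have "norm ((\<Sum>n<K. scale (l n) (x n)) - 0) < \<epsilon>" if K: "M \<le> K" for K
    proof -
      have "(\<lambda>m. norm ((\<Sum>n<K. scale (k (r m) n) (x n)) - D (\<omega> (r m)) (\<omega>' (r m)))) \<longlonglongrightarrow>
          norm ((\<Sum>n<K. scale (l n) (x n)) - 0)"
        by (intro tendsto_intros bounded_bilinear.tendsto[OF bounded_bilinear_scale] l D0)
      then have "norm ((\<Sum>n<K. scale (l n) (x n)) - 0) \<le> \<epsilon> / 4 * 2"
      proof (rule LIMSEQ_le_const2)
        show "\<exists>M. \<forall>m\<ge>M. norm ((\<Sum>n<K. scale (k (r m) n) (x n)) - D (\<omega> (r m)) (\<omega>' (r m))) \<le> \<epsilon> / 4 * 2"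
          using norm_partial_sum_diff_le[OF p _ M _ k(1) k(2) K] \<epsilon> by auto
      qed
      then show ?thesis
        using \<epsilon> by simp
    qed
    then show "\<exists>M. \<forall>K\<ge>M. norm ((\<Sum>n<K. scale (l n) (x n)) - 0) < \<epsilon>"
      by blast
  qed
  \<comment> \<open>Subtracting an expansion of 0 changes the coefficients but not the value. The
    bounds 2 for \<open>k m\<close> and for \<open>l\<close> add up to the 4 in the
    statement.\<close>
  then have sums: "(\<lambda>n. scale (k m n - l n) (x n)) sums D (\<omega> m) (\<omega>' m)" for m
    unfolding scale_left_diff_distrib using sums_diff[OF k(2)] by fastforce
  have "eventually (\<lambda>m. \<forall>n\<in>{..<N}. norm (k (r m) n - l n) < e) sequentially"
    using l e by (intro eventually_ball_finite) (auto simp: tendsto_iff dist_norm)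
  then obtain m where m: "\<forall>n\<in>{..<N}. norm (k (r m) n - l n) < e"
    using eventually_happens'[OF sequentially_bot] by blast
  have "lnorm (conj_index p) UNIV (\<lambda>n. k (r m) n - l n) \<le> ennreal (2 + 2)"
    by (rule lnorm_triangle_le[OF q _ k(1)[of "r m"] _ l2 norm_triangle_ineq4]) simp_all
  moreover have "\<forall>n<N. norm (k (r m) n - l n) \<le> e"
    using m by (auto intro: less_imp_le)
  ultimately have "good (\<omega> (r m)) (\<omega>' (r m))"
    unfolding good_def using sums[of "r m"] by (intro exI[of _ "\<lambda>n. k (r m) n - l n"]) simp
  then show False
    using bad by blast
qed

end


section \<open>Extension along partitions of unity\<close>

lemma wnorm_le_iff: "wnorm sX q I x \<le> C \<longleftrightarrow>
    (\<forall>f\<in>dual_ball sX. lnorm q I (\<lambda>i. blinfun_apply f (x i)) \<le> C)"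
  by (simp add: wnorm_def SUP_le_iff)

text \<open>Once phases are absorbed into the coefficients, a weighted sum of the numbers
  \<open>norm (f (\<phi> i))\<close> is the value of \<open>f\<close> at one function
  \<open>\<psi>\<close>, whose supremum norm is controlled pointwise.\<close>

lemma wnorm_scaleC_le:
  fixes \<phi> :: "nat \<Rightarrow> 'w::topological_space \<Rightarrow>\<^sub>C 'k::real_or_complex"
  assumes q: "1 \<le> q" and C: "0 \<le> C"
    and le: "\<And>\<omega>. lnorm q I (\<lambda>i. apply_bcontfun (\<phi> i) \<omega>) \<le> ennreal C"
  shows "wnorm (scaleC (*)) q I \<phi> \<le> ennreal C"
  unfolding wnorm_le_iff lnorm_le_iff_dual[OF q C]
proof (intro ballI allI impI, elim conjE)
  interpret K: banach_over "(*) :: 'k \<Rightarrow> 'k \<Rightarrow> 'k"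
    by (rule banach_over_scalars)
  fix f :: "('w \<Rightarrow>\<^sub>C 'k) \<Rightarrow>\<^sub>L 'k" and F and \<mu> :: "nat \<Rightarrow> real"
  assume f: "f \<in> dual_ball (scaleC (*))" and F: "finite F" "F \<subseteq> I"
    and \<mu>: "\<forall>i. 0 \<le> \<mu> i" "lnorm (conj_index q) F \<mu> \<le> 1"
  have f_lin: "blinfun_apply f (scaleC (*) a \<psi>) = a * blinfun_apply f \<psi>" for a \<psi>
    using f by (simp add: dual_ball_def bounded_ops_def)
  have "\<exists>t. norm t \<le> 1 \<and> t * blinfun_apply f (\<phi> i) = of_real (norm (blinfun_apply f (\<phi> i)))" for i
    using ex_unimodular_mult by metis
  then obtain t where t: "\<And>i. norm (t i) \<le> 1"
    "\<And>i. t i * blinfun_apply f (\<phi> i) = of_real (norm (blinfun_apply f (\<phi> i)))"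
    by metis
  define \<psi> where "\<psi> = (\<Sum>i\<in>F. scaleC (*) (of_real (\<mu> i) * t i) (\<phi> i))"
  have "blinfun_apply f \<psi> = of_real (\<Sum>i\<in>F. \<mu> i * norm (blinfun_apply f (\<phi> i)))"
    by (simp add: \<psi>_def blinfun.sum_right f_lin mult.assoc t)
  then have "(\<Sum>i\<in>F. \<mu> i * norm (blinfun_apply f (\<phi> i))) \<le> norm (blinfun_apply f \<psi>)"
    by (metis abs_ge_self norm_of_real)
  also have "\<dots> \<le> norm f * norm \<psi>"
    by (rule norm_blinfun)
  also have "\<dots> \<le> 1 * norm \<psi>"
    using f by (intro mult_right_mono) (auto simp: dual_ball_def)
  also have "\<dots> \<le> C"
    unfolding mult_1
  proof (rule norm_bound)
    fix \<omega>
    have "norm (apply_bcontfun \<psi> \<omega>) \<le> (\<Sum>i\<in>F. \<mu> i * norm (apply_bcontfun (\<phi> i) \<omega>))"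
      unfolding \<psi>_def apply_bcontfun_sum K.apply_scaleC
    proof (rule sum_norm_le)
      fix i
      have "\<mu> i * norm (t i) * norm (apply_bcontfun (\<phi> i) \<omega>) \<le> \<mu> i * 1 * norm (apply_bcontfun (\<phi> i) \<omega>)"
        using \<mu> t by (intro mult_right_mono mult_left_mono) auto
      then show "norm (of_real (\<mu> i) * t i * apply_bcontfun (\<phi> i) \<omega>) \<le> \<mu> i * norm (apply_bcontfun (\<phi> i) \<omega>)"
        using \<mu> by (simp add: norm_mult)
    qed
    also have "\<dots> \<le> C"
      using lnorm_le_iff_dual[OF q C, THEN iffD1, OF le, rule_format, of F \<mu>] F \<mu> by simp
    finally show "norm (apply_bcontfun \<psi> \<omega>) \<le> C" .
  qed
  finally show "(\<Sum>i\<in>F. \<mu> i * norm (blinfun_apply f (\<phi> i))) \<le> C" .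
qed

text \<open>Point evaluations lie in the dual ball. Together with the preceding bound, the weak norm
  on C(Omega) is the supremum of the pointwise norms.\<close>

lemma lnorm_apply_le_wnorm:
  fixes \<phi> :: "nat \<Rightarrow> 'w::topological_space \<Rightarrow>\<^sub>C 'k::real_or_complex"
  shows "lnorm q I (\<lambda>i. apply_bcontfun (\<phi> i) \<omega>) \<le> wnorm (scaleC (*)) q I \<phi>"
proof -
  interpret K: banach_over "(*) :: 'k \<Rightarrow> 'k \<Rightarrow> 'k"
    by (rule banach_over_scalars)
  interpret CK: normed_over "scaleC (*) :: 'k \<Rightarrow> ('w \<Rightarrow>\<^sub>C 'k) \<Rightarrow> _"
    by (rule K.normed_over_scaleC)
  obtain f :: "('w \<Rightarrow>\<^sub>C 'k) \<Rightarrow>\<^sub>L 'k"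
    where f: "f \<in> dual_ball (scaleC (*))" "\<And>\<phi>. blinfun_apply f \<phi> = apply_bcontfun \<phi> \<omega>"
  proof (rule CK.ex_dual_ball_functional[of "\<lambda>\<phi>. apply_bcontfun \<phi> \<omega>"])
    show "norm (apply_bcontfun \<phi> \<omega>) \<le> norm \<phi>" for \<phi> :: "'w \<Rightarrow>\<^sub>C 'k"
      by (rule norm_bounded)
  qed (simp_all add: K.apply_scaleC)
  then show ?thesis
    using SUP_upper[OF f(1), of "\<lambda>f. lnorm q I (\<lambda>i. blinfun_apply f (\<phi> i))"] by (simp add: wnorm_def f(2))
qed

locale C_operator = X: banach_over sX + Y: banach_over sY
  for sX :: "'k::real_or_complex \<Rightarrow> 'x::banach \<Rightarrow> 'x" and sY :: "'k \<Rightarrow> 'y::banach \<Rightarrow> 'y" +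
  fixes p :: ennreal and S :: "('w::topological_space \<Rightarrow>\<^sub>C 'k) \<Rightarrow>\<^sub>L ('x \<Rightarrow>\<^sub>L 'y)"
  assumes p: "1 \<le> p" and S: "S \<in> C_op_ops sX sY" and compact_domain: "compact (UNIV :: 'w set)"
begin

sublocale K: banach_over "(*) :: 'k \<Rightarrow> 'k \<Rightarrow> 'k"
  by (rule banach_over_scalars)

definition op :: "('w \<Rightarrow>\<^sub>C 'k) \<Rightarrow> 'x \<Rightarrow> 'y" where
  "op \<phi> x = blinfun_apply (blinfun_apply S \<phi>) x"

lemma q: "1 \<le> conj_index p"
  by (rule one_le_conj_index[OF p])

lemma op_scaleC: "op (scaleC (*) a \<phi>) x = sY a (op \<phi> x)"
  using S by (simp add: C_op_ops_def op_def)

lemma op_scale: "op \<phi> (sX a x) = sY a (op \<phi> x)"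
  using S by (simp add: C_op_ops_def bounded_ops_def op_def)

lemma op_scaleR: "op \<phi> (r *\<^sub>R x) = r *\<^sub>R op \<phi> x"
  by (simp add: op_def blinfun.scaleR_right)

lemma op_add_right: "op \<phi> (x + y) = op \<phi> x + op \<phi> y"
  by (simp add: op_def blinfun.add_right)

lemma op_diff_right: "op \<phi> (x - y) = op \<phi> x - op \<phi> y"
  by (simp add: op_def blinfun.diff_right)

lemma op_zero_left: "op 0 x = 0"
  by (simp add: op_def)

lemma op_zero_right: "op \<phi> 0 = 0"
  by (simp add: op_def blinfun.zero_right)

lemma op_sum_left: "op (\<Sum>i\<in>A. \<phi> i) x = (\<Sum>i\<in>A. op (\<phi> i) x)"
  by (simp add: op_def blinfun.sum_right blinfun.sum_left)

lemma op_sum_right: "op \<phi> (\<Sum>i\<in>A. x i) = (\<Sum>i\<in>A. op \<phi> (x i))"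
  by (simp add: op_def blinfun.sum_right)

lemma op_diff_left: "op (\<phi> - \<psi>) x = op \<phi> x - op \<psi> x"
  by (simp add: op_def blinfun.diff_right blinfun.diff_left)

lemma norm_op_le: "norm (op \<phi> x) \<le> norm S * norm \<phi> * norm x"
proof -
  have "norm (op \<phi> x) \<le> norm (blinfun_apply S \<phi>) * norm x"
    unfolding op_def by (rule norm_blinfun)
  also have "\<dots> \<le> norm S * norm \<phi> * norm x"
    by (intro mult_right_mono norm_blinfun) simp
  finally show ?thesis .
qed

text \<open>Statement (b) for a fixed constant.\<close>

definition finite_bound :: "real \<Rightarrow> bool" where
  "finite_bound c \<longleftrightarrow> (\<forall>(n::nat) (x :: nat \<Rightarrow> 'x) (\<phi> :: nat \<Rightarrow> 'w \<Rightarrow>\<^sub>C 'k).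
        wnorm sY (conj_index p) {..<n} (\<lambda>i. op (\<phi> i) (x i))
          \<le> ennreal c * lnorm \<infinity> {..<n} x * wnorm (scaleC (*)) (conj_index p) {..<n} \<phi>)"

section \<open>Estimates by p-norms from (b)\<close>

text \<open>(b) measures the vectors in the supremum norm. It is applied to the normalized vectors
  \<open>u i\<close>; Hoelder then pairs \<open>norm (x i)\<close> in the p-norm with
  \<open>f (op (\<phi> i) (u i))\<close> in the conjugate norm, for a norming functional
  \<open>f\<close>.\<close>

lemma norm_sum_op_le:
  assumes b: "finite_bound c" and c: "0 < c" and F: "finite F"
    and A: "0 \<le> A" "lnorm p F x \<le> ennreal A"
    and C: "0 \<le> C" "\<And>\<omega>. lnorm (conj_index p) F (\<lambda>i. apply_bcontfun (\<phi> i) \<omega>) \<le> ennreal C"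
  shows "norm (\<Sum>i\<in>F. op (\<phi> i) (x i)) \<le> c * A * C"
proof -
  obtain n where n: "F \<subseteq> {..<n}"
    using F finite_nat_bounded by blast
  then have Fn: "{..<n} \<inter> F = F"
    by blast
  \<comment> \<open>A zero vector gives \<open>u i = 0\<close>, as \<open>inverse 0 = 0\<close>.
    Padding \<open>\<phi>\<close> by zeros off \<open>F\<close> fits the initial segments in
    \<open>finite_bound\<close>.\<close>
  define u where "u i = inverse (norm (x i)) *\<^sub>R x i" for i
  define \<phi>' where "\<phi>' i = (if i \<in> F then \<phi> i else 0)" for i
  have xu: "x i = norm (x i) *\<^sub>R u i" for i
    by (cases "x i = 0") (simp_all add: u_def)
  have "lnorm \<infinity> {..<n} u \<le> ennreal 1"
    by (subst lnorm_infinity_le_iff) (auto simp: u_def field_simps)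
  moreover have "wnorm (scaleC (*)) (conj_index p) {..<n} \<phi>' \<le> ennreal C"
  proof (rule wnorm_scaleC_le[OF q C(1)])
    fix \<omega>
    have "(\<lambda>i. apply_bcontfun (\<phi>' i) \<omega>) = (\<lambda>i. if i \<in> F then apply_bcontfun (\<phi> i) \<omega> else 0)"
      by (auto simp: \<phi>'_def)
    then show "lnorm (conj_index p) {..<n} (\<lambda>i. apply_bcontfun (\<phi>' i) \<omega>) \<le> ennreal C"
      using C(2)[of \<omega>] by (simp add: lnorm_if[OF q] Fn)
  qed
  ultimately have "ennreal c * lnorm \<infinity> {..<n} u * wnorm (scaleC (*)) (conj_index p) {..<n} \<phi>' \<le>
      ennreal c * ennreal 1 * ennreal C"
    by (intro mult_mono) auto
  also have "\<dots> = ennreal (c * C)"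
    using c C by (simp add: ennreal_mult)
  finally have w: "wnorm sY (conj_index p) {..<n} (\<lambda>i. op (\<phi>' i) (u i)) \<le> ennreal (c * C)"
    using b unfolding finite_bound_def by (meson order_trans)
  define y where "y = (\<Sum>i\<in>F. op (\<phi> i) (x i))"
  obtain f where f: "f \<in> dual_ball sY" "norm y \<le> norm (blinfun_apply f y)"
    by (rule Y.norming_functional)
  have fw: "lnorm (conj_index p) F (\<lambda>i. blinfun_apply f (op (\<phi> i) (u i))) \<le> ennreal (c * C)"
  proof -
    have "lnorm (conj_index p) F (\<lambda>i. blinfun_apply f (op (\<phi> i) (u i))) \<le>
        lnorm (conj_index p) {..<n} (\<lambda>i. blinfun_apply f (op (\<phi>' i) (u i)))"
      using n by (intro lnorm_mono q) (auto simp: \<phi>'_def)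
    then show ?thesis
      using w f(1) unfolding wnorm_le_iff by (meson order_trans)
  qed
  have "blinfun_apply f y = (\<Sum>i\<in>F. norm (x i) *\<^sub>R blinfun_apply f (op (\<phi> i) (u i)))"
    unfolding y_def blinfun.sum_right by (subst xu) (simp add: op_scaleR blinfun.scaleR_right)
  then have "norm (blinfun_apply f y) \<le> (\<Sum>i\<in>F. norm (x i) * norm (blinfun_apply f (op (\<phi> i) (u i))))"
    by (auto intro!: sum_norm_le)
  also have "\<dots> \<le> A * (c * C)"
    using c C by (intro lnorm_Hoelder[OF p F A _ fw]) simp
  finally show ?thesis
    using f(2) by (simp add: y_def mult_ac)
qed

text \<open>Serves one partition of unity as well as products of two, hence the form of the
  condition on \<open>g\<close>; \<open>I\<close> selects head or tail of the expansions. At each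
  point the regrouped coefficients are dominated by an average of the \<open>\<gamma> j\<close> with
  weights \<open>norm (g j)\<close>.\<close>

lemma norm_sum_op_sums_le:
  assumes b: "finite_bound c" and c: "0 < c" and J: "finite J"
    and g: "\<And>\<omega>. (\<Sum>j\<in>J. norm (apply_bcontfun (g j) \<omega>)) \<le> 1"
    and A: "0 \<le> A" "lnorm p I x \<le> ennreal A"
    and C: "0 \<le> C" "\<And>j. j \<in> J \<Longrightarrow> lnorm (conj_index p) I (\<gamma> j) \<le> ennreal C"
    and v: "\<And>j. j \<in> J \<Longrightarrow> (\<lambda>n. if n \<in> I then sX (\<gamma> j n) (x n) else 0) sums v j"
  shows "norm (\<Sum>j\<in>J. op (g j) (v j)) \<le> c * A * C"
proof -
  define \<phi> where "\<phi> n = (\<Sum>j\<in>J. scaleC (*) (\<gamma> j n) (g j))" for n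
  \<comment> \<open>Truncation makes the regrouping an interchange of finite sums; the bound is
    independent of \<open>N\<close> and survives the limit.\<close>
  define T where "T j N = (\<Sum>n<N. if n \<in> I then sX (\<gamma> j n) (x n) else 0)" for j N
  have "norm (\<Sum>j\<in>J. op (g j) (T j N)) \<le> c * A * C" for N
  proof -
    have T: "T j N = (\<Sum>n\<in>{..<N} \<inter> I. sX (\<gamma> j n) (x n))" for j
      by (simp add: T_def sum.inter_restrict)
    have "(\<Sum>j\<in>J. op (g j) (T j N)) = (\<Sum>n\<in>{..<N} \<inter> I. op (\<phi> n) (x n))"
      unfolding T \<phi>_def op_sum_right op_sum_left op_scale op_scaleC by (rule sum.swap)
    also have "norm \<dots> \<le> c * A * C"
    proof (rule norm_sum_op_le[OF b c _ A(1) _ C(1)])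
      show "lnorm p ({..<N} \<inter> I) x \<le> ennreal A"
        by (rule order_trans[OF lnorm_mono[OF p] A(2)]) auto
      show "lnorm (conj_index p) ({..<N} \<inter> I) (\<lambda>n. apply_bcontfun (\<phi> n) \<omega>) \<le> ennreal C" for \<omega>
      proof (rule lnorm_convex_le[OF q C(1) J, of _ \<gamma> "\<lambda>j. norm (apply_bcontfun (g j) \<omega>)"])
        show "lnorm (conj_index p) ({..<N} \<inter> I) (\<gamma> j) \<le> ennreal C" if "j \<in> J" for j
          by (rule order_trans[OF lnorm_mono[OF q] C(2)[OF that]]) auto
        show "norm (apply_bcontfun (\<phi> n) \<omega>) \<le> (\<Sum>j\<in>J. norm (apply_bcontfun (g j) \<omega>) * norm (\<gamma> j n))" for n
          unfolding \<phi>_def apply_bcontfun_sum K.apply_scaleC by (rule sum_norm_le) (simp add: norm_mult mult.commute)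
      qed (use g in auto)
    qed simp
    finally show ?thesis .
  qed
  moreover have "(\<lambda>N. norm (\<Sum>j\<in>J. op (g j) (T j N))) \<longlonglongrightarrow> norm (\<Sum>j\<in>J. op (g j) (v j))"
    using v unfolding op_def sums_def T_def by (intro tendsto_intros) auto
  ultimately show ?thesis
    by (intro LIMSEQ_le_const2) auto
qed

text \<open>
  A triple \<open>(m, h, w)\<close> stands for a partition of unity \<open>h\<^sub>0, \<dots>, h\<^sub>m\<^sub>-\<^sub>1\<close> with sample points
  \<open>w\<^sub>0, \<dots>, w\<^sub>m\<^sub>-\<^sub>1\<close>. Fineness is measured by functions in \<open>\<C>(\<Omega>,X)\<close> instead of open covers.
\<close>

definition subordinate :: "('w \<Rightarrow>\<^sub>C 'x) set \<Rightarrow> real \<Rightarrow> nat \<times> (nat \<Rightarrow> 'w \<Rightarrow>\<^sub>C 'k) \<times> (nat \<Rightarrow> 'w) \<Rightarrow> bool" where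
  "subordinate G \<delta> = (\<lambda>(m, h, w).
    (\<forall>\<omega>. (\<Sum>j<m. apply_bcontfun (h j) \<omega>) = 1 \<and> (\<Sum>j<m. norm (apply_bcontfun (h j) \<omega>)) \<le> 1) \<and>
    (\<forall>f\<in>G. \<forall>j<m. \<forall>\<omega>. apply_bcontfun (h j) \<omega> \<noteq> 0 \<longrightarrow>
      norm (apply_bcontfun f \<omega> - apply_bcontfun f (w j)) < \<delta>))"

text \<open>One filter serves all functions, so limits for \<open>f\<close> and \<open>g\<close> can
  be added. Finite sets \<open>G\<close> make the generating sets closed under intersection up to
  refinement.\<close>

definition partitions :: "(nat \<times> (nat \<Rightarrow> 'w \<Rightarrow>\<^sub>C 'k) \<times> (nat \<Rightarrow> 'w)) filter" where
  "partitions = (INF (G, \<delta>)\<in>{(G, \<delta>). finite G \<and> 0 < \<delta>}. principal {\<pi>. subordinate G \<delta> \<pi>})"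

lemma eventually_partitions:
  "eventually P partitions \<longleftrightarrow> (\<exists>G \<delta>. finite G \<and> 0 < \<delta> \<and> (\<forall>\<pi>. subordinate G \<delta> \<pi> \<longrightarrow> P \<pi>))"
proof -
  have "eventually P partitions \<longleftrightarrow>
      (\<exists>b\<in>{(G, \<delta>). finite G \<and> 0 < \<delta>}. eventually P (case b of (G, \<delta>) \<Rightarrow> principal {\<pi>. subordinate G \<delta> \<pi>}))"
    unfolding partitions_def
  proof (rule eventually_INF_base)
    show "{(G::('w \<Rightarrow>\<^sub>C 'x) set, \<delta>::real). finite G \<and> 0 < \<delta>} \<noteq> {}"
      by (auto intro!: exI[of _ "{}"] exI[of _ 1])
    fix a b :: "('w \<Rightarrow>\<^sub>C 'x) set \<times> real"
    assume "a \<in> {(G, \<delta>). finite G \<and> 0 < \<delta>}" "b \<in> {(G, \<delta>). finite G \<and> 0 < \<delta>}"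
    then show "\<exists>x\<in>{(G, \<delta>). finite G \<and> 0 < \<delta>}. (case x of (G, \<delta>) \<Rightarrow> principal {\<pi>. subordinate G \<delta> \<pi>}) \<le>
        inf (case a of (G, \<delta>) \<Rightarrow> principal {\<pi>. subordinate G \<delta> \<pi>}) (case b of (G, \<delta>) \<Rightarrow> principal {\<pi>. subordinate G \<delta> \<pi>})"
      by (intro bexI[of _ "(fst a \<union> fst b, min (snd a) (snd b))"]) (auto simp: subordinate_def)
  qed
  then show ?thesis
    by (auto simp: eventually_principal)
qed

text \<open>The functions in \<open>G\<close> supply the bumps: \<open>d t\<close> is continuous and
  dominates each distance to be controlled, and \<open>\<delta> - d t\<close> is cut off at 0. By
  compactness finitely many bumps have a positive sum, by which they are divided.\<close>

lemma ex_subordinate: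
  assumes G: "finite G" and \<delta>: "0 < \<delta>"
  shows "\<exists>\<pi>. subordinate G \<delta> \<pi>"
proof -
  define d where "d t \<omega> = (\<Sum>f\<in>G. norm (apply_bcontfun f \<omega> - apply_bcontfun f t))" for t \<omega>
  have d_cont: "continuous_on UNIV (d t)" for t
    unfolding d_def by (intro continuous_intros) auto
  have "open {\<omega>. d t \<omega> < \<delta>}" for t
    using d_cont by (intro open_Collect_less) (auto intro: continuous_intros)
  moreover have "UNIV \<subseteq> (\<Union>t. {\<omega>. d t \<omega> < \<delta>})"
    using \<delta> by (auto simp: d_def intro!: exI)
  ultimately obtain T where T: "finite T" "UNIV \<subseteq> (\<Union>t\<in>T. {\<omega>. d t \<omega> < \<delta>})"
    using compactE_image[OF compact_domain, of UNIV "\<lambda>t. {\<omega>. d t \<omega> < \<delta>}"] by metis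
  obtain w where w: "bij_betw w {..<card T} T"
    using ex_bij_betw_nat_finite[OF T(1)] by (auto simp: lessThan_atLeast0)
  define e where "e j \<omega> = max 0 (\<delta> - d (w j) \<omega>)" for j \<omega>
  define E where "E \<omega> = (\<Sum>j<card T. e j \<omega>)" for \<omega>
  have e_cont: "continuous_on UNIV (e j)" for j
    unfolding e_def by (intro continuous_intros d_cont)
  have E_cont: "continuous_on UNIV E"
    unfolding E_def by (intro continuous_intros e_cont)
  have e_nonneg: "0 \<le> e j \<omega>" for j \<omega>
    by (simp add: e_def)
  have E_pos: "0 < E \<omega>" for \<omega>
  proof -
    obtain t where "t \<in> T" "d t \<omega> < \<delta>"
      using T(2) by blast
    then obtain j where "j < card T" "0 < e j \<omega>"
      using w unfolding e_def bij_betw_def by (metis diff_gt_0_iff_gt imageE lessThan_iff max.strict_coboundedI2)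
    then show ?thesis
      unfolding E_def using e_nonneg by (intro sum_pos2[of _ j]) auto
  qed
  define h where "h j = Bcontfun (\<lambda>\<omega>. of_real (e j \<omega> / E \<omega>) :: 'k)" for j
  \<comment> \<open>For \<open>j < card T\<close> the term \<open>e j\<close> is a summand of
    \<open>E\<close>; this bounds the quotient by 1 and makes \<open>Bcontfun\<close>
    meaningful.\<close>
  have h: "apply_bcontfun (h j) \<omega> = of_real (e j \<omega> / E \<omega>)" if "j < card T" for j \<omega>
  proof -
    have "(\<lambda>\<omega>. of_real (e j \<omega> / E \<omega>) :: 'k) \<in> bcontfun"
    proof (rule bcontfun_normI)
      show "continuous_on UNIV (\<lambda>\<omega>. of_real (e j \<omega> / E \<omega>) :: 'k)"
        using E_pos by (intro continuous_intros e_cont E_cont) (simp add: less_imp_neq[symmetric])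
      show "norm (of_real (e j \<omega> / E \<omega>) :: 'k) \<le> 1" for \<omega>
      proof -
        have "e j \<omega> \<le> E \<omega>"
          unfolding E_def using that e_nonneg by (intro member_le_sum) auto
        then show ?thesis
          using E_pos[of \<omega>] e_nonneg[of j \<omega>] unfolding norm_of_real by simp
      qed
    qed
    then show ?thesis
      by (simp add: h_def Bcontfun_inverse)
  qed
  have "subordinate G \<delta> (card T, h, w)"
    unfolding subordinate_def split
  proof (intro conjI allI impI ballI)
    fix \<omega>
    have one: "(\<Sum>j<card T. e j \<omega> / E \<omega>) = 1"
      using E_pos[of \<omega>] by (simp add: E_def flip: sum_divide_distrib)
    have "(\<Sum>j<card T. apply_bcontfun (h j) \<omega>) = of_real (\<Sum>j<card T. e j \<omega> / E \<omega>)"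
      unfolding of_real_sum by (intro sum.cong) (auto simp: h)
    then show "(\<Sum>j<card T. apply_bcontfun (h j) \<omega>) = 1"
      using one by simp
    have "(\<Sum>j<card T. norm (apply_bcontfun (h j) \<omega>)) = (\<Sum>j<card T. e j \<omega> / E \<omega>)"
      using E_pos[of \<omega>] e_nonneg by (intro sum.cong) (auto simp: h simp del: of_real_divide)
    then show "(\<Sum>j<card T. norm (apply_bcontfun (h j) \<omega>)) \<le> 1"
      using one by simp
  next
    fix f j \<omega>
    assume f: "f \<in> G" and j: "j < card T" and "apply_bcontfun (h j) \<omega> \<noteq> 0"
    then have "d (w j) \<omega> < \<delta>"
      by (auto simp: h e_def max_def split: if_splits)
    moreover have "norm (apply_bcontfun f \<omega> - apply_bcontfun f (w j)) \<le> d (w j) \<omega>"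
      unfolding d_def using f G by (intro member_le_sum) auto
    ultimately show "norm (apply_bcontfun f \<omega> - apply_bcontfun f (w j)) < \<delta>"
      by simp
  qed
  then show ?thesis
    by blast
qed

lemma partitions_neq_bot: "partitions \<noteq> bot"
  using ex_subordinate unfolding trivial_limit_def eventually_partitions by blast

section \<open>Riemann sums and their convergence\<close>

definition riemann_sum :: "('w \<Rightarrow>\<^sub>C 'x) \<Rightarrow> nat \<times> (nat \<Rightarrow> 'w \<Rightarrow>\<^sub>C 'k) \<times> (nat \<Rightarrow> 'w) \<Rightarrow> 'y" where
  "riemann_sum f = (\<lambda>(m, h, w). \<Sum>j<m. op (h j) (apply_bcontfun f (w j)))"

lemma bcontfun_mult:
  fixes g h :: "'w \<Rightarrow>\<^sub>C 'k"
  obtains gh where "\<And>\<omega>. apply_bcontfun gh \<omega> = apply_bcontfun g \<omega> * apply_bcontfun h \<omega>"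
proof -
  have "(\<lambda>\<omega>. apply_bcontfun g \<omega> * apply_bcontfun h \<omega>) \<in> bcontfun"
    by (rule bcontfun_normI[of _ "norm g * norm h"])
      (auto intro!: continuous_intros mult_mono norm_bounded simp: norm_mult)
  then show thesis
    using that[of "Bcontfun (\<lambda>\<omega>. apply_bcontfun g \<omega> * apply_bcontfun h \<omega>)"] by (simp add: Bcontfun_inverse)
qed

text \<open>Products of the two partitions form a common refinement. \<open>J\<close> keeps the
  products that are not identically zero: a point where one is nonzero links both sample values. For
  other pairs the sample values may be far apart.\<close>

lemma riemann_sum_diff:
  assumes "subordinate {f} \<delta> (m, h, w)" "subordinate {f} \<delta> (m', h', w')"
  obtains g J where "J \<subseteq> {..<m} \<times> {..<m'}"
    "\<And>\<omega>. (\<Sum>i\<in>J. norm (apply_bcontfun (g i) \<omega>)) \<le> 1"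
    "\<And>j j'. (j, j') \<in> J \<Longrightarrow> norm (apply_bcontfun f (w j) - apply_bcontfun f (w' j')) < 2 * \<delta>"
    "riemann_sum f (m, h, w) - riemann_sum f (m', h', w') =
      (\<Sum>i\<in>J. op (g i) (apply_bcontfun f (w (fst i)) - apply_bcontfun f (w' (snd i))))"
proof -
  have h: "(\<Sum>j<m. apply_bcontfun (h j) \<omega>) = 1" "(\<Sum>j<m. norm (apply_bcontfun (h j) \<omega>)) \<le> 1"
    and hd: "\<And>j. j < m \<Longrightarrow> apply_bcontfun (h j) \<omega> \<noteq> 0 \<Longrightarrow> norm (apply_bcontfun f \<omega> - apply_bcontfun f (w j)) < \<delta>"
    and h': "(\<Sum>j<m'. apply_bcontfun (h' j) \<omega>) = 1" "(\<Sum>j<m'. norm (apply_bcontfun (h' j) \<omega>)) \<le> 1"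
    and hd': "\<And>j. j < m' \<Longrightarrow> apply_bcontfun (h' j) \<omega> \<noteq> 0 \<Longrightarrow> norm (apply_bcontfun f \<omega> - apply_bcontfun f (w' j)) < \<delta>"
    for \<omega>
    using assms by (auto simp: subordinate_def)
  have "\<exists>gh. \<forall>\<omega>. apply_bcontfun gh \<omega> = apply_bcontfun (h (fst i)) \<omega> * apply_bcontfun (h' (snd i)) \<omega>" for i
    by (rule bcontfun_mult[of "h (fst i)" "h' (snd i)"]) blast
  then have "\<exists>g. \<forall>i \<omega>. apply_bcontfun (g i) \<omega> = apply_bcontfun (h (fst i)) \<omega> * apply_bcontfun (h' (snd i)) \<omega>"
    by (intro choice) blast
  then obtain g where g: "\<And>i \<omega>. apply_bcontfun (g i) \<omega> = apply_bcontfun (h (fst i)) \<omega> * apply_bcontfun (h' (snd i)) \<omega>"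
    by blast
  define J where "J = {i \<in> {..<m} \<times> {..<m'}. g i \<noteq> 0}"
  have J: "J \<subseteq> {..<m} \<times> {..<m'}"
    by (auto simp: J_def)
  have op_h: "op (h j) x = (\<Sum>j'<m'. op (g (j, j')) x)" for j x
  proof -
    have "h j = (\<Sum>j'<m'. g (j, j'))"
      by (rule bcontfun_eqI) (simp add: apply_bcontfun_sum g h' flip: sum_distrib_left)
    then show ?thesis
      by (simp add: op_sum_left)
  qed
  have op_h': "op (h' j') x = (\<Sum>j<m. op (g (j, j')) x)" for j' x
  proof -
    have "h' j' = (\<Sum>j<m. g (j, j'))"
      by (rule bcontfun_eqI) (simp add: apply_bcontfun_sum g h flip: sum_distrib_right)
    then show ?thesis
      by (simp add: op_sum_left)
  qed
  show thesis
  proof (rule that[OF J, of g])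
    fix \<omega>
    have "(\<Sum>i\<in>J. norm (apply_bcontfun (g i) \<omega>)) \<le> (\<Sum>i\<in>{..<m} \<times> {..<m'}. norm (apply_bcontfun (g i) \<omega>))"
      using J by (intro sum_mono2) auto
    also have "\<dots> = (\<Sum>j<m. norm (apply_bcontfun (h j) \<omega>)) * (\<Sum>j<m'. norm (apply_bcontfun (h' j) \<omega>))"
      by (simp add: g norm_mult sum_product sum.cartesian_product case_prod_unfold)
    also have "\<dots> \<le> 1"
      using h(2) h'(2) by (intro mult_le_one sum_nonneg) auto
    finally show "(\<Sum>i\<in>J. norm (apply_bcontfun (g i) \<omega>)) \<le> 1" .
  next
    fix j j'
    assume jj: "(j, j') \<in> J"
    then obtain \<omega> where "apply_bcontfun (g (j, j')) \<omega> \<noteq> 0"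
      using bcontfun_eqI[of "g (j, j')" 0] by (auto simp: J_def)
    then have "norm (apply_bcontfun f \<omega> - apply_bcontfun f (w j)) < \<delta>"
      "norm (apply_bcontfun f \<omega> - apply_bcontfun f (w' j')) < \<delta>"
      using hd hd' jj J by (auto simp: g)
    then show "norm (apply_bcontfun f (w j) - apply_bcontfun f (w' j')) < 2 * \<delta>"
      using dist_triangle3[of "apply_bcontfun f (w j)" "apply_bcontfun f (w' j')" "apply_bcontfun f \<omega>"]
      by (simp add: dist_norm)
  next
    define D where "D i = apply_bcontfun f (w (fst i)) - apply_bcontfun f (w' (snd i))" for i
    have "riemann_sum f (m, h, w) = (\<Sum>j<m. \<Sum>j'<m'. op (g (j, j')) (apply_bcontfun f (w j)))"
      by (simp add: riemann_sum_def op_h)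
    moreover have "riemann_sum f (m', h', w') = (\<Sum>j<m. \<Sum>j'<m'. op (g (j, j')) (apply_bcontfun f (w' j')))"
      unfolding riemann_sum_def split op_h' by (rule sum.swap)
    ultimately have "riemann_sum f (m, h, w) - riemann_sum f (m', h', w') =
        (\<Sum>j<m. \<Sum>j'<m'. op (g (j, j')) (D (j, j')))"
      by (simp add: D_def op_diff_right sum_subtractf)
    also have "\<dots> = (\<Sum>i\<in>{..<m} \<times> {..<m'}. op (g i) (D i))"
      by (simp add: sum.cartesian_product case_prod_unfold)
    also have "\<dots> = (\<Sum>i\<in>J. op (g i) (D i))"
      by (rule sum.mono_neutral_right) (auto simp: J_def op_zero_left)
    finally show "riemann_sum f (m, h, w) - riemann_sum f (m', h', w') =
        (\<Sum>i\<in>J. op (g i) (apply_bcontfun f (w (fst i)) - apply_bcontfun f (w' (snd i))))"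
      by (simp add: D_def)
  qed
qed

text \<open>A Cauchy argument: the expansions of the differences of sample values are split at
  \<open>N\<close>, and each part is estimated separately, with small coefficients in the head and
  small vectors in the tail.\<close>

lemma riemann_sum_convergent:
  assumes b: "finite_bound c" and c: "0 < c" and dom: "Cp_dominates sX p f x"
  shows "\<exists>y. (riemann_sum f \<longlongrightarrow> y) partitions"
proof -
  obtain A where A: "0 \<le> A" "lnorm p UNIV x = ennreal A"
    using lnorm_realE[OF X.Cp_dominates_lnorm_finite[OF dom]] by metis
  have xp: "x \<in> (if p = \<infinity> then c_zero else ell p)"
    using dom by (simp add: Cp_dominates_def)
  have "cauchy_filter (filtermap (riemann_sum f) partitions)"
    unfolding cauchy_filter_metric_filtermap
  proof (intro allI impI)
    fix e :: real
    assume e: "0 < e"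
    \<comment> \<open>The tail estimate is \<open>c\<close> times this p-norm bound times the
      coefficient bound 4, which makes \<open>e / 4\<close>.\<close>
    define \<epsilon>1 where "\<epsilon>1 = e / (16 * c)"
    have \<epsilon>1: "0 < \<epsilon>1" "c * \<epsilon>1 * 4 = e / 4"
      using e c by (simp_all add: \<epsilon>1_def)
    obtain N where N: "lnorm p {N..} x \<le> ennreal \<epsilon>1"
      using lnorm_atLeast_small[OF p xp \<epsilon>1(1)] .
    \<comment> \<open>Chosen after \<open>N\<close>, since the head costs up to \<open>N\<close>
      times the coefficient size. The added 1s keep the denominator positive.\<close>
    define \<epsilon> where "\<epsilon> = e / (4 * c * (A + 1) * (real N + 1))"
    have \<epsilon>: "0 < \<epsilon>"
      using e c A by (simp add: \<epsilon>_def)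
    have \<epsilon>_le: "c * A * (real N * \<epsilon>) \<le> e / 4"
    proof -
      have "c * A * (real N * \<epsilon>) \<le> c * (A + 1) * ((real N + 1) * \<epsilon>)"
        using c A \<epsilon> by (intro mult_mono) auto
      also have "\<dots> = e / 4"
        using c A by (simp add: \<epsilon>_def) (simp add: divide_eq_eq algebra_simps)
      finally show ?thesis .
    qed
    obtain d where d: "0 < d" "\<And>\<omega> \<omega>'. norm (apply_bcontfun f \<omega> - apply_bcontfun f \<omega>') < d \<Longrightarrow>
      \<exists>\<gamma>. lnorm (conj_index p) UNIV \<gamma> \<le> ennreal 4 \<and> (\<forall>n<N. norm (\<gamma> n) \<le> \<epsilon>) \<and>
        (\<lambda>n. sX (\<gamma> n) (x n)) sums (apply_bcontfun f \<omega> - apply_bcontfun f \<omega>')"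
      using X.Cp_dominates_small_coeffs[OF p dom \<epsilon>, of N] by blast
    show "\<exists>P. eventually P partitions \<and> (\<forall>\<pi> \<pi>'. P \<pi> \<and> P \<pi>' \<longrightarrow> dist (riemann_sum f \<pi>) (riemann_sum f \<pi>') < e)"
    proof (intro exI conjI allI impI; (elim conjE)?)
      \<comment> \<open>Half of \<open>d\<close>, because sample values of two partitions are
        compared through a common point.\<close>
      show "eventually (subordinate {f} (d / 2)) partitions"
        unfolding eventually_partitions using d(1) by (intro exI[of _ "{f}"] exI[of _ "d / 2"]) simp
      fix \<pi> \<pi>'
      assume \<pi>: "subordinate {f} (d / 2) \<pi>" "subordinate {f} (d / 2) \<pi>'"
      obtain m h w m' h' w' where \<pi>_eq: "\<pi> = (m, h, w)" "\<pi>' = (m', h', w')"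
        by (cases \<pi>; cases \<pi>') auto
      obtain J g where J: "J \<subseteq> {..<m} \<times> {..<m'}"
        and g: "\<And>\<omega>. (\<Sum>i\<in>J. norm (apply_bcontfun (g i) \<omega>)) \<le> 1"
        and near: "\<And>j j'. (j, j') \<in> J \<Longrightarrow> norm (apply_bcontfun f (w j) - apply_bcontfun f (w' j')) < 2 * (d / 2)"
        and diff: "riemann_sum f (m, h, w) - riemann_sum f (m', h', w') =
          (\<Sum>i\<in>J. op (g i) (apply_bcontfun f (w (fst i)) - apply_bcontfun f (w' (snd i))))"
      proof (rule riemann_sum_diff[OF \<pi>[unfolded \<pi>_eq]], goal_cases)
        case (1 g J)
        from that[OF 1(2-5)] show ?case .
      qed
      have finJ: "finite J"
        using J finite_subset by blast
      define D where "D i = apply_bcontfun f (w (fst i)) - apply_bcontfun f (w' (snd i))" for i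
      have "\<forall>i\<in>J. \<exists>\<gamma>. lnorm (conj_index p) UNIV \<gamma> \<le> ennreal 4 \<and> (\<forall>n<N. norm (\<gamma> n) \<le> \<epsilon>) \<and>
          (\<lambda>n. sX (\<gamma> n) (x n)) sums D i"
        using near d(2) by (auto simp: D_def)
      then obtain \<gamma> where \<gamma>: "\<And>i. i \<in> J \<Longrightarrow> lnorm (conj_index p) UNIV (\<gamma> i) \<le> ennreal 4"
          "\<And>i n. i \<in> J \<Longrightarrow> n < N \<Longrightarrow> norm (\<gamma> i n) \<le> \<epsilon>"
          "\<And>i. i \<in> J \<Longrightarrow> (\<lambda>n. sX (\<gamma> i n) (x n)) sums D i"
        by metis
      define H where "H i = (\<Sum>n<N. sX (\<gamma> i n) (x n))" for i
      have H: "(\<lambda>n. if n \<in> {..<N} then sX (\<gamma> i n) (x n) else 0) sums H i" for i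
        unfolding H_def by (rule sums_If_finite_set) simp
      have T: "(\<lambda>n. if n \<in> {N..} then sX (\<gamma> i n) (x n) else 0) sums (D i - H i)" if "i \<in> J" for i
      proof -
        have "(\<lambda>n. sX (\<gamma> i n) (x n) - (if n \<in> {..<N} then sX (\<gamma> i n) (x n) else 0)) sums (D i - H i)"
          by (rule sums_diff[OF \<gamma>(3)[OF that] H])
        moreover have "(\<lambda>n. sX (\<gamma> i n) (x n) - (if n \<in> {..<N} then sX (\<gamma> i n) (x n) else 0)) =
            (\<lambda>n. if n \<in> {N..} then sX (\<gamma> i n) (x n) else 0)"
          by auto
        ultimately show ?thesis
          by simp
      qed
      have head: "norm (\<Sum>i\<in>J. op (g i) (H i)) \<le> c * A * (real N * \<epsilon>)"
      proof (rule norm_sum_op_sums_le[OF b c finJ g A(1), where I = "{..<N}"])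
        show "lnorm p {..<N} x \<le> ennreal A"
          using lnorm_mono[OF p, of "{..<N}" UNIV x x] A by simp
        show "lnorm (conj_index p) {..<N} (\<gamma> i) \<le> ennreal (real N * \<epsilon>)" if "i \<in> J" for i
        proof (rule order_trans[OF lnorm_le_sum[OF q]])
          have "(\<Sum>n<N. norm (\<gamma> i n)) \<le> (\<Sum>n<N. \<epsilon>)"
            using \<gamma>(2)[OF that] by (intro sum_mono) auto
          then show "ennreal (\<Sum>n<N. norm (\<gamma> i n)) \<le> ennreal (real N * \<epsilon>)"
            by (intro ennreal_leI) simp
        qed simp
      qed (use \<epsilon> H in auto)
      have tail: "norm (\<Sum>i\<in>J. op (g i) (D i - H i)) \<le> c * \<epsilon>1 * 4"
      proof (rule norm_sum_op_sums_le[OF b c finJ g _ N _ _ T])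
        show "lnorm (conj_index p) {N..} (\<gamma> i) \<le> ennreal 4" if "i \<in> J" for i
          by (rule order_trans[OF lnorm_mono[OF q] \<gamma>(1)[OF that]]) auto
      qed (use \<epsilon>1 in auto)
      have "riemann_sum f \<pi> - riemann_sum f \<pi>' = (\<Sum>i\<in>J. op (g i) (H i)) + (\<Sum>i\<in>J. op (g i) (D i - H i))"
        unfolding \<pi>_eq diff D_def[symmetric] by (simp add: op_diff_right sum_subtractf)
      then have "dist (riemann_sum f \<pi>) (riemann_sum f \<pi>') \<le>
          norm (\<Sum>i\<in>J. op (g i) (H i)) + norm (\<Sum>i\<in>J. op (g i) (D i - H i))"
        by (simp add: dist_norm norm_triangle_ineq)
      also have "\<dots> \<le> e / 4 + e / 4"
        using head tail \<epsilon>_le \<epsilon>1 by simp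
      finally show "dist (riemann_sum f \<pi>) (riemann_sum f \<pi>') < e"
        using e by simp
    qed
  qed
  moreover have "filtermap (riemann_sum f) partitions \<noteq> bot"
    using partitions_neq_bot by (simp add: filtermap_bot_iff)
  ultimately show ?thesis
    unfolding filterlim_def
    by (intro cauchy_filter_complete_converges[of _ UNIV]) (simp_all add: complete_UNIV)
qed

text \<open>Here the coefficients come from the unit ball, and the bound does not depend on the
  partition, so it passes to the limit.\<close>

lemma norm_riemann_sum_le:
  assumes b: "finite_bound c" and c: "0 < c" and dom: "Cp_dominates sX p f x"
    and A: "0 \<le> A" "lnorm p UNIV x \<le> ennreal A" and \<pi>: "subordinate G \<delta> \<pi>"
  shows "norm (riemann_sum f \<pi>) \<le> c * A"
proof -
  obtain m h w where \<pi>_eq: "\<pi> = (m, h, w)"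
    by (cases \<pi>) auto
  have "\<forall>j. \<exists>\<alpha>. lnorm (conj_index p) UNIV \<alpha> \<le> 1 \<and> (\<lambda>n. sX (\<alpha> n) (x n)) sums apply_bcontfun f (w j)"
    using X.Cp_dominates_coeffs[OF dom] by metis
  then obtain \<alpha> where \<alpha>: "\<And>j. lnorm (conj_index p) UNIV (\<alpha> j) \<le> 1"
    "\<And>j. (\<lambda>n. sX (\<alpha> j n) (x n)) sums apply_bcontfun f (w j)"
    by metis
  have "norm (\<Sum>j<m. op (h j) (apply_bcontfun f (w j))) \<le> c * A * 1"
    by (rule norm_sum_op_sums_le[OF b c _ _ A, of _ _ 1 \<alpha>]) (use \<alpha> \<pi> in \<open>auto simp: subordinate_def \<pi>_eq\<close>)
  then show ?thesis
    by (simp add: riemann_sum_def \<pi>_eq)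
qed

text \<open>For a product \<open>\<phi> x\<close> the Riemann sum is \<open>op \<psi> x\<close>,
  where \<open>\<psi>\<close> averages sampled values of \<open>\<phi>\<close>. It tends to
  \<open>\<phi>\<close> uniformly, and boundedness of \<open>S\<close> gives the limit.\<close>

lemma riemann_sum_fun_times: "(riemann_sum (fun_times sX \<phi> x) \<longlongrightarrow> op \<phi> x) partitions"
\<comment> \<open>Fineness is measured on \<open>\<phi> x\<close>, so closeness for
  \<open>\<phi>\<close> itself requires division by \<open>norm x\<close>.\<close>
proof (cases "x = 0")
  case True
  have "apply_bcontfun (fun_times sX \<phi> x) \<omega> = 0" for \<omega>
    by (simp add: X.apply_fun_times True)
  then have "riemann_sum (fun_times sX \<phi> x) = (\<lambda>_. 0)"
    by (auto simp: riemann_sum_def op_zero_right)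
  then show ?thesis
    by (simp add: True op_zero_right)
next
  case False
  show ?thesis
    unfolding tendsto_iff
  proof (intro allI impI)
    fix e :: real
    assume e: "0 < e"
    define \<delta> where "\<delta> = e / (norm S + 1)"
    have \<delta>: "0 < \<delta>" "norm S * \<delta> < e"
      using e norm_ge_zero[of S] unfolding \<delta>_def by (simp_all add: field_simps add_pos_nonneg add_nonneg_pos)
    show "\<forall>\<^sub>F \<pi> in partitions. dist (riemann_sum (fun_times sX \<phi> x) \<pi>) (op \<phi> x) < e"
      unfolding eventually_partitions
    proof (intro exI conjI allI impI)
      fix \<pi>
      assume \<pi>: "subordinate {fun_times sX \<phi> x} \<delta> \<pi>"
      obtain m h w where \<pi>_eq: "\<pi> = (m, h, w)"
        by (cases \<pi>) auto
      have h: "(\<Sum>j<m. apply_bcontfun (h j) \<omega>) = 1" "(\<Sum>j<m. norm (apply_bcontfun (h j) \<omega>)) \<le> 1" for \<omega>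
        using \<pi> by (auto simp: subordinate_def \<pi>_eq)
      have near: "norm (apply_bcontfun \<phi> \<omega> - apply_bcontfun \<phi> (w j)) * norm x < \<delta>"
        if "j < m" "apply_bcontfun (h j) \<omega> \<noteq> 0" for j \<omega>
      proof -
        have "norm (sX (apply_bcontfun \<phi> \<omega> - apply_bcontfun \<phi> (w j)) x) < \<delta>"
          using \<pi> that by (auto simp: subordinate_def \<pi>_eq X.apply_fun_times X.scale_left_diff_distrib)
        then show ?thesis
          by (simp add: X.norm_scale)
      qed
      define \<psi> where "\<psi> = (\<Sum>j<m. scaleC (*) (apply_bcontfun \<phi> (w j)) (h j))"
      have "riemann_sum (fun_times sX \<phi> x) \<pi> = op \<psi> x"
        unfolding riemann_sum_def \<pi>_eq \<psi>_def split X.apply_fun_times op_scale op_sum_left op_scaleC ..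
      moreover have "norm (\<psi> - \<phi>) \<le> \<delta> / norm x"
      proof (rule norm_bound)
        fix \<omega>
        have "apply_bcontfun (\<psi> - \<phi>) \<omega> =
            (\<Sum>j<m. apply_bcontfun (h j) \<omega> * (apply_bcontfun \<phi> (w j) - apply_bcontfun \<phi> \<omega>))"
          using h(1)[of \<omega>] by (simp add: \<psi>_def apply_bcontfun_sum K.apply_scaleC right_diff_distrib sum_subtractf
              mult.commute[of "apply_bcontfun \<phi> _"] flip: sum_distrib_right)
        also have "norm \<dots> \<le> (\<Sum>j<m. norm (apply_bcontfun (h j) \<omega>) * (\<delta> / norm x))"
        proof (rule sum_norm_le)
          fix j
          assume j: "j \<in> {..<m}"
          show "norm (apply_bcontfun (h j) \<omega> * (apply_bcontfun \<phi> (w j) - apply_bcontfun \<phi> \<omega>)) \<le>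
              norm (apply_bcontfun (h j) \<omega>) * (\<delta> / norm x)"
          proof (cases "apply_bcontfun (h j) \<omega> = 0")
            case False
            then have "norm (apply_bcontfun \<phi> (w j) - apply_bcontfun \<phi> \<omega>) \<le> \<delta> / norm x"
              using near[of j \<omega>] j \<open>x \<noteq> 0\<close> by (simp add: field_simps norm_minus_commute)
            then show ?thesis
              unfolding norm_mult by (intro mult_left_mono) auto
          qed simp
        qed
        also have "\<dots> \<le> 1 * (\<delta> / norm x)"
          unfolding sum_distrib_right[symmetric] using h \<delta> by (intro mult_right_mono) auto
        finally show "norm (apply_bcontfun (\<psi> - \<phi>) \<omega>) \<le> \<delta> / norm x"
          by simp
      qed
      then have "norm S * norm (\<psi> - \<phi>) * norm x \<le> norm S * (\<delta> / norm x) * norm x"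
        by (intro mult_right_mono mult_left_mono) auto
      then have "norm (op (\<psi> - \<phi>) x) \<le> norm S * \<delta>"
        using norm_op_le[of "\<psi> - \<phi>" x] False by simp
      ultimately show "dist (riemann_sum (fun_times sX \<phi> x) \<pi>) (op \<phi> x) < e"
        using \<delta> by (simp add: dist_norm op_diff_left)
    qed (use \<delta> in auto)
  qed
qed

text \<open>Where the limit does not exist the value is unspecified; \<open>Cp_ops\<close> looks at
  \<open>Cp\<close> only.\<close>

definition extension :: "('w \<Rightarrow>\<^sub>C 'x) \<Rightarrow> 'y" where
  "extension f = Lim partitions (riemann_sum f)"

lemma extensionI: "(riemann_sum f \<longlongrightarrow> y) partitions \<Longrightarrow> extension f = y"
  unfolding extension_def by (rule tendsto_Lim[OF partitions_neq_bot])

lemma extension_in_Cp_ops: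
  assumes b: "finite_bound c" and c: "0 < c"
  shows "extension \<in> Cp_ops sX sY p"
proof -
  have lim: "(riemann_sum f \<longlongrightarrow> extension f) partitions" if "f \<in> Cp sX p" for f :: "'w \<Rightarrow>\<^sub>C 'x"
    using that riemann_sum_convergent[OF b c] extensionI unfolding Cp_def by blast
  show ?thesis
    unfolding Cp_ops_def
  proof (intro CollectI conjI ballI allI exI)
    fix f g :: "'w \<Rightarrow>\<^sub>C 'x"
    assume "f \<in> Cp sX p" "g \<in> Cp sX p"
    then have "((\<lambda>\<pi>. riemann_sum f \<pi> + riemann_sum g \<pi>) \<longlongrightarrow> extension f + extension g) partitions"
      by (intro tendsto_add lim)
    \<comment> \<open>Additivity holds for each partition, so the limit for \<open>f + g\<close>
      exists without a proof that \<open>f + g\<close> lies in \<open>Cp\<close>.\<close>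
    moreover have "(\<lambda>\<pi>. riemann_sum f \<pi> + riemann_sum g \<pi>) = riemann_sum (f + g)"
      by (auto simp: riemann_sum_def op_add_right sum.distrib)
    ultimately show "extension (f + g) = extension f + extension g"
      by (intro extensionI) simp
  next
    fix a and f :: "'w \<Rightarrow>\<^sub>C 'x"
    assume "f \<in> Cp sX p"
    then have "((\<lambda>\<pi>. sY a (riemann_sum f \<pi>)) \<longlongrightarrow> sY a (extension f)) partitions"
      by (intro bounded_bilinear.tendsto[OF Y.bounded_bilinear_scale] tendsto_const lim)
    moreover have "(\<lambda>\<pi>. sY a (riemann_sum f \<pi>)) = riemann_sum (scaleC sX a f)"
      by (auto simp: riemann_sum_def op_scale X.apply_scaleC Y.scale_sum_right)
    ultimately show "extension (scaleC sX a f) = sY a (extension f)"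
      by (intro extensionI) simp
  next
    fix f :: "'w \<Rightarrow>\<^sub>C 'x"
    assume f: "f \<in> Cp sX p"
    \<comment> \<open>With \<open>c\<close> on the left, the infimum in \<open>Cp_norm\<close> is
      bounded one dominating sequence at a time.\<close>
    have "ennreal (norm (extension f)) / ennreal c \<le> Cp_norm sX p f"
      unfolding Cp_norm_def
    proof (rule INF_greatest)
      fix x
      assume "x \<in> {x. Cp_dominates sX p f x}"
      then have dom: "Cp_dominates sX p f x"
        by simp
      obtain A where A: "0 \<le> A" "lnorm p UNIV x = ennreal A"
        using lnorm_realE[OF X.Cp_dominates_lnorm_finite[OF dom]] by metis
      have "norm (extension f) \<le> c * A"
      proof (rule tendsto_upperbound[OF tendsto_norm[OF lim[OF f]]])
        show "\<forall>\<^sub>F \<pi> in partitions. norm (riemann_sum f \<pi>) \<le> c * A"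
          unfolding eventually_partitions using norm_riemann_sum_le[OF b c dom A(1)] A(2)
          by (intro exI[of _ "{}"] exI[of _ 1]) auto
      qed (rule partitions_neq_bot)
      then show "ennreal (norm (extension f)) / ennreal c \<le> lnorm p UNIV x"
        using c A by (simp add: divide_ennreal ennreal_leI pos_divide_le_eq mult.commute)
    qed
    then have "ennreal c * (ennreal (norm (extension f)) / ennreal c) \<le> ennreal c * Cp_norm sX p f"
      by (rule mult_left_mono) simp
    moreover have "ennreal c * (ennreal (norm (extension f)) / ennreal c) = ennreal (norm (extension f))"
      using c by (simp add: divide_ennreal flip: ennreal_mult)
    ultimately show "ennreal (norm (extension f)) \<le> ennreal c * Cp_norm sX p f"
      by simp
  qed
qed

lemma sharp_extension: "sharp sX extension = (\<lambda>\<phi>. blinfun_apply (blinfun_apply S \<phi>))"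
  by (intro ext) (simp add: sharp_def extensionI[OF riemann_sum_fun_times] flip: op_def)

text \<open>The factor \<open>W\<close> moves from the coefficients \<open>\<phi> i\<close>, which
  thereby enter the unit ball at each point, to the vectors. This bounds the norm of the sum by
  \<open>W\<close> times the p-norm of \<open>x\<close>.\<close>

lemma Cp_dominates_sum_fun_times:
  assumes W: "0 < W" "\<And>\<omega>. lnorm (conj_index p) {..<n} (\<lambda>i. apply_bcontfun (\<phi> i) \<omega>) \<le> ennreal W"
  shows "Cp_dominates sX p (\<Sum>i<n. fun_times sX (\<phi> i) (x i)) (\<lambda>i. if i \<in> {..<n} then W *\<^sub>R x i else 0)"
  unfolding Cp_dominates_def
proof
  define x' where "x' i = (if i \<in> {..<n} then W *\<^sub>R x i else 0)" for i
  have "x' \<in> c_zero"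
    unfolding c_zero_def mem_Collect_eq
    by (rule tendsto_eventually) (auto simp: x'_def eventually_sequentially intro!: exI[of _ n])
  moreover have "lnorm p UNIV x' \<le> ennreal (\<Sum>i<n. norm (W *\<^sub>R x i))"
    unfolding x'_def lnorm_if[OF p] using lnorm_le_sum[OF p, of "{..<n}" "\<lambda>i. W *\<^sub>R x i"] by simp
  then have "x' \<in> ell p"
    unfolding ell_def by (simp add: le_less_trans[OF _ ennreal_less_top])
  ultimately show "(\<lambda>i. if i \<in> {..<n} then W *\<^sub>R x i else 0) \<in> (if p = \<infinity> then c_zero else ell p)"
    unfolding x'_def by simp
  show "range (apply_bcontfun (\<Sum>i<n. fun_times sX (\<phi> i) (x i))) \<subseteq>
    {y. \<exists>\<alpha>. lnorm (conj_index p) UNIV \<alpha> \<le> 1 \<and>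
      (\<lambda>i. sX (\<alpha> i) (if i \<in> {..<n} then W *\<^sub>R x i else 0)) sums y}"
  proof clarify
    fix \<omega>
    define \<alpha> where "\<alpha> i = (if i \<in> {..<n} then inverse W *\<^sub>R apply_bcontfun (\<phi> i) \<omega> else 0)" for i
    have "lnorm (conj_index p) {..<n} (\<lambda>i. inverse W *\<^sub>R apply_bcontfun (\<phi> i) \<omega>) \<le> ennreal (inverse W * W)"
      by (rule lnorm_scale_le[OF q _ W(2)]) (use W in auto)
    then have "lnorm (conj_index p) UNIV \<alpha> \<le> 1"
      unfolding \<alpha>_def lnorm_if[OF q] using W by simp
    moreover have "(\<lambda>i. if i \<in> {..<n} then sX (apply_bcontfun (\<phi> i) \<omega>) (x i) else 0) sums
        (\<Sum>i<n. sX (apply_bcontfun (\<phi> i) \<omega>) (x i))"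
      by (rule sums_If_finite_set) simp
    moreover have "sX (inverse W *\<^sub>R a) (W *\<^sub>R y) = sX a y" for a y
      using W by (simp add: X.scale_scaleR scaleR_conv_of_real)
    then have "(\<lambda>i. sX (\<alpha> i) (if i \<in> {..<n} then W *\<^sub>R x i else 0)) =
        (\<lambda>i. if i \<in> {..<n} then sX (apply_bcontfun (\<phi> i) \<omega>) (x i) else 0)"
      by (auto simp: \<alpha>_def)
    ultimately have "(\<lambda>i. sX (\<alpha> i) (if i \<in> {..<n} then W *\<^sub>R x i else 0)) sums
        apply_bcontfun (\<Sum>i<n. fun_times sX (\<phi> i) (x i)) \<omega>" "lnorm (conj_index p) UNIV \<alpha> \<le> 1"
      by (simp_all add: apply_bcontfun_sum X.apply_fun_times)
    then show "\<exists>\<alpha>. lnorm (conj_index p) UNIV \<alpha> \<le> 1 \<and>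
      (\<lambda>i. sX (\<alpha> i) (if i \<in> {..<n} then W *\<^sub>R x i else 0)) sums
        apply_bcontfun (\<Sum>i<n. fun_times sX (\<phi> i) (x i)) \<omega>"
      by blast
  qed
qed

end


section \<open>Weak summability conditions\<close>

lemma lnorm_finite:
  assumes "1 \<le> p" "finite I"
  obtains A where "0 \<le> A" "lnorm p I x = ennreal A"
  using lnorm_le_sum[OF assms, of x] by (cases "lnorm p I x") (auto simp: top_unique)

lemma wnorm_scale_le:
  assumes q: "1 \<le> q" and C: "0 \<le> C" "wnorm sX q I x \<le> ennreal C"
    and a: "0 \<le> a" "\<And>i. i \<in> I \<Longrightarrow> y i = a *\<^sub>R x i"
  shows "wnorm sX q I y \<le> ennreal (a * C)"
  unfolding wnorm_le_iff
proof
  fix f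
  assume "f \<in> dual_ball sX"
  then show "lnorm q I (\<lambda>i. blinfun_apply f (y i)) \<le> ennreal (a * C)"
    using C a unfolding wnorm_le_iff
    by (intro lnorm_scale_le[OF q, of C I "\<lambda>i. blinfun_apply f (x i)"]) (auto simp: blinfun.scaleR_right)
qed

lemma wnorm_if:
  fixes sX :: "'k::real_or_complex \<Rightarrow> 'x::real_normed_vector \<Rightarrow> 'x"
  assumes q: "1 \<le> q"
  shows "wnorm sX q I (\<lambda>i. if i \<in> J then x i else 0) = wnorm sX q (I \<inter> J) x"
proof -
  have "(\<lambda>i. blinfun_apply f (if i \<in> J then x i else 0)) = (\<lambda>i. if i \<in> J then blinfun_apply f (x i) else 0)"
    for f :: "'x \<Rightarrow>\<^sub>L 'k"
    by (auto simp: blinfun.zero_right)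
  then show ?thesis
    by (simp add: wnorm_def lnorm_if[OF q])
qed

lemma wnorm_reindex_le:
  assumes q: "1 \<le> q" and g: "inj_on g I"
  shows "wnorm sX q I (\<lambda>i. x (g i)) \<le> wnorm sX q UNIV x"
  unfolding wnorm_def
proof (rule SUP_mono')
  fix f
  show "lnorm q I (\<lambda>i. blinfun_apply f (x (g i))) \<le> lnorm q UNIV (\<lambda>i. blinfun_apply f (x i))"
    using lnorm_reindex[OF g, of q "\<lambda>i. blinfun_apply f (x i)"]
      lnorm_mono[OF q, of "g ` I" UNIV "\<lambda>i. blinfun_apply f (x i)" "\<lambda>i. blinfun_apply f (x i)"]
    by simp
qed

lemma ell_u_iff:
  assumes q: "1 \<le> q"
  shows "x \<in> ell_u sX q \<longleftrightarrow> x \<in> ell_w sX q \<and> (\<lambda>N. wnorm sX q {N..} x) \<longlonglongrightarrow> 0"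
proof -
  have "(\<lambda>i. x i - (if i < N then x i else 0)) = (\<lambda>i. if i \<in> {N..} then x i else 0)" for N
    by auto
  then have "wnorm sX q UNIV (\<lambda>i. x i - (if i < N then x i else 0)) = wnorm sX q {N..} x" for N
    by (simp only: wnorm_if[OF q] Int_UNIV_left)
  then show ?thesis
    by (simp add: ell_u_def)
qed

lemma tendsto_zero_ennrealI:
  assumes "\<And>e. 0 < e \<Longrightarrow> eventually (\<lambda>n. f n \<le> ennreal e) F"
  shows "(f \<longlongrightarrow> 0) F"
proof (rule order_tendstoI)
  fix a :: ennreal
  assume a: "0 < a"
  obtain e where "0 < e" "ennreal e < a"
  proof (cases a)
    case (real r)
    then show ?thesis
      using a by (intro that[of "r / 2"]) (auto simp: ennreal_less_iff)
  next
    case top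
    then show ?thesis
      by (intro that[of 1]) auto
  qed
  then show "eventually (\<lambda>n. f n < a) F"
    using assms[OF \<open>0 < e\<close>] by (auto elim!: eventually_mono intro: le_less_trans)
qed simp

lemma tendsto_zero_ennrealD:
  assumes "(f \<longlongrightarrow> (0::ennreal)) F" "0 < e"
  shows "eventually (\<lambda>n. f n \<le> ennreal e) F"
  using order_tendstoD(2)[OF assms(1), of "ennreal e"] assms(2) by (auto elim: eventually_mono)

text \<open>Converse of \<open>wnorm_less_top\<close>, by rescaling a functional into the dual ball;
  the divisor \<open>norm f + 1\<close> is positive even for \<open>f = 0\<close>.\<close>

lemma (in normed_over) ell_wI:
  assumes q: "1 \<le> q" and fin: "wnorm scale q UNIV x < \<infinity>"
  shows "x \<in> ell_w scale q"
  unfolding ell_w_def ell_def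
proof (intro CollectI ballI)
  fix f
  assume f: "f \<in> bounded_ops scale (*)"
  obtain C where C: "0 \<le> C" "wnorm scale q UNIV x = ennreal C"
    using fin by (cases "wnorm scale q UNIV x") auto
  define a where "a = norm f + 1"
  have a: "0 < a" "norm f \<le> a"
    by (simp_all add: a_def add_nonneg_pos)
  define g where "g = inverse a *\<^sub>R f"
  have "norm g \<le> 1"
    using a by (simp add: g_def field_simps)
  moreover have "g \<in> bounded_ops scale (*)"
    unfolding g_def using subspace_bounded_ops_scalars f by (rule real_vector.subspace_scale)
  ultimately have "lnorm q UNIV (\<lambda>i. blinfun_apply g (x i)) \<le> ennreal C"
    using C(2) wnorm_le_iff[of scale q UNIV x "ennreal C"] by (simp add: dual_ball_def)
  then have "lnorm q UNIV (\<lambda>i. blinfun_apply f (x i)) \<le> ennreal (a * C)"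
    by (rule lnorm_scale_le[OF q C(1)]) (use a in \<open>auto simp: g_def blinfun.scaleR_left simp flip: mult.assoc\<close>)
  then show "lnorm q UNIV (\<lambda>i. blinfun_apply f (x i)) < \<infinity>"
    by (simp add: le_less_trans[OF _ ennreal_less_top])
qed

lemma c_zero_subset_ell_infinity: "c_zero \<subseteq> ell \<infinity>"
proof
  fix x :: "nat \<Rightarrow> 'a"
  assume "x \<in> c_zero"
  then have "Bseq x"
    unfolding c_zero_def by (intro convergent_imp_Bseq convergentI) auto
  then obtain B where "0 < B" "\<And>n. norm (x n) \<le> B"
    using BseqE by blast
  then have "lnorm \<infinity> UNIV x \<le> ennreal B"
    using lnorm_infinity_le_iff[of B UNIV x] by simp
  then show "x \<in> ell \<infinity>"
    by (simp add: ell_def le_less_trans[OF _ ennreal_less_top])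
qed

context C_operator
begin

sublocale CK: normed_over "scaleC (*) :: 'k \<Rightarrow> ('w \<Rightarrow>\<^sub>C 'k) \<Rightarrow> _"
  by (rule K.normed_over_scaleC)

section \<open>From an operator on C_p to (b)\<close>

lemma wnorm_finite:
  fixes \<phi> :: "nat \<Rightarrow> 'w \<Rightarrow>\<^sub>C 'k"
  assumes I: "finite I"
  obtains W where "0 \<le> W" "wnorm (scaleC (*)) (conj_index p) I \<phi> = ennreal W"
proof -
  have nonneg: "0 \<le> (\<Sum>i\<in>I. norm (\<phi> i))"
    by (simp add: sum_nonneg)
  have "wnorm (scaleC (*)) (conj_index p) I \<phi> \<le> ennreal (\<Sum>i\<in>I. norm (\<phi> i))"
  proof (rule wnorm_scaleC_le[OF q nonneg])
    fix \<omega>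
    show "lnorm (conj_index p) I (\<lambda>i. apply_bcontfun (\<phi> i) \<omega>) \<le> ennreal (\<Sum>i\<in>I. norm (\<phi> i))"
      by (rule order_trans[OF lnorm_le_sum[OF q I]]) (intro ennreal_leI sum_mono norm_bounded)
  qed
  then show thesis
    using that by (cases "wnorm (scaleC (*)) (conj_index p) I \<phi>") (auto simp: top_unique)
qed

lemma sum_fun_times_in_Cp:
  fixes \<phi> :: "nat \<Rightarrow> 'w \<Rightarrow>\<^sub>C 'k"
  shows "(\<Sum>i<n. fun_times sX (\<phi> i) (x i)) \<in> Cp sX p"
proof -
  obtain W where W: "0 \<le> W" "wnorm (scaleC (*)) (conj_index p) {..<n} \<phi> = ennreal W"
    using wnorm_finite[OF finite_lessThan] by blast
  have "lnorm (conj_index p) {..<n} (\<lambda>i. apply_bcontfun (\<phi> i) \<omega>) \<le> ennreal (W + 1)" for \<omega>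
    by (rule order_trans[OF lnorm_apply_le_wnorm]) (use W in \<open>simp add: ennreal_leI\<close>)
  then show ?thesis
    using Cp_dominates_sum_fun_times[of "W + 1" n \<phi> x] W unfolding Cp_def by auto
qed

text \<open>\<open>U\<close> is additive only on \<open>Cp\<close>, so partial sums must be known to
  lie there; the empty sum uses homogeneity with scalar 0.\<close>

lemma Cp_ops_sum_fun_times:
  fixes \<phi> :: "nat \<Rightarrow> 'w \<Rightarrow>\<^sub>C 'k"
  assumes U: "U \<in> Cp_ops sX sY p"
  shows "U (\<Sum>i<n. fun_times sX (\<phi> i) (x i)) = (\<Sum>i<n. U (fun_times sX (\<phi> i) (x i)))"
proof (induction n)
  case 0
  have "(0 :: 'w \<Rightarrow>\<^sub>C 'x) \<in> Cp sX p"
    using sum_fun_times_in_Cp[where n = 0] by simp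
  then have "U (scaleC sX 0 0) = sY 0 (U 0)"
    using U unfolding Cp_ops_def by blast
  moreover have "scaleC sX 0 (0 :: 'w \<Rightarrow>\<^sub>C 'x) = 0"
    by (rule bcontfun_eqI) (simp add: X.apply_scaleC)
  ultimately show ?case
    by simp
next
  case (Suc n)
  have "fun_times sX (\<phi> n) (x n) \<in> Cp sX p"
    using sum_fun_times_in_Cp[where n = 1 and \<phi> = "\<lambda>_. \<phi> n" and x = "\<lambda>_. x n"] by simp
  then show ?case
    using U sum_fun_times_in_Cp[of \<phi> x n] Suc by (simp add: Cp_ops_def)
qed

text \<open>A test \<open>(f, \<mu>)\<close> of the left side of (b), with phases \<open>t i\<close>
  absorbed into the vectors, equals \<open>f (U g)\<close> for
  \<open>g = \<Sum> \<phi> i (\<mu> i t i x i)\<close>. Since \<open>\<mu>\<close> has p-norm at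
  most 1, these vectors have p-norm at most the supremum norm of \<open>x\<close>.\<close>

lemma Cp_ops_imp_finite_bound:
  assumes U: "U \<in> Cp_ops sX sY p" and sharp: "sharp sX U = (\<lambda>\<phi>. blinfun_apply (blinfun_apply S \<phi>))"
  obtains c where "0 < c" "finite_bound c"
proof -
  have U_op: "U (fun_times sX \<phi> x) = op \<phi> x" for \<phi> x
    using sharp unfolding sharp_def op_def by metis
  obtain K0 :: real where K0: "\<And>f. f \<in> Cp sX p \<Longrightarrow> ennreal (norm (U f)) \<le> ennreal K0 * Cp_norm sX p f"
    using U unfolding Cp_ops_def by blast
  \<comment> \<open>\<open>K0\<close> may be nonpositive, while (b) asks for a positive
    constant.\<close>
  define K where "K = max K0 1"
  have K: "0 < K" "ennreal K0 \<le> ennreal K"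
    by (auto simp: K_def intro: ennreal_leI)
  have "finite_bound K"
    unfolding finite_bound_def
  proof (intro allI)
    fix n and x :: "nat \<Rightarrow> 'x" and \<phi> :: "nat \<Rightarrow> 'w \<Rightarrow>\<^sub>C 'k"
    obtain A where A: "0 \<le> A" "lnorm \<infinity> {..<n} x = ennreal A"
      using lnorm_finite[OF _ finite_lessThan, of \<infinity>] by auto
    obtain W0 where W0: "0 \<le> W0" "wnorm (scaleC (*)) (conj_index p) {..<n} \<phi> = ennreal W0"
      using wnorm_finite[OF finite_lessThan] by blast
    have KAW: "0 \<le> K * A * W0"
      using K A W0 by simp
    have "wnorm sY (conj_index p) {..<n} (\<lambda>i. op (\<phi> i) (x i)) \<le> ennreal (K * A * W0)"
      unfolding wnorm_le_iff lnorm_le_iff_dual[OF q KAW] conj_index_conj_index[OF p]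
    proof (intro ballI allI impI, elim conjE)
      fix f F and \<mu> :: "nat \<Rightarrow> real"
      assume f: "f \<in> dual_ball sY" and F: "finite F" "F \<subseteq> {..<n}"
        and \<mu>: "\<forall>i. 0 \<le> \<mu> i" "lnorm p F \<mu> \<le> 1"
      have "\<forall>i. \<exists>t. norm t \<le> 1 \<and>
          t * blinfun_apply f (op (\<phi> i) (x i)) = of_real (norm (blinfun_apply f (op (\<phi> i) (x i))))"
        using ex_unimodular_mult by metis
      then obtain t where t: "\<And>i. norm (t i) \<le> 1"
        "\<And>i. t i * blinfun_apply f (op (\<phi> i) (x i)) = of_real (norm (blinfun_apply f (op (\<phi> i) (x i))))"
        by metis
      define x' where "x' i = (if i \<in> F then sX (of_real (\<mu> i) * t i) (x i) else 0)" for i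
      define g where "g = (\<Sum>i<n. fun_times sX (\<phi> i) (x' i))"
      have g: "g \<in> Cp sX p"
        unfolding g_def by (rule sum_fun_times_in_Cp)
      have "U g = (\<Sum>i<n. op (\<phi> i) (x' i))"
        unfolding g_def Cp_ops_sum_fun_times[OF U] U_op ..
      also have "\<dots> = (\<Sum>i\<in>F. op (\<phi> i) (x' i))"
        using F by (intro sum.mono_neutral_right) (auto simp: x'_def op_zero_right)
      also have "\<dots> = (\<Sum>i\<in>F. sY (of_real (\<mu> i) * t i) (op (\<phi> i) (x i)))"
        by (intro sum.cong) (auto simp: x'_def op_scale)
      finally have "blinfun_apply f (U g) = (\<Sum>i\<in>F. of_real (\<mu> i) * t i * blinfun_apply f (op (\<phi> i) (x i)))"
        using f by (simp add: blinfun.sum_right dual_ball_def bounded_ops_def)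
      then have "blinfun_apply f (U g) = of_real (\<Sum>i\<in>F. \<mu> i * norm (blinfun_apply f (op (\<phi> i) (x i))))"
        by (simp add: mult.assoc t)
      then have "norm (blinfun_apply f (U g)) = \<bar>\<Sum>i\<in>F. \<mu> i * norm (blinfun_apply f (op (\<phi> i) (x i)))\<bar>"
        by (simp only: norm_of_real)
      then have "(\<Sum>i\<in>F. \<mu> i * norm (blinfun_apply f (op (\<phi> i) (x i)))) \<le> norm (blinfun_apply f (U g))"
        by linarith
      also have "\<dots> \<le> norm f * norm (U g)"
        by (rule norm_blinfun)
      also have "\<dots> \<le> 1 * norm (U g)"
        using f by (intro mult_right_mono) (auto simp: dual_ball_def)
      finally have le: "(\<Sum>i\<in>F. \<mu> i * norm (blinfun_apply f (op (\<phi> i) (x i)))) \<le> norm (U g)"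
        by simp
      have x'_A: "lnorm p {..<n} x' \<le> ennreal A"
      proof -
        have "lnorm p F (\<lambda>i. sX (of_real (\<mu> i) * t i) (x i)) \<le> ennreal (A * 1)"
        proof (rule lnorm_scale_le[OF p, of 1 F \<mu>])
          fix i
          assume i: "i \<in> F"
          then have "norm (x i) \<le> A"
            using A lnorm_infinity_le_iff[of A "{..<n}" x] F by auto
          then have "norm (t i) * norm (x i) \<le> 1 * A"
            using t A by (intro mult_mono) auto
          then have "\<mu> i * (norm (t i) * norm (x i)) \<le> \<mu> i * A"
            using \<mu> by (intro mult_left_mono) auto
          then show "norm (sX (of_real (\<mu> i) * t i) (x i)) \<le> A * norm (\<mu> i)"
            using \<mu> by (simp add: X.norm_scale norm_mult mult_ac)
        qed (use \<mu> A in auto)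
        moreover have "{..<n} \<inter> F = F"
          using F by blast
        ultimately show ?thesis
          unfolding x'_def lnorm_if[OF p] by simp
      qed
      \<comment> \<open>\<open>W0\<close> may be 0, but domination needs a positive factor; hence
        all \<open>W > W0\<close> and a limit afterwards.\<close>
      have bound: "norm (U g) \<le> K * A * W" if W: "W0 < W" for W
      proof -
        have W_pos: "0 < W"
          using W W0 by simp
        define z where "z i = (if i \<in> {..<n} then W *\<^sub>R x' i else 0)" for i
        have "lnorm (conj_index p) {..<n} (\<lambda>i. apply_bcontfun (\<phi> i) \<omega>) \<le> ennreal W" for \<omega>
          by (rule order_trans[OF lnorm_apply_le_wnorm]) (use W W0 in \<open>simp add: ennreal_leI\<close>)
        then have "Cp_dominates sX p g z"
          unfolding g_def z_def by (rule Cp_dominates_sum_fun_times[OF W_pos])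
        then have "Cp_norm sX p g \<le> lnorm p UNIV z"
          unfolding Cp_norm_def by (intro INF_lower) simp
        also have "\<dots> \<le> ennreal (W * A)"
          unfolding z_def lnorm_if[OF p]
          by (rule lnorm_scale_le[OF p A(1), of _ x']) (use W_pos x'_A in auto)
        finally have "ennreal K0 * Cp_norm sX p g \<le> ennreal K * ennreal (W * A)"
          using K by (intro mult_mono) auto
        also have "\<dots> = ennreal (K * A * W)"
          using K W_pos A by (simp add: ennreal_mult[symmetric] mult_ac)
        finally have "ennreal (norm (U g)) \<le> ennreal (K * A * W)"
          using K0[OF g] by (rule order_trans[rotated])
        then show ?thesis
          using K W_pos A by (simp add: ennreal_le_iff)
      qed
      have "((\<lambda>W. K * A * W) \<longlongrightarrow> K * A * W0) (at_right W0)"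
        by (intro tendsto_intros)
      then have "norm (U g) \<le> K * A * W0"
        by (rule tendsto_lowerbound) (auto intro!: eventually_mono[OF eventually_at_right_less] bound)
      then show "(\<Sum>i\<in>F. \<mu> i * norm (blinfun_apply f (op (\<phi> i) (x i)))) \<le> K * A * W0"
        using le by simp
    qed
    then show "wnorm sY (conj_index p) {..<n} (\<lambda>i. op (\<phi> i) (x i))
          \<le> ennreal K * lnorm \<infinity> {..<n} x * wnorm (scaleC (*)) (conj_index p) {..<n} \<phi>"
      unfolding A W0 using K A W0 by (simp add: ennreal_mult)
  qed
  then show thesis
    using that K by blast
qed

text \<open>Zero padding off \<open>I\<close>, then exhaustion by initial segments.\<close>

lemma finite_bound_wnorm_le:
  assumes b: "finite_bound c" and c: "0 < c"
    and A: "0 \<le> A" "lnorm \<infinity> I x \<le> ennreal A"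
    and W: "0 \<le> W" "wnorm (scaleC (*)) (conj_index p) I \<phi> \<le> ennreal W"
  shows "wnorm sY (conj_index p) I (\<lambda>i. op (\<phi> i) (x i)) \<le> ennreal (c * A * W)"
  unfolding wnorm_le_iff
proof
  fix f
  assume f: "f \<in> dual_ball sY"
  have cAW: "0 \<le> c * A * W"
    using A W c by simp
  show "lnorm (conj_index p) I (\<lambda>i. blinfun_apply f (op (\<phi> i) (x i))) \<le> ennreal (c * A * W)"
  proof (rule lnorm_lessThan_Int_le[OF q cAW])
    fix N
    define x' where "x' i = (if i \<in> I then x i else 0)" for i
    define \<phi>' where "\<phi>' i = (if i \<in> I then \<phi> i else 0)" for i
    have "lnorm \<infinity> {..<N} x' \<le> ennreal A"
      unfolding x'_def by (subst lnorm_if, simp, rule order_trans[OF lnorm_mono A(2)]) auto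
    moreover have "wnorm (scaleC (*)) (conj_index p) {..<N} \<phi>' \<le> ennreal W"
    proof -
      have "wnorm (scaleC (*)) (conj_index p) ({..<N} \<inter> I) \<phi> \<le> wnorm (scaleC (*)) (conj_index p) I \<phi>"
        unfolding wnorm_def by (intro SUP_mono' lnorm_mono[OF q]) auto
      then show ?thesis
        unfolding \<phi>'_def wnorm_if[OF q] using W(2) by (rule order_trans)
    qed
    ultimately have "ennreal c * lnorm \<infinity> {..<N} x' * wnorm (scaleC (*)) (conj_index p) {..<N} \<phi>' \<le>
        ennreal c * ennreal A * ennreal W"
      by (intro mult_mono) auto
    also have "\<dots> = ennreal (c * A * W)"
      using c A W by (simp add: ennreal_mult)
    finally have "wnorm sY (conj_index p) {..<N} (\<lambda>i. op (\<phi>' i) (x' i)) \<le> ennreal (c * A * W)"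
      using b unfolding finite_bound_def by (meson order_trans)
    then have "lnorm (conj_index p) {..<N} (\<lambda>i. blinfun_apply f (op (\<phi>' i) (x' i))) \<le> ennreal (c * A * W)"
      using f unfolding wnorm_le_iff by blast
    moreover have "lnorm (conj_index p) (I \<inter> {..<N}) (\<lambda>i. blinfun_apply f (op (\<phi> i) (x i))) \<le>
        lnorm (conj_index p) {..<N} (\<lambda>i. blinfun_apply f (op (\<phi>' i) (x' i)))"
      by (rule lnorm_mono[OF q]) (auto simp: x'_def \<phi>'_def)
    ultimately show "lnorm (conj_index p) (I \<inter> {..<N}) (\<lambda>i. blinfun_apply f (op (\<phi> i) (x i))) \<le> ennreal (c * A * W)"
      by (rule order_trans[rotated])
  qed
qed

text \<open>A violated bound leaves some \<open>op (\<phi> i) (x i)\<close> nonzero, so both norms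
  of the system are positive and can be divided out.\<close>

lemma not_finite_bound_normalized:
  assumes c: "0 < c" and not_b: "\<not> finite_bound c"
  obtains n x \<phi> where "lnorm \<infinity> {..<n} x \<le> 1" "wnorm (scaleC (*)) (conj_index p) {..<n} \<phi> \<le> 1"
    "\<not> wnorm sY (conj_index p) {..<n} (\<lambda>i. op (\<phi> i) (x i)) \<le> ennreal c"
proof -
  obtain n x \<phi> where not_le: "\<not> wnorm sY (conj_index p) {..<n} (\<lambda>i. op (\<phi> i) (x i))
      \<le> ennreal c * lnorm \<infinity> {..<n} x * wnorm (scaleC (*)) (conj_index p) {..<n} \<phi>"
    using not_b unfolding finite_bound_def by blast
  obtain A where A: "0 \<le> A" "lnorm \<infinity> {..<n} x = ennreal A"
    using lnorm_finite[OF _ finite_lessThan, of \<infinity>] by auto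
  obtain W where W: "0 \<le> W" "wnorm (scaleC (*)) (conj_index p) {..<n} \<phi> = ennreal W"
    using wnorm_finite[OF finite_lessThan] by blast
  have not_le': "\<not> wnorm sY (conj_index p) {..<n} (\<lambda>i. op (\<phi> i) (x i)) \<le> ennreal (c * A * W)"
    using not_le A W c by (simp add: ennreal_mult)
  have "\<exists>i<n. op (\<phi> i) (x i) \<noteq> 0"
  proof (rule ccontr)
    assume "\<not> (\<exists>i<n. op (\<phi> i) (x i) \<noteq> 0)"
    then have "wnorm sY (conj_index p) {..<n} (\<lambda>i. op (\<phi> i) (x i)) \<le> ennreal (c * A * W)"
      unfolding wnorm_le_iff by (auto intro!: order_trans[OF lnorm_le_sum[OF q]] simp: blinfun.zero_right)
    then show False
      using not_le' by blast
  qed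
  then obtain i where i: "i < n" "op (\<phi> i) (x i) \<noteq> 0"
    by blast
  have "norm (x i) \<le> A"
    using A lnorm_infinity_le_iff[of A "{..<n}" x] i by auto
  then have A_pos: "0 < A"
    using i by (metis norm_le_zero_iff not_less op_zero_right order_trans)
  have W_pos: "0 < W"
  proof (rule ccontr)
    assume "\<not> 0 < W"
    then have "lnorm (conj_index p) {..<n} (\<lambda>i. apply_bcontfun (\<phi> i) \<omega>) \<le> ennreal 0" for \<omega>
      using lnorm_apply_le_wnorm[of "conj_index p" "{..<n}" \<phi> \<omega>] W by (simp add: ennreal_neg)
    then have "norm (apply_bcontfun (\<phi> i) \<omega>) \<le> 0" for \<omega>
      by (rule norm_le_of_lnorm_le[OF q, rotated]) (use i in auto)
    then have "\<phi> i = 0"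
      by (intro bcontfun_eqI) simp
    then show False
      using i op_zero_left by simp
  qed
  show thesis
  proof
    show "lnorm \<infinity> {..<n} (\<lambda>i. inverse A *\<^sub>R x i) \<le> 1"
      using lnorm_scale_le[of \<infinity> A "{..<n}" x "inverse A" "\<lambda>i. inverse A *\<^sub>R x i"] A A_pos by simp
    show "wnorm (scaleC (*)) (conj_index p) {..<n} (\<lambda>i. inverse W *\<^sub>R \<phi> i) \<le> 1"
      using wnorm_scale_le[OF q W(1), of "scaleC (*)" "{..<n}" \<phi> "inverse W" "\<lambda>i. inverse W *\<^sub>R \<phi> i"] W W_pos by simp
    show "\<not> wnorm sY (conj_index p) {..<n} (\<lambda>i. op (inverse W *\<^sub>R \<phi> i) (inverse A *\<^sub>R x i)) \<le> ennreal c"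
    proof
      assume "wnorm sY (conj_index p) {..<n} (\<lambda>i. op (inverse W *\<^sub>R \<phi> i) (inverse A *\<^sub>R x i)) \<le> ennreal c"
      then have "wnorm sY (conj_index p) {..<n} (\<lambda>i. op (\<phi> i) (x i)) \<le> ennreal (A * W * c)"
        by (rule wnorm_scale_le[OF q less_imp_le[OF c]])
          (use A_pos W_pos in \<open>auto simp: op_def blinfun.scaleR_right blinfun.scaleR_left field_simps\<close>)
      then show False
        using not_le' by (simp add: mult_ac)
    qed
  qed
qed

end

section \<open>Counterexample sequences when (b) fails\<close>

lemma sum_inverse_powers_2_le: "(\<Sum>k\<in>{K..<L}. 1 / 2 ^ k) \<le> (2 / 2 ^ K :: real)"
proof (cases "K \<le> L")
  case True
  have "(\<Sum>k\<in>{K..<L}. 1 / 2 ^ k) = (2 / 2 ^ K - 2 / 2 ^ L :: real)"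
    using True
  proof (induction L rule: dec_induct)
    case (step L)
    have "(2 / 2 ^ L :: real) = 1 / 2 ^ L + 2 / 2 ^ Suc L"
      by simp
    then show ?case
      using step by simp
  qed simp
  then show ?thesis
    by simp
qed simp

context C_operator
begin

lemma ex_bad_sequences:
  assumes not_b: "\<And>c. 0 < c \<Longrightarrow> \<not> finite_bound c"
  obtains x \<phi> where "x \<in> c_zero" "\<phi> \<in> ell_u (scaleC (*)) (conj_index p)"
    "(\<lambda>i. op (\<phi> i) (x i)) \<notin> ell_w sY (conj_index p)"
proof -
  define R where "R k n x \<phi> \<longleftrightarrow> lnorm \<infinity> {..<n} x \<le> 1 \<and> wnorm (scaleC (*)) (conj_index p) {..<n} \<phi> \<le> 1 \<and>
      \<not> wnorm sY (conj_index p) {..<n} (\<lambda>i. op (\<phi> i) (x i)) \<le> ennreal (8 ^ k)" for k n :: nat and x \<phi>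
  have "\<exists>n x \<phi>. R k n x \<phi>" for k
    unfolding R_def by (rule not_finite_bound_normalized[of "8 ^ k", OF _ not_b]) (simp, simp, blast)
  then obtain n X \<Phi> where R: "\<And>k. R k (n k) (X k) (\<Phi> k)"
    by metis
  have X: "lnorm \<infinity> {..<n k} (X k) \<le> 1"
    and \<Phi>: "wnorm (scaleC (*)) (conj_index p) {..<n k} (\<Phi> k) \<le> 1"
    and large: "\<not> wnorm sY (conj_index p) {..<n k} (\<lambda>i. op (\<Phi> k i) (X k i)) \<le> ennreal (8 ^ k)" for k
    using R[of k] by (auto simp: R_def)
  \<comment> \<open>The pairing function lays out all systems in one sequence: index
    \<open>i\<close> is place \<open>pos i\<close> of system \<open>block i\<close>, and places
    beyond its length are filled with 0.\<close>
  define block where "block i = fst (prod_decode i)" for i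
  define pos where "pos i = snd (prod_decode i)" for i
  define valid where "valid i \<longleftrightarrow> pos i < n (block i)" for i
  define x where "x i = (if valid i then (1 / 2 ^ block i) *\<^sub>R X (block i) (pos i) else 0)" for i
  define \<phi> where "\<phi> i = (if valid i then (1 / 2 ^ block i) *\<^sub>R \<Phi> (block i) (pos i) else 0)" for i
  have encode: "block (prod_encode (k, j)) = k" "pos (prod_encode (k, j)) = j" for k j
    by (simp_all add: block_def pos_def)
  have decode: "i = prod_encode (block i, pos i)" for i
    by (simp add: block_def pos_def)
  \<comment> \<open>Systems are interleaved, but each is finite, so late indices meet only late
    systems or zeros.\<close>
  have tail: "\<exists>N. \<forall>i\<ge>N. valid i \<longrightarrow> K \<le> block i" for K
  proof -
    have "{i. valid i \<and> block i < K} \<subseteq> prod_encode ` (SIGMA k:{..<K}. {..<n k})"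
    proof
      fix i
      assume "i \<in> {i. valid i \<and> block i < K}"
      then show "i \<in> prod_encode ` (SIGMA k:{..<K}. {..<n k})"
        using decode[of i] by (intro image_eqI[of _ _ "(block i, pos i)"]) (auto simp: valid_def)
    qed
    then have "finite {i. valid i \<and> block i < K}"
      by (rule finite_subset) auto
    then obtain N where "{i. valid i \<and> block i < K} \<subseteq> {..<N}"
      using finite_nat_bounded by blast
    then show ?thesis
      by (intro exI[of _ N]) (force simp: subset_iff)
  qed
  have "x \<in> c_zero"
    unfolding c_zero_def mem_Collect_eq
  proof (rule LIMSEQ_I)
    fix e :: real
    assume e: "0 < e"
    obtain K where K: "1 / 2 ^ K < e"
      using real_arch_pow_inv[OF e, of "1 / 2"] by (auto simp: power_divide)
    obtain N where N: "\<forall>i\<ge>N. valid i \<longrightarrow> K \<le> block i"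
      using tail by blast
    have "norm (x i) < e" if "N \<le> i" for i
    proof (cases "valid i")
      case True
      have "norm (X (block i) (pos i)) \<le> 1"
        using X[of "block i"] lnorm_infinity_le_iff[of 1 "{..<n (block i)}" "X (block i)"] True
        by (auto simp: valid_def)
      then have "norm (x i) \<le> 1 / 2 ^ block i"
        using True by (simp add: x_def divide_right_mono)
      also have "\<dots> \<le> 1 / 2 ^ K"
        using N that True by (intro divide_left_mono power_increasing) auto
      finally show ?thesis
        using K by simp
    qed (use e in \<open>simp add: x_def\<close>)
    then show "\<exists>N. \<forall>i\<ge>N. norm (x i - 0) < e"
      by auto
  qed
  \<comment> \<open>System \<open>k\<close> contributes at most 2^-k to any test; the geometric sum
    from \<open>K\<close> on gives \<open>2 / 2 ^ K\<close>.\<close>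
  have \<phi>_tail: "wnorm (scaleC (*)) (conj_index p) {N..} \<phi> \<le> ennreal (2 / 2 ^ K)"
    if N: "\<forall>i\<ge>N. valid i \<longrightarrow> K \<le> block i" for N K
  proof -
    have nonneg: "0 \<le> (2 / 2 ^ K :: real)"
      by simp
    show ?thesis
      unfolding wnorm_le_iff lnorm_le_iff_dual[OF q nonneg]
    proof (intro ballI allI impI, elim conjE)
      fix f :: "('w \<Rightarrow>\<^sub>C 'k) \<Rightarrow>\<^sub>L 'k" and F and \<mu> :: "nat \<Rightarrow> real"
      assume f: "f \<in> dual_ball (scaleC (*))" and F: "finite F" "F \<subseteq> {N..}"
        and \<mu>: "\<forall>i. 0 \<le> \<mu> i" "lnorm (conj_index (conj_index p)) F \<mu> \<le> 1"
      define G where "G k = {i \<in> F. valid i \<and> block i = k}" for k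
      define v where "v i = norm (blinfun_apply f (\<Phi> (block i) (pos i)))" for i
      have block_le: "(\<Sum>i\<in>G k. \<mu> i * v i) \<le> 1" for k
      proof -
        define g where "g j = prod_encode (k, j)" for j
        have g: "inj_on g {..<n k}"
          by (auto simp: g_def inj_on_def)
        have G: "G k \<subseteq> g ` {..<n k}"
        proof
          fix i
          assume "i \<in> G k"
          then show "i \<in> g ` {..<n k}"
            using decode[of i] by (intro image_eqI[of _ _ "pos i"]) (auto simp: G_def g_def valid_def)
        qed
        have "lnorm (conj_index p) {..<n k} (\<lambda>j. blinfun_apply f (\<Phi> k j)) \<le> ennreal 1"
          using \<Phi>[of k] f unfolding wnorm_le_iff by simp
        then have "lnorm (conj_index p) (g ` {..<n k}) (\<lambda>i. blinfun_apply f (\<Phi> k (pos i))) \<le> ennreal 1"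
          unfolding lnorm_reindex[OF g] by (simp add: g_def encode)
        moreover have "lnorm (conj_index (conj_index p)) (G k) \<mu> \<le> 1"
          by (rule order_trans[OF lnorm_mono \<mu>(2)]) (auto simp: G_def one_le_conj_index q)
        moreover have "finite (G k)"
          using F by (simp add: G_def)
        ultimately have "(\<Sum>i\<in>G k. \<mu> i * norm (blinfun_apply f (\<Phi> k (pos i)))) \<le> 1"
          using lnorm_le_iff_dual[OF q, of 1 "g ` {..<n k}" "\<lambda>i. blinfun_apply f (\<Phi> k (pos i))",
              THEN iffD1, rule_format, of "G k" \<mu>] G \<mu>(1) by simp
        moreover have "(\<Sum>i\<in>G k. \<mu> i * v i) = (\<Sum>i\<in>G k. \<mu> i * norm (blinfun_apply f (\<Phi> k (pos i))))"
          by (rule sum.cong) (auto simp: G_def v_def)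
        ultimately show ?thesis
          by simp
      qed
      obtain L where L: "block ` F \<subseteq> {..<L}"
        using F finite_nat_bounded by blast
      define F' where "F' = {i \<in> F. valid i}"
      have "(\<Sum>i\<in>F. \<mu> i * norm (blinfun_apply f (\<phi> i))) = (\<Sum>i\<in>F'. \<mu> i * v i / 2 ^ block i)"
        unfolding F'_def using F
        by (intro sum.mono_neutral_cong_right) (auto simp: \<phi>_def v_def blinfun.scaleR_right blinfun.zero_right)
      also have "\<dots> = (\<Sum>k\<in>{K..<L}. \<Sum>i\<in>{i \<in> F'. block i = k}. \<mu> i * v i / 2 ^ block i)"
      proof (rule sum.group[symmetric])
        show "block ` F' \<subseteq> {K..<L}"
        proof clarify
          fix i
          assume "i \<in> F'"
          then have "i \<in> F" "valid i"
            by (auto simp: F'_def)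
          moreover from this have "N \<le> i"
            using F by auto
          ultimately show "block i \<in> {K..<L}"
            using N L by auto
        qed
      qed (use F in \<open>auto simp: F'_def\<close>)
      also have "\<dots> = (\<Sum>k\<in>{K..<L}. (\<Sum>i\<in>G k. \<mu> i * v i) / 2 ^ k)"
      proof (rule sum.cong)
        fix k
        have "{i \<in> F'. block i = k} = G k"
          by (auto simp: F'_def G_def)
        then show "(\<Sum>i\<in>{i \<in> F'. block i = k}. \<mu> i * v i / 2 ^ block i) = (\<Sum>i\<in>G k. \<mu> i * v i) / 2 ^ k"
          by (simp add: sum_divide_distrib G_def)
      qed simp
      also have "\<dots> \<le> (\<Sum>k\<in>{K..<L}. 1 / 2 ^ k)"
        using block_le by (intro sum_mono divide_right_mono) auto
      also have "\<dots> \<le> 2 / 2 ^ K"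
        by (rule sum_inverse_powers_2_le)
      finally show "(\<Sum>i\<in>F. \<mu> i * norm (blinfun_apply f (\<phi> i))) \<le> 2 / 2 ^ K" .
    qed
  qed
  have "\<phi> \<in> ell_w (scaleC (*)) (conj_index p)"
  proof (rule CK.ell_wI[OF q])
    have "wnorm (scaleC (*)) (conj_index p) {0..} \<phi> \<le> ennreal (2 / 2 ^ 0)"
      by (rule \<phi>_tail) simp
    then show "wnorm (scaleC (*)) (conj_index p) UNIV \<phi> < \<infinity>"
      by (simp add: atLeast_0 le_less_trans[OF _ ennreal_less_top] del: ennreal_numeral)
  qed
  moreover have "(\<lambda>N. wnorm (scaleC (*)) (conj_index p) {N..} \<phi>) \<longlonglongrightarrow> 0"
  proof (rule tendsto_zero_ennrealI)
    fix e :: real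
    assume e: "0 < e"
    obtain K where K: "(1 / 2) ^ K < e / 2"
      using real_arch_pow_inv[of "e / 2" "1 / 2"] e by auto
    obtain N where N: "\<forall>i\<ge>N. valid i \<longrightarrow> K \<le> block i"
      using tail by blast
    have "wnorm (scaleC (*)) (conj_index p) {M..} \<phi> \<le> ennreal e" if "N \<le> M" for M
    proof -
      have "wnorm (scaleC (*)) (conj_index p) {M..} \<phi> \<le> ennreal (2 / 2 ^ K)"
        using N that by (intro \<phi>_tail) auto
      also have "\<dots> \<le> ennreal e"
        using K by (intro ennreal_leI) (simp add: power_divide)
      finally show ?thesis .
    qed
    then show "\<forall>\<^sub>F M in sequentially. wnorm (scaleC (*)) (conj_index p) {M..} \<phi> \<le> ennreal e"
      by (auto simp: eventually_sequentially)
  qed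
  ultimately have "\<phi> \<in> ell_u (scaleC (*)) (conj_index p)"
    by (simp add: ell_u_iff[OF q])
  moreover have "(\<lambda>i. op (\<phi> i) (x i)) \<notin> ell_w sY (conj_index p)"
  proof
    assume "(\<lambda>i. op (\<phi> i) (x i)) \<in> ell_w sY (conj_index p)"
    from Y.wnorm_less_top[OF q this]
    obtain B where B: "0 \<le> B" "wnorm sY (conj_index p) UNIV (\<lambda>i. op (\<phi> i) (x i)) = ennreal B"
      by (cases "wnorm sY (conj_index p) UNIV (\<lambda>i. op (\<phi> i) (x i))") auto
    \<comment> \<open>Undoing both scalings multiplies by 4^k, and 4^k \<open>B\<close> stays below
      8^k, contrary to the choice of system \<open>k\<close>.\<close>
    obtain k where k: "B < 2 ^ k"
      using real_arch_pow[of 2 B] by auto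
    define g where "g j = prod_encode (k, j)" for j
    have "inj_on g {..<n k}"
      by (auto simp: g_def inj_on_def)
    then have "wnorm sY (conj_index p) {..<n k} (\<lambda>j. op (\<phi> (g j)) (x (g j))) \<le> ennreal B"
      using wnorm_reindex_le[OF q, of g "{..<n k}" sY "\<lambda>i. op (\<phi> i) (x i)"] B(2) by simp
    then have "wnorm sY (conj_index p) {..<n k} (\<lambda>j. op (\<Phi> k j) (X k j)) \<le> ennreal (4 ^ k * B)"
    proof (rule wnorm_scale_le[OF q B(1)])
      show "op (\<Phi> k j) (X k j) = 4 ^ k *\<^sub>R op (\<phi> (g j)) (x (g j))" if "j \<in> {..<n k}" for j
      proof -
        have "(4 ^ k :: real) = 2 ^ k * 2 ^ k"
          by (simp flip: power_mult_distrib)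
        then show ?thesis
          using that by (simp add: \<phi>_def x_def g_def encode valid_def op_def blinfun.scaleR_right blinfun.scaleR_left)
      qed
    qed simp
    also have "\<dots> \<le> ennreal (4 ^ k * 2 ^ k)"
      using k by (intro ennreal_leI mult_left_mono) auto
    also have "\<dots> = ennreal (8 ^ k)"
      by (simp flip: power_mult_distrib)
    finally show False
      using large by blast
  qed
  ultimately show thesis
    using that \<open>x \<in> c_zero\<close> by blast
qed

section \<open>Summability statements from (b)\<close>

lemma ell_w_op:
  assumes b: "finite_bound c" "0 < c" and x: "x \<in> ell \<infinity>" and \<phi>: "\<phi> \<in> ell_w (scaleC (*)) (conj_index p)"
  shows "(\<lambda>i. op (\<phi> i) (x i)) \<in> ell_w sY (conj_index p)"
proof (rule Y.ell_wI[OF q])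
  obtain A where A: "0 \<le> A" "lnorm \<infinity> UNIV x = ennreal A"
    using x lnorm_realE unfolding ell_def by blast
  obtain W where W: "0 \<le> W" "wnorm (scaleC (*)) (conj_index p) UNIV \<phi> = ennreal W"
    using CK.wnorm_less_top[OF q \<phi>] by (cases "wnorm (scaleC (*)) (conj_index p) UNIV \<phi>") auto
  have "wnorm sY (conj_index p) UNIV (\<lambda>i. op (\<phi> i) (x i)) \<le> ennreal (c * A * W)"
    using A W by (intro finite_bound_wnorm_le[OF b]) auto
  then show "wnorm sY (conj_index p) UNIV (\<lambda>i. op (\<phi> i) (x i)) < \<infinity>"
    by (simp add: le_less_trans[OF _ ennreal_less_top])
qed

text \<open>The bounds are made strictly positive because tolerances are later divided by
  them.\<close>

lemma lnorm_wnorm_tails: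
  fixes x :: "nat \<Rightarrow> 'x" and \<phi> :: "nat \<Rightarrow> 'w \<Rightarrow>\<^sub>C 'k"
  assumes x: "x \<in> ell \<infinity>" and \<phi>: "\<phi> \<in> ell_w (scaleC (*)) (conj_index p)"
  obtains A W where "0 < A" "\<And>n. lnorm \<infinity> {n..} x \<le> ennreal A"
    "0 < W" "\<And>n. wnorm (scaleC (*)) (conj_index p) {n..} \<phi> \<le> ennreal W"
proof -
  obtain A where A: "0 \<le> A" "lnorm \<infinity> UNIV x = ennreal A"
    using x lnorm_realE unfolding ell_def by blast
  obtain W where W: "0 \<le> W" "wnorm (scaleC (*)) (conj_index p) UNIV \<phi> = ennreal W"
    using CK.wnorm_less_top[OF q \<phi>] by (cases "wnorm (scaleC (*)) (conj_index p) UNIV \<phi>") auto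
  show thesis
  proof
    show "lnorm \<infinity> {n..} x \<le> ennreal (A + 1)" for n
      by (rule order_trans[OF lnorm_mono[of \<infinity> _ UNIV x x]]) (use A in \<open>auto intro: ennreal_leI\<close>)
    show "wnorm (scaleC (*)) (conj_index p) {n..} \<phi> \<le> ennreal (W + 1)" for n
    proof -
      have "wnorm (scaleC (*)) (conj_index p) {n..} \<phi> \<le> wnorm (scaleC (*)) (conj_index p) UNIV \<phi>"
        unfolding wnorm_def by (intro SUP_mono' lnorm_mono[OF q]) auto
      also have "\<dots> \<le> ennreal (W + 1)"
        unfolding W(2) by (intro ennreal_leI) simp
      finally show ?thesis .
    qed
  qed (use A W in auto)
qed

lemma tail_bound:
  assumes b: "finite_bound c" "0 < c" and x: "x \<in> ell \<infinity>" and \<phi>: "\<phi> \<in> ell_w (scaleC (*)) (conj_index p)"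
  shows "wnorm sY (conj_index p) {n..} (\<lambda>i. op (\<phi> i) (x i))
    \<le> ennreal c * lnorm \<infinity> {n..} x * wnorm (scaleC (*)) (conj_index p) {n..} \<phi>"
proof -
  obtain A' W' where le: "\<And>n. lnorm \<infinity> {n..} x \<le> ennreal A'" "\<And>n. wnorm (scaleC (*)) (conj_index p) {n..} \<phi> \<le> ennreal W'"
    using lnorm_wnorm_tails[OF x \<phi>] by metis
  obtain A W where A: "0 \<le> A" "lnorm \<infinity> {n..} x = ennreal A"
    and W: "0 \<le> W" "wnorm (scaleC (*)) (conj_index p) {n..} \<phi> = ennreal W"
    using le[of n] by (cases "lnorm \<infinity> {n..} x"; cases "wnorm (scaleC (*)) (conj_index p) {n..} \<phi>") (auto simp: top_unique)
  have "wnorm sY (conj_index p) {n..} (\<lambda>i. op (\<phi> i) (x i)) \<le> ennreal (c * A * W)"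
    using A W by (intro finite_bound_wnorm_le[OF b]) auto
  also have "\<dots> = ennreal c * lnorm \<infinity> {n..} x * wnorm (scaleC (*)) (conj_index p) {n..} \<phi>"
    unfolding A(2) W(2) using A(1) W(1) b by (simp add: ennreal_mult)
  finally show ?thesis .
qed

text \<open>In the product bound on tails, \<open>x\<close> supplies the small factor.\<close>

lemma ell_u_op_c_zero:
  assumes b: "finite_bound c" "0 < c" and x: "x \<in> c_zero" and \<phi>: "\<phi> \<in> ell_w (scaleC (*)) (conj_index p)"
  shows "(\<lambda>i. op (\<phi> i) (x i)) \<in> ell_u sY (conj_index p)"
  unfolding ell_u_iff[OF q]
proof
  have x': "x \<in> ell \<infinity>"
    using x c_zero_subset_ell_infinity by blast
  then show "(\<lambda>i. op (\<phi> i) (x i)) \<in> ell_w sY (conj_index p)"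
    by (rule ell_w_op[OF b _ \<phi>])
  obtain A W where W: "0 < W" "\<And>n. wnorm (scaleC (*)) (conj_index p) {n..} \<phi> \<le> ennreal W"
    using lnorm_wnorm_tails[OF x' \<phi>] by metis
  show "(\<lambda>N. wnorm sY (conj_index p) {N..} (\<lambda>i. op (\<phi> i) (x i))) \<longlonglongrightarrow> 0"
  proof (rule tendsto_zero_ennrealI)
    fix e :: real
    assume e: "0 < e"
    define d where "d = e / (c * W)"
    have d: "0 < d" "c * d * W = e"
      using e b W by (simp_all add: d_def)
    obtain N where N: "lnorm \<infinity> {N..} x \<le> ennreal d"
      using lnorm_atLeast_small[of \<infinity> x d] x d by auto
    have "wnorm sY (conj_index p) {M..} (\<lambda>i. op (\<phi> i) (x i)) \<le> ennreal (c * d * W)" if "N \<le> M" for M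
    proof (rule finite_bound_wnorm_le[OF b])
      show "lnorm \<infinity> {M..} x \<le> ennreal d"
        by (rule order_trans[OF lnorm_mono N]) (use that in auto)
    qed (use d W in auto)
    then show "\<forall>\<^sub>F M in sequentially. wnorm sY (conj_index p) {M..} (\<lambda>i. op (\<phi> i) (x i)) \<le> ennreal e"
      unfolding d eventually_sequentially by blast
  qed
qed

text \<open>Here \<open>\<phi>\<close> supplies the small factor and \<open>x\<close> a bounded
  one.\<close>

lemma ell_u_op_ell_u:
  assumes b: "finite_bound c" "0 < c" and x: "x \<in> ell \<infinity>" and \<phi>: "\<phi> \<in> ell_u (scaleC (*)) (conj_index p)"
  shows "(\<lambda>i. op (\<phi> i) (x i)) \<in> ell_u sY (conj_index p)"
  unfolding ell_u_iff[OF q]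
proof
  have \<phi>': "\<phi> \<in> ell_w (scaleC (*)) (conj_index p)"
    and lim: "(\<lambda>N. wnorm (scaleC (*)) (conj_index p) {N..} \<phi>) \<longlonglongrightarrow> 0"
    using \<phi> unfolding ell_u_iff[OF q] by auto
  then show "(\<lambda>i. op (\<phi> i) (x i)) \<in> ell_w sY (conj_index p)"
    using ell_w_op[OF b x] by blast
  obtain A W where A: "0 < A" "\<And>n. lnorm \<infinity> {n..} x \<le> ennreal A"
    using lnorm_wnorm_tails[OF x \<phi>'] by metis
  show "(\<lambda>N. wnorm sY (conj_index p) {N..} (\<lambda>i. op (\<phi> i) (x i))) \<longlonglongrightarrow> 0"
  proof (rule tendsto_zero_ennrealI)
    fix e :: real
    assume e: "0 < e"
    define d where "d = e / (c * A)"
    have d: "0 < d" "c * A * d = e"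
      using e b A by (simp_all add: d_def)
    have "\<forall>\<^sub>F M in sequentially. wnorm (scaleC (*)) (conj_index p) {M..} \<phi> \<le> ennreal d"
      by (rule tendsto_zero_ennrealD[OF lim d(1)])
    then show "\<forall>\<^sub>F M in sequentially. wnorm sY (conj_index p) {M..} (\<lambda>i. op (\<phi> i) (x i)) \<le> ennreal e"
    proof (rule eventually_mono)
      fix M
      assume "wnorm (scaleC (*)) (conj_index p) {M..} \<phi> \<le> ennreal d"
      then have "wnorm sY (conj_index p) {M..} (\<lambda>i. op (\<phi> i) (x i)) \<le> ennreal (c * A * d)"
        using A d by (intro finite_bound_wnorm_le[OF b]) auto
      then show "wnorm sY (conj_index p) {M..} (\<lambda>i. op (\<phi> i) (x i)) \<le> ennreal e"
        by (simp add: d)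
    qed
  qed
qed

end

theorem corollary3p4:
  fixes sX :: "'k::real_or_complex \<Rightarrow> 'x::banach \<Rightarrow> 'x"
    and sY :: "'k \<Rightarrow> 'y::banach \<Rightarrow> 'y"
    and p :: ennreal
    and S :: "('w::t2_space \<Rightarrow>\<^sub>C 'k) \<Rightarrow>\<^sub>L ('x \<Rightarrow>\<^sub>L 'y)"
  assumes X: "banach_over sX"
    and Y: "banach_over sY"
    and Omega: "compact (UNIV :: 'w set)"
    and p: "1 \<le> p"
    and S: "S \<in> C_op_ops sX sY"
  defines "q \<equiv> conj_index p"
  defines "a \<equiv> \<exists>U\<in>Cp_ops sX sY p. sharp sX U = (\<lambda>\<phi>. blinfun_apply (blinfun_apply S \<phi>))"
    and "b \<equiv> \<exists>c::real. c > 0 \<and>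
      (\<forall>(n::nat) (x :: nat \<Rightarrow> 'x) (\<phi> :: nat \<Rightarrow> 'w \<Rightarrow>\<^sub>C 'k).
        wnorm sY q {..<n} (\<lambda>i. blinfun_apply (blinfun_apply S (\<phi> i)) (x i))
          \<le> ennreal c * lnorm \<infinity> {..<n} x * wnorm (scaleC (*)) q {..<n} \<phi>)"
    and "b' \<equiv> \<exists>c::real. c > 0 \<and>
      (\<forall>x\<in>ell \<infinity>. \<forall>\<phi>\<in>ell_w (scaleC (*)) q. \<forall>n::nat.
        wnorm sY q {n..} (\<lambda>i. blinfun_apply (blinfun_apply S (\<phi> i)) (x i))
          \<le> ennreal c * lnorm \<infinity> {n..} x * wnorm (scaleC (*)) q {n..} \<phi>)"
    and "c \<equiv> \<forall>x\<in>ell \<infinity>. \<forall>\<phi>\<in>ell_w (scaleC (*)) q.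
      (\<lambda>i. blinfun_apply (blinfun_apply S (\<phi> i)) (x i)) \<in> ell_w sY q"
    and "d \<equiv> \<forall>x\<in>c_zero. \<forall>\<phi>\<in>ell_w (scaleC (*)) q.
      (\<lambda>i. blinfun_apply (blinfun_apply S (\<phi> i)) (x i)) \<in> ell_u sY q"
    and "d_alt \<equiv> \<forall>x\<in>ell \<infinity>. \<forall>\<phi>\<in>ell_u (scaleC (*)) q.
      (\<lambda>i. blinfun_apply (blinfun_apply S (\<phi> i)) (x i)) \<in> ell_u sY q"
  shows "(a \<longleftrightarrow> b) \<and> (a \<longleftrightarrow> b') \<and> (a \<longleftrightarrow> c) \<and> (a \<longleftrightarrow> d) \<and> (a \<longleftrightarrow> d_alt)"
proof -
  interpret C_operator sX sY p S
    using X Y p S Omega by (intro C_operator.intro C_operator_axioms.intro)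
  have b_iff: "b \<longleftrightarrow> (\<exists>c>0. finite_bound c)"
    by (simp add: b_def q_def finite_bound_def op_def)
  have "a \<Longrightarrow> b"
    unfolding b_iff a_def using Cp_ops_imp_finite_bound by blast
  moreover have "b \<Longrightarrow> a"
    unfolding b_iff a_def using extension_in_Cp_ops sharp_extension by blast
  moreover have "b \<Longrightarrow> b'"
    unfolding b_iff b'_def q_def op_def[symmetric] using tail_bound by blast
  \<comment> \<open>The case \<open>n = 0\<close> suffices, since both factors on the right are
    finite.\<close>
  moreover have c if prem: b'
  proof -
    obtain c0 :: real where bound: "\<And>x \<phi> n. x \<in> ell \<infinity> \<Longrightarrow> \<phi> \<in> ell_w (scaleC (*)) (conj_index p) \<Longrightarrow>
        wnorm sY (conj_index p) {n..} (\<lambda>i. op (\<phi> i) (x i))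
          \<le> ennreal c0 * lnorm \<infinity> {n..} x * wnorm (scaleC (*)) (conj_index p) {n..} \<phi>"
      using prem unfolding b'_def q_def op_def[symmetric] by blast
    show c
      unfolding c_def q_def op_def[symmetric]
    proof (intro ballI)
      fix x :: "nat \<Rightarrow> 'x" and \<phi> :: "nat \<Rightarrow> 'w \<Rightarrow>\<^sub>C 'k"
      assume x: "x \<in> ell \<infinity>" and \<phi>: "\<phi> \<in> ell_w (scaleC (*)) (conj_index p)"
      have "ennreal c0 * lnorm \<infinity> UNIV x * wnorm (scaleC (*)) (conj_index p) UNIV \<phi> < \<infinity>"
        using x CK.wnorm_less_top[OF q \<phi>] by (auto simp: ell_def ennreal_mult_less_top)
      then show "(\<lambda>i. op (\<phi> i) (x i)) \<in> ell_w sY (conj_index p)"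
        using bound[OF x \<phi>, of 0] by (intro Y.ell_wI[OF q]) (simp add: atLeast_0 le_less_trans)
    qed
  qed
  moreover have "b \<Longrightarrow> d"
    unfolding b_iff d_def q_def op_def[symmetric] using ell_u_op_c_zero by blast
  moreover have "b \<Longrightarrow> d_alt"
    unfolding b_iff d_alt_def q_def op_def[symmetric] using ell_u_op_ell_u by blast
  \<comment> \<open>One pair of sequences refutes all three conditions: it satisfies the strongest
    hypotheses, and its image fails even the weakest conclusion.\<close>
  moreover have b if "c \<or> d \<or> d_alt"
  proof (rule ccontr)
    assume "\<not> b"
    then obtain x \<phi> where x: "x \<in> c_zero" and \<phi>: "\<phi> \<in> ell_u (scaleC (*)) (conj_index p)"
      and bad: "(\<lambda>i. op (\<phi> i) (x i)) \<notin> ell_w sY (conj_index p)"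
      unfolding b_iff using ex_bad_sequences by metis
    moreover have "x \<in> ell \<infinity>" "\<phi> \<in> ell_w (scaleC (*)) (conj_index p)"
      using x \<phi> c_zero_subset_ell_infinity by (auto simp: ell_u_def)
    moreover have "(\<lambda>i. op (\<phi> i) (x i)) \<notin> ell_u sY (conj_index p)"
      using bad by (simp add: ell_u_def)
    ultimately show False
      using that unfolding c_def d_def d_alt_def q_def op_def[symmetric] by blast
  qed
  ultimately show ?thesis
    by blast
qed

end
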